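(* Let $\Omega\subseteq\mathbb{R}^d$ be a domain that is $H^2$ regular for the Laplacian, and let $I=[0,T]$ be a finite time interval. Let $f\in L^2(I,L^2(\Omega))$, $g\in H^{3/2}(\partial\Omega)$ and $u_0\in H^1_0(\Omega)$, and let $u_f$ denote the solution of the parabolic problem $$d_tu-\Delta u=f\ \text{ in }I\times\Omega,\qquad u(t)|_{\partial\Omega}=g\ \text{ for all }t\in I,\qquad u(0)=u_0.$$ Let $$\mathcal{X}=H^1(I,L^2(\Omega))\cap L^2(I,H^2(\Omega)\cap H^1_g(\Omega)),\qquad \lVert u\rVert_{\mathcal{X}}=\lVert d_tu\rVert_{L^2(I,L^2(\Omega))}+\lVert u\rVert_{L^2(I,H^2(\Omega))}.$$ Let $\Theta\subseteq\mathbb{R}^N$ be a parameter set and $\theta\mapsto u_\theta$ a map from $\Theta$ into $\mathcal{X}$ with $u_\theta(0)=u_0$ for every $\theta\in\Theta$, so that both initial and boundary conditions are satisfied exactly. Define $$\mathcal{L}(\theta)=\lVert d_tu_\theta-\Delta u_\theta-f\rVert_{L^2(I,L^2(\Omega))}^2,\qquad\theta\in\Theta.$$ Then there is a constant $C$, independent of $\theta$, such that for all $\theta\in\Theta$ $$\lVert u_\theta-u_f\rVert_{\mathcal{X}}\le C\sqrt{\mathcal{L}(\theta)}.$$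
   Context: $\Omega$ is $H^2$ regular for the Laplacian if there is a constant $C_{\mathrm{reg}}>0$ with $\lVert u\rVert_{H^2(\Omega)}\le C_{\mathrm{reg}}\lVert\Delta u\rVert_{L^2(\Omega)}$ for all $u\in H^2(\Omega)\cap H^1_0(\Omega)$, the Dirichlet problem for the Laplacian with right-hand side in $L^2(\Omega)$ and boundary values in $H^{3/2}(\partial\Omega)$ being well posed with solution in $H^2(\Omega)$. $H^1_g(\Omega)$ is the affine subspace of $H^1(\Omega)$ of functions that agree with $g$ on $\partial\Omega$ (trace sense), and $H^1_0(\Omega)$ is the space of $H^1(\Omega)$ functions with zero boundary values. $L^2(I,V)$ is the Bochner space of Bochner measurable, square integrable functions on $I$ with values in $V$; $H^1(I,V)$ is the Sobolev space modelled on $L^2(I,V)$, and $d_t$ is the time derivative. The family $\{u_\theta\}_{\theta\in\Theta}$ (a neural network class) is an arbitrary parametric family; no further structure is assumed. *)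

theory Defs
  imports "HOL-Analysis.Analysis" "HOL-Library.Function_Algebras"
begin

text \<open>
  The classical function spaces are rendered as sets of representatives: elements of \<open>L2 \<Omega>\<close> are
  functions on the whole space whose values outside \<open>\<Omega>\<close> are irrelevant, and equality almost
  everywhere on \<open>\<Omega>\<close> is expressed by a vanishing seminorm.  With the pointwise vector space
  structure on functions, the library's integral of simple functions with values in a real vector
  space applies to functions of time with values in such a space.
\<close>

instantiation "fun" :: (type, real_vector) real_vector
begin

definition scaleR_fun :: "real \<Rightarrow> ('a \<Rightarrow> 'b) \<Rightarrow> 'a \<Rightarrow> 'b"
  where "scaleR_fun c f = (\<lambda>x. c *\<^sub>R f x)"

instance
  by standard (simp_all add: scaleR_fun_def fun_eq_iff scaleR_add_right scaleR_add_left)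

end


section \<open>Test functions and weak derivatives\<close>

fun C_k :: "nat \<Rightarrow> ('a::euclidean_space \<Rightarrow> real) \<Rightarrow> bool" where
  "C_k 0 \<phi> \<longleftrightarrow> continuous_on UNIV \<phi>"
| "C_k (Suc k) \<phi> \<longleftrightarrow>
     \<phi> differentiable_on UNIV \<and> (\<forall>b\<in>Basis. C_k k (\<lambda>x. frechet_derivative \<phi> (at x) b))"

definition test_function :: "'a::euclidean_space set \<Rightarrow> ('a \<Rightarrow> real) \<Rightarrow> bool" where
  "test_function \<Omega> \<phi> \<longleftrightarrow>
     (\<forall>k. C_k k \<phi>) \<and> (\<exists>K. compact K \<and> K \<subseteq> \<Omega> \<and> (\<forall>x. x \<notin> K \<longrightarrow> \<phi> x = 0))"

definition L2 :: "'a::euclidean_space set \<Rightarrow> ('a \<Rightarrow> real) set" where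
  "L2 \<Omega> = {u \<in> borel_measurable (lebesgue_on \<Omega>). integrable (lebesgue_on \<Omega>) (\<lambda>x. (u x)\<^sup>2)}"

definition L2_norm :: "'a::euclidean_space set \<Rightarrow> ('a \<Rightarrow> real) \<Rightarrow> real" where
  "L2_norm \<Omega> u = sqrt (\<integral>x. (u x)\<^sup>2 \<partial>lebesgue_on \<Omega>)"

definition has_weak_partial ::
  "'a::euclidean_space set \<Rightarrow> 'a \<Rightarrow> ('a \<Rightarrow> real) \<Rightarrow> ('a \<Rightarrow> real) \<Rightarrow> bool" where
  "has_weak_partial \<Omega> b u v \<longleftrightarrow>
     (\<forall>\<phi>. test_function \<Omega> \<phi> \<longrightarrow>
        (\<integral>x. u x * frechet_derivative \<phi> (at x) b \<partial>lebesgue_on \<Omega>)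
          = - (\<integral>x. v x * \<phi> x \<partial>lebesgue_on \<Omega>))"

definition weak_partial :: "'a::euclidean_space set \<Rightarrow> 'a \<Rightarrow> ('a \<Rightarrow> real) \<Rightarrow> 'a \<Rightarrow> real" where
  "weak_partial \<Omega> b u = (SOME v. v \<in> L2 \<Omega> \<and> has_weak_partial \<Omega> b u v)"


section \<open>Sobolev spaces\<close>

definition H1 :: "'a::euclidean_space set \<Rightarrow> ('a \<Rightarrow> real) set" where
  "H1 \<Omega> = {u \<in> L2 \<Omega>. \<forall>b\<in>Basis. \<exists>v\<in>L2 \<Omega>. has_weak_partial \<Omega> b u v}"

definition H2 :: "'a::euclidean_space set \<Rightarrow> ('a \<Rightarrow> real) set" where
  "H2 \<Omega> = {u \<in> H1 \<Omega>. \<forall>b\<in>Basis. weak_partial \<Omega> b u \<in> H1 \<Omega>}"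

definition H1_norm :: "'a::euclidean_space set \<Rightarrow> ('a \<Rightarrow> real) \<Rightarrow> real" where
  "H1_norm \<Omega> u = sqrt ((L2_norm \<Omega> u)\<^sup>2 + (\<Sum>b\<in>Basis. (L2_norm \<Omega> (weak_partial \<Omega> b u))\<^sup>2))"

definition H2_norm :: "'a::euclidean_space set \<Rightarrow> ('a \<Rightarrow> real) \<Rightarrow> real" where
  "H2_norm \<Omega> u = sqrt ((L2_norm \<Omega> u)\<^sup>2 + (\<Sum>b\<in>Basis. (L2_norm \<Omega> (weak_partial \<Omega> b u))\<^sup>2)
     + (\<Sum>b\<in>Basis. \<Sum>c\<in>Basis. (L2_norm \<Omega> (weak_partial \<Omega> c (weak_partial \<Omega> b u)))\<^sup>2))"

definition laplacian :: "'a::euclidean_space set \<Rightarrow> ('a \<Rightarrow> real) \<Rightarrow> 'a \<Rightarrow> real" where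
  "laplacian \<Omega> u = (\<Sum>b\<in>Basis. weak_partial \<Omega> b (weak_partial \<Omega> b u))"

definition H1_0 :: "'a::euclidean_space set \<Rightarrow> ('a \<Rightarrow> real) set" where
  "H1_0 \<Omega> = {u \<in> H1 \<Omega>. \<exists>\<phi> :: nat \<Rightarrow> 'a \<Rightarrow> real.
     (\<forall>n. test_function \<Omega> (\<phi> n)) \<and> (\<lambda>n. H1_norm \<Omega> (\<phi> n - u)) \<longlonglongrightarrow> 0}"

text \<open>
  No regularity of the boundary is assumed, so the trace operator is the quotient map of
  \<open>H1 \<Omega>\<close> modulo \<open>H1_0 \<Omega>\<close>: the boundary values of a function are its coset.  On a Lipschitz domain
  the kernel of the classical trace operator is \<open>H1_0 \<Omega>\<close>, so these cosets correspond one-to-one to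
  the functions in \<open>H\<^sup>1\<^sup>/\<^sup>2(\<partial>\<Omega>)\<close>.  \<open>H\<^sup>3\<^sup>/\<^sup>2(\<partial>\<Omega>)\<close> is the space of traces of functions in \<open>H2 \<Omega>\<close>, with
  the quotient norm.
\<close>

definition boundary_trace :: "'a::euclidean_space set \<Rightarrow> ('a \<Rightarrow> real) \<Rightarrow> ('a \<Rightarrow> real) set" where
  "boundary_trace \<Omega> u = {v \<in> H1 \<Omega>. v - u \<in> H1_0 \<Omega>}"

definition H32_boundary :: "'a::euclidean_space set \<Rightarrow> ('a \<Rightarrow> real) set set" where
  "H32_boundary \<Omega> = boundary_trace \<Omega> ` H2 \<Omega>"

definition H32_boundary_norm :: "'a::euclidean_space set \<Rightarrow> ('a \<Rightarrow> real) set \<Rightarrow> real" where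
  "H32_boundary_norm \<Omega> g = (INF w\<in>{w \<in> H2 \<Omega>. boundary_trace \<Omega> w = g}. H2_norm \<Omega> w)"

definition H1_bc :: "'a::euclidean_space set \<Rightarrow> ('a \<Rightarrow> real) set \<Rightarrow> ('a \<Rightarrow> real) set" where
  "H1_bc \<Omega> g = {u \<in> H1 \<Omega>. boundary_trace \<Omega> u = g}"

definition dirichlet_solution ::
  "'a::euclidean_space set \<Rightarrow> ('a \<Rightarrow> real) \<Rightarrow> ('a \<Rightarrow> real) set \<Rightarrow> ('a \<Rightarrow> real) \<Rightarrow> bool" where
  "dirichlet_solution \<Omega> f g u \<longleftrightarrow>
     u \<in> H2 \<Omega> \<inter> H1_bc \<Omega> g \<and> (AE x in lebesgue_on \<Omega>. laplacian \<Omega> u x = f x)"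

definition H2_regular :: "'a::euclidean_space set \<Rightarrow> bool" where
  "H2_regular \<Omega> \<longleftrightarrow>
     (\<exists>C>0. \<forall>u \<in> H2 \<Omega> \<inter> H1_0 \<Omega>. H2_norm \<Omega> u \<le> C * L2_norm \<Omega> (laplacian \<Omega> u)) \<and>
     (\<forall>f \<in> L2 \<Omega>. \<forall>g \<in> H32_boundary \<Omega>. \<exists>u. dirichlet_solution \<Omega> f g u \<and>
        (\<forall>v. dirichlet_solution \<Omega> f g v \<longrightarrow> (AE x in lebesgue_on \<Omega>. v x = u x))) \<and>
     (\<exists>C>0. \<forall>f \<in> L2 \<Omega>. \<forall>g \<in> H32_boundary \<Omega>. \<forall>u. dirichlet_solution \<Omega> f g u \<longrightarrow>
        H2_norm \<Omega> u \<le> C * (L2_norm \<Omega> f + H32_boundary_norm \<Omega> g))"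


section \<open>Bochner spaces\<close>

text \<open>
  The definitions below follow the library's Bochner integral, with the norm of a type class
  replaced by a seminorm \<open>N\<close> on a set \<open>V\<close> of values.
\<close>

definition bochner_measurable ::
  "'t measure \<Rightarrow> 'v::real_vector set \<Rightarrow> ('v \<Rightarrow> real) \<Rightarrow> ('t \<Rightarrow> 'v) \<Rightarrow> bool" where
  "bochner_measurable M V N u \<longleftrightarrow>
     (\<exists>s :: nat \<Rightarrow> 't \<Rightarrow> 'v. (\<forall>i. simple_function M (s i) \<and> s i ` space M \<subseteq> V) \<and>
        (AE t in M. u t \<in> V \<and> (\<lambda>i. N (u t - s i t)) \<longlonglongrightarrow> 0))"

definition has_bochner_integral_in ::
  "'t measure \<Rightarrow> 'v::real_vector set \<Rightarrow> ('v \<Rightarrow> real) \<Rightarrow> ('t \<Rightarrow> 'v) \<Rightarrow> 'v \<Rightarrow> bool" where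
  "has_bochner_integral_in M V N u w \<longleftrightarrow>
     bochner_measurable M V N u \<and> w \<in> V \<and>
     (\<exists>s :: nat \<Rightarrow> 't \<Rightarrow> 'v.
        (\<forall>i. Bochner_Integration.simple_bochner_integrable M (s i) \<and> s i ` space M \<subseteq> V) \<and>
        (\<lambda>i. \<integral>\<^sup>+t. ennreal (N (u t - s i t)) \<partial>M) \<longlonglongrightarrow> 0 \<and>
        (\<lambda>i. N (Bochner_Integration.simple_bochner_integral M (s i) - w)) \<longlonglongrightarrow> 0)"

definition L2_time ::
  "real set \<Rightarrow> 'v::real_vector set \<Rightarrow> ('v \<Rightarrow> real) \<Rightarrow> (real \<Rightarrow> 'v) set" where
  "L2_time I V N = {u. bochner_measurable (lebesgue_on I) V N u \<and>
     integrable (lebesgue_on I) (\<lambda>t. (N (u t))\<^sup>2)}"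

definition L2_time_norm ::
  "real set \<Rightarrow> ('v \<Rightarrow> real) \<Rightarrow> (real \<Rightarrow> 'v) \<Rightarrow> real" where
  "L2_time_norm I N u = sqrt (\<integral>t. (N (u t))\<^sup>2 \<partial>lebesgue_on I)"

definition has_weak_time_deriv ::
  "real set \<Rightarrow> 'v::real_vector set \<Rightarrow> ('v \<Rightarrow> real) \<Rightarrow> (real \<Rightarrow> 'v) \<Rightarrow> (real \<Rightarrow> 'v) \<Rightarrow> bool" where
  "has_weak_time_deriv I V N u v \<longleftrightarrow>
     (\<forall>\<phi>. test_function (interior I) \<phi> \<longrightarrow>
        (\<exists>w. has_bochner_integral_in (lebesgue_on I) V N (\<lambda>t. deriv \<phi> t *\<^sub>R u t) w \<and>
             has_bochner_integral_in (lebesgue_on I) V N (\<lambda>t. \<phi> t *\<^sub>R v t) (- w)))"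

definition H1_time ::
  "real set \<Rightarrow> 'v::real_vector set \<Rightarrow> ('v \<Rightarrow> real) \<Rightarrow> (real \<Rightarrow> 'v) set" where
  "H1_time I V N = {u \<in> L2_time I V N. \<exists>v \<in> L2_time I V N. has_weak_time_deriv I V N u v}"

definition time_deriv ::
  "real set \<Rightarrow> 'v::real_vector set \<Rightarrow> ('v \<Rightarrow> real) \<Rightarrow> (real \<Rightarrow> 'v) \<Rightarrow> real \<Rightarrow> 'v" where
  "time_deriv I V N u = (SOME v. v \<in> L2_time I V N \<and> has_weak_time_deriv I V N u v)"

text \<open>
  Point evaluations of a function in \<open>H1_time\<close> refer to its continuous representative.
\<close>

definition continuous_representative ::
  "real set \<Rightarrow> 'v::real_vector set \<Rightarrow> ('v \<Rightarrow> real) \<Rightarrow> (real \<Rightarrow> 'v) \<Rightarrow> (real \<Rightarrow> 'v) \<Rightarrow> bool" where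
  "continuous_representative I V N u w \<longleftrightarrow>
     (AE t in lebesgue_on I. u t \<in> V \<and> N (u t - w t) = 0) \<and>
     (\<forall>t\<in>I. w t \<in> V \<and> ((\<lambda>s. N (w s - w t)) \<longlongrightarrow> 0) (at t within I))"


section \<open>The parabolic problem\<close>

abbreviation dt :: "'a::euclidean_space set \<Rightarrow> real \<Rightarrow> (real \<Rightarrow> 'a \<Rightarrow> real) \<Rightarrow> real \<Rightarrow> 'a \<Rightarrow> real" where
  "dt \<Omega> T \<equiv> time_deriv {0..T} (L2 \<Omega>) (L2_norm \<Omega>)"

definition X_space ::
  "'a::euclidean_space set \<Rightarrow> real \<Rightarrow> ('a \<Rightarrow> real) set \<Rightarrow> (real \<Rightarrow> 'a \<Rightarrow> real) set" where
  "X_space \<Omega> T g = H1_time {0..T} (L2 \<Omega>) (L2_norm \<Omega>) \<inter>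
     L2_time {0..T} (H2 \<Omega> \<inter> H1_bc \<Omega> g) (H2_norm \<Omega>)"

definition X_norm :: "'a::euclidean_space set \<Rightarrow> real \<Rightarrow> (real \<Rightarrow> 'a \<Rightarrow> real) \<Rightarrow> real" where
  "X_norm \<Omega> T u = L2_time_norm {0..T} (L2_norm \<Omega>) (dt \<Omega> T u) + L2_time_norm {0..T} (H2_norm \<Omega>) u"

definition has_initial_value ::
  "'a::euclidean_space set \<Rightarrow> real \<Rightarrow> (real \<Rightarrow> 'a \<Rightarrow> real) \<Rightarrow> ('a \<Rightarrow> real) \<Rightarrow> bool" where
  "has_initial_value \<Omega> T u u0 \<longleftrightarrow>
     (\<exists>w. continuous_representative {0..T} (L2 \<Omega>) (L2_norm \<Omega>) u w \<and>
        (AE x in lebesgue_on \<Omega>. w 0 x = u0 x))"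

definition has_boundary_values ::
  "'a::euclidean_space set \<Rightarrow> real \<Rightarrow> (real \<Rightarrow> 'a \<Rightarrow> real) \<Rightarrow> ('a \<Rightarrow> real) set \<Rightarrow> bool" where
  "has_boundary_values \<Omega> T u g \<longleftrightarrow>
     (\<exists>w. continuous_representative {0..T} (L2 \<Omega>) (L2_norm \<Omega>) u w \<and>
        (\<forall>t\<in>{0..T}. w t \<in> H1_bc \<Omega> g))"

definition parabolic_residual ::
  "'a::euclidean_space set \<Rightarrow> real \<Rightarrow> (real \<Rightarrow> 'a \<Rightarrow> real) \<Rightarrow> (real \<Rightarrow> 'a \<Rightarrow> real) \<Rightarrow> real \<Rightarrow> 'a \<Rightarrow> real" where
  "parabolic_residual \<Omega> T f u = (\<lambda>t. dt \<Omega> T u t - laplacian \<Omega> (u t) - f t)"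

definition parabolic_solution ::
  "'a::euclidean_space set \<Rightarrow> real \<Rightarrow> (real \<Rightarrow> 'a \<Rightarrow> real) \<Rightarrow> ('a \<Rightarrow> real) set \<Rightarrow> ('a \<Rightarrow> real) \<Rightarrow>
     (real \<Rightarrow> 'a \<Rightarrow> real) \<Rightarrow> bool" where
  "parabolic_solution \<Omega> T f g u0 u \<longleftrightarrow>
     u \<in> X_space \<Omega> T g \<and>
     (AE t in lebesgue_on {0..T}. AE x in lebesgue_on \<Omega>.
        dt \<Omega> T u t x - laplacian \<Omega> (u t) x = f t x) \<and>
     has_boundary_values \<Omega> T u g \<and>
     has_initial_value \<Omega> T u u0"

definition loss ::
  "'a::euclidean_space set \<Rightarrow> real \<Rightarrow> (real \<Rightarrow> 'a \<Rightarrow> real) \<Rightarrow> ('p \<Rightarrow> real \<Rightarrow> 'a \<Rightarrow> real) \<Rightarrow> 'p \<Rightarrow> real" where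
  "loss \<Omega> T f U \<theta> = (L2_time_norm {0..T} (L2_norm \<Omega>) (parabolic_residual \<Omega> T f (U \<theta>)))\<^sup>2"

end

theory Submission
  imports Defs
begin

text \<open>
  The difference \<open>v = u\<^sub>\<theta> - u\<^sub>f\<close> has zero boundary and initial values, and the residual of
  \<open>u\<^sub>\<theta>\<close> is \<open>d\<^sub>t v - \<Delta>v\<close>.  Formally \<open>-2 (d\<^sub>t v, \<Delta>v)\<close> is the time derivative of
  \<open>\<parallel>\<nabla>v\<parallel>\<^sup>2\<close>, which vanishes initially; hence the mixed term in the expansion of
  \<open>\<parallel>d\<^sub>t v - \<Delta>v\<parallel>\<^sup>2\<close> is nonnegative, the loss dominates both \<open>\<parallel>d\<^sub>t v\<parallel>\<^sup>2\<close> and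
  \<open>\<parallel>\<Delta>v\<parallel>\<^sup>2\<close>, and \<open>H\<^sup>2\<close> regularity bounds \<open>v\<close> in \<open>L\<^sup>2(I, H\<^sup>2)\<close> by \<open>\<Delta>v\<close>.

  To justify the sign of the mixed term, \<open>d\<^sub>t v\<close> is replaced by backward difference quotients of
  \<open>v\<close>, extended by zero to negative times.  Convexity of \<open>\<parallel>\<nabla>v\<parallel>\<^sup>2\<close> makes their pairing with
  \<open>\<Delta>v\<close> telescope, and they converge weakly to \<open>d\<^sub>t v\<close> by Lebesgue's differentiation theorem and
  Scheffe's lemma.
\<close>

section \<open>Smooth functions\<close>

text \<open>The time derivative of v is only known in L2, so it cannot be integrated by parts
  against the Laplacian of v. A difference quotient, by contrast, combines values of v itself, which
  lie in H2 and H1_0 for almost every t, where Green's formula applies. Backward quotients carry the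
  right sign: convexity is used at the later time, where the Laplacian is evaluated. The extension
  by zero is compatible with the weak derivative because v starts at 0.

  A second obstacle is that functions are representatives, and that \<open>weak_partial\<close> and
  \<open>time_deriv\<close> choose one derivative among many. Neither operator is literally linear,
  so uniqueness up to null sets, in space and in time, is what allows the passage from the two
  solutions to their difference. It rests on the fundamental lemma of the calculus of variations,
  hence on explicit test functions.

  Vector-valued functions of time are handled by pairing them with fixed vectors c, which turns
  statements about weak derivatives and increments into statements about real functions of
  t.\<close>

lemma C_k_SucI:
  fixes \<phi> :: "'a::euclidean_space \<Rightarrow> real"
  assumes "\<And>x. (\<phi> has_derivative D x) (at x)" and "\<And>b. b \<in> Basis \<Longrightarrow> C_k k (\<lambda>x. D x b)"
  shows "C_k (Suc k) \<phi>"
proof -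
  have "frechet_derivative \<phi> (at x) = D x" for x
    using assms(1) by (metis frechet_derivative_at)
  moreover have "\<phi> differentiable_on UNIV"
    using assms(1) by (auto simp: differentiable_on_def differentiable_def)
  ultimately show ?thesis
    using assms(2) by simp
qed

lemma C_k_Suc_has_derivative:
  assumes "C_k (Suc k) \<phi>"
  shows "(\<phi> has_derivative frechet_derivative \<phi> (at x)) (at x)"
  using assms by (auto simp: differentiable_on_def frechet_derivative_works)

lemma C_k_mono_Suc: "C_k (Suc k) \<phi> \<Longrightarrow> C_k k \<phi>"
  by (induction k arbitrary: \<phi>) (auto intro: differentiable_imp_continuous_on)

lemma C_k_const: "C_k k (\<lambda>x. c)"
proof (induction k arbitrary: c)
  case (Suc k)
  show ?case
    by (rule C_k_SucI[where D="\<lambda>_ _. 0"]) (auto intro: Suc)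
qed simp

lemma C_k_add: "C_k k \<phi> \<Longrightarrow> C_k k \<psi> \<Longrightarrow> C_k k (\<lambda>x. \<phi> x + \<psi> x)"
proof (induction k arbitrary: \<phi> \<psi>)
  case (Suc k)
  show ?case
  proof (rule C_k_SucI)
    show "((\<lambda>x. \<phi> x + \<psi> x) has_derivative
        (\<lambda>b. frechet_derivative \<phi> (at x) b + frechet_derivative \<psi> (at x) b)) (at x)" for x
      using Suc.prems by (intro has_derivative_add C_k_Suc_has_derivative)
    show "C_k k (\<lambda>x. frechet_derivative \<phi> (at x) b + frechet_derivative \<psi> (at x) b)"
      if "b \<in> Basis" for b
      using Suc.prems that by (intro Suc.IH) auto
  qed
qed (auto intro: continuous_on_add)

lemma C_k_mult: "C_k k \<phi> \<Longrightarrow> C_k k \<psi> \<Longrightarrow> C_k k (\<lambda>x. \<phi> x * \<psi> x)"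
proof (induction k arbitrary: \<phi> \<psi>)
  case (Suc k)
  show ?case
  proof (rule C_k_SucI)
    show "((\<lambda>x. \<phi> x * \<psi> x) has_derivative
        (\<lambda>b. \<phi> x * frechet_derivative \<psi> (at x) b + frechet_derivative \<phi> (at x) b * \<psi> x)) (at x)" for x
      using Suc.prems by (intro has_derivative_mult C_k_Suc_has_derivative)
    show "C_k k (\<lambda>x. \<phi> x * frechet_derivative \<psi> (at x) b + frechet_derivative \<phi> (at x) b * \<psi> x)"
      if "b \<in> Basis" for b
      using Suc.prems that by (intro C_k_add Suc.IH C_k_mono_Suc[of k \<phi>] C_k_mono_Suc[of k \<psi>]) auto
  qed
qed (auto intro: continuous_on_mult)

lemma C_k_diff: "C_k k \<phi> \<Longrightarrow> C_k k \<psi> \<Longrightarrow> C_k k (\<lambda>x. \<phi> x - \<psi> x)"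
  using C_k_add[of k \<phi> "\<lambda>x. -1 * \<psi> x"] C_k_mult[OF C_k_const[of k "-1"], of \<psi>] by simp

lemma C_k_prod:
  "finite I \<Longrightarrow> (\<And>i. i \<in> I \<Longrightarrow> C_k k (\<phi> i)) \<Longrightarrow> C_k k (\<lambda>x. \<Prod>i\<in>I. \<phi> i x)"
  by (induction I rule: finite_induct) (auto intro: C_k_const C_k_mult)

lemma C_k_Suc_realI:
  fixes s :: "real \<Rightarrow> real"
  assumes "\<And>x. (s has_real_derivative d x) (at x)" and "C_k k d"
  shows "C_k (Suc k) s"
proof (rule C_k_SucI)
  show "(s has_derivative (\<lambda>y. d x * y)) (at x)" for x
    using assms(1)[of x] by (simp add: has_field_derivative_def)
qed (use assms(2) in auto)

lemma frechet_derivative_real: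
  fixes s :: "real \<Rightarrow> real"
  assumes "s differentiable (at x)"
  shows "frechet_derivative s (at x) y = deriv s x * y"
  using assms by (metis DERIV_deriv_iff_real_differentiable frechet_derivative_at has_field_derivative_def)

text \<open>The chain rule for a one-dimensional profile along one direction. Cut-offs of boxes use
  it with coordinate directions, functions of time with \<open>'a = real\<close> and
  \<open>b = 1\<close>.\<close>

lemma C_k_affine:
  fixes s :: "real \<Rightarrow> real"
  shows "C_k k s \<Longrightarrow> C_k k (\<lambda>x::'a::euclidean_space. s (c * (x \<bullet> b) + a))"
proof (induction k arbitrary: s)
  case 0
  then show ?case
    by (auto intro!: continuous_intros continuous_on_compose2[of UNIV s])
next
  case (Suc k)
  have s: "(s has_real_derivative deriv s x) (at x)" for x
    using Suc.prems by (auto simp: differentiable_on_def DERIV_deriv_iff_real_differentiable)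
  show ?case
  proof (rule C_k_SucI)
    fix x :: 'a
    have "((\<lambda>x::'a. c * (x \<bullet> b) + a) has_derivative (\<lambda>y. c * (y \<bullet> b))) (at x)"
      by (auto intro!: derivative_eq_intros)
    from has_derivative_compose[OF this] s
    show "((\<lambda>x::'a. s (c * (x \<bullet> b) + a)) has_derivative (\<lambda>y. deriv s (c * (x \<bullet> b) + a) * (c * (y \<bullet> b)))) (at x)"
      unfolding has_field_derivative_def by auto
  next
    fix y :: 'a
    have "C_k k (\<lambda>x. frechet_derivative s (at x) 1)"
      using Suc.prems by simp
    then have "C_k k (deriv s)"
      using Suc.prems by (simp add: frechet_derivative_real differentiable_on_def)
    then show "C_k k (\<lambda>x::'a. deriv s (c * (x \<bullet> b) + a) * (c * (y \<bullet> b)))"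
      by (intro C_k_mult Suc.IH C_k_const)
  qed
qed

section \<open>Cut-off functions\<close>

text \<open>Polynomials in 1/x times exp(-1/x) form a family closed under differentiation, so
  flatness at 0 and smoothness can be proved for the whole family at once.\<close>

definition exp_germ :: "real poly \<Rightarrow> real \<Rightarrow> real" where
  "exp_germ p x = (if x > 0 then poly p (1/x) * exp (-1/x) else 0)"

lemma poly_times_exp_minus_tendsto_0: "((\<lambda>y::real. poly p y * exp (-y)) \<longlongrightarrow> 0) at_top"
proof -
  have "((\<lambda>y::real. \<Sum>i\<le>degree p. coeff p i * (y ^ i / exp y)) \<longlongrightarrow> (\<Sum>i\<le>degree p. coeff p i * 0)) at_top"
    by (intro tendsto_intros tendsto_power_div_exp_0)
  then show ?thesis
    by (simp add: poly_altdef sum_distrib_right exp_minus divide_inverse mult.assoc)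
qed

lemma exp_germ_tendsto_0: "(exp_germ p \<longlongrightarrow> 0) (at 0)"
proof -
  have "((\<lambda>x. poly p (1/x) * exp (- (1/x))) \<longlongrightarrow> 0) (at_right 0)"
    by (rule filterlim_compose[OF poly_times_exp_minus_tendsto_0])
       (simp add: filterlim_inverse_at_top_right flip: inverse_eq_divide)
  then have "(exp_germ p \<longlongrightarrow> 0) (at_right 0)"
    by (rule Lim_transform_eventually) (auto simp: exp_germ_def eventually_at_filter)
  moreover have "(exp_germ p \<longlongrightarrow> 0) (at_left 0)"
    by (rule Lim_transform_eventually[OF tendsto_const]) (auto simp: exp_germ_def eventually_at_filter)
  ultimately show ?thesis
    by (simp add: filterlim_split_at)
qed

text \<open>In the variable y = 1/x differentiation is -y^2 d/dy, which maps p(y) exp(-y) to y^2 (p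
  - p')(y) exp(-y); the two \<open>pCons 0\<close> are the factor y^2.\<close>

lemma exp_germ_has_derivative:
  "(exp_germ p has_real_derivative exp_germ (pCons 0 (pCons 0 (p - pderiv p))) x) (at x)"
proof -
  consider "x > 0" | "x < 0" | "x = 0" by linarith
  then show ?thesis
  proof cases
    case 1
    have "((\<lambda>x. poly p (1/x) * exp (-1/x)) has_real_derivative
        exp_germ (pCons 0 (pCons 0 (p - pderiv p))) x) (at x)"
      using 1 by (auto intro!: derivative_eq_intros simp: exp_germ_def field_simps power2_eq_square)
    then show ?thesis
      by (rule has_field_derivative_transform_within_open[where S="{0<..}"])
         (use 1 in \<open>auto simp: exp_germ_def\<close>)
  next
    case 2
    have "((\<lambda>x. 0) has_real_derivative exp_germ (pCons 0 (pCons 0 (p - pderiv p))) x) (at x)"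
      using 2 by (auto simp: exp_germ_def)
    then show ?thesis
      by (rule has_field_derivative_transform_within_open[where S="{..<0}"])
         (use 2 in \<open>auto simp: exp_germ_def\<close>)
  next
    case 3
    \<comment> \<open>Dividing by h multiplies the polynomial by its variable, so the quotient at 0
      is the germ of \<open>pCons 0 p\<close>, which again tends to 0.\<close>
    have "((\<lambda>h. (exp_germ p (0 + h) - exp_germ p 0) / h) \<longlongrightarrow> 0) (at 0)"
      by (rule Lim_transform_eventually[OF exp_germ_tendsto_0[of "pCons 0 p"]])
         (auto simp: exp_germ_def eventually_at_filter)
    then show ?thesis
      by (simp add: 3 DERIV_def exp_germ_def)
  qed
qed

lemma C_k_exp_germ: "C_k k (exp_germ p)"
proof (induction k arbitrary: p)
  case 0
  show ?case
    using DERIV_isCont[OF exp_germ_has_derivative] by (simp add: continuous_at_imp_continuous_on)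
next
  case (Suc k)
  show ?case
    by (rule C_k_Suc_realI[OF exp_germ_has_derivative Suc])
qed

abbreviation germ :: "real \<Rightarrow> real" where
  "germ \<equiv> exp_germ 1"

lemma germ_bounds: "0 \<le> germ x" "germ x \<le> 1" "germ x > 0 \<longleftrightarrow> x > 0" "x \<le> 0 \<Longrightarrow> germ x = 0"
  by (auto simp: exp_germ_def)

text \<open>For x > 0 the values are exp(-1/((n+1)x)), which tend to 1; for x \<le> 0 they are all
  0. Bounds by 0 and 1 make these dilates suitable for dominated convergence.\<close>

lemma germ_tendsto_indicator:
  "(\<lambda>n. germ (real (Suc n) * x)) \<longlonglongrightarrow> indicator {0<..} x"
proof (cases "x > 0")
  case True
  have "(\<lambda>n. exp (- (inverse (real (Suc n)) * (1/x)))) \<longlonglongrightarrow> exp (- (0 * (1/x)))"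
    by (intro tendsto_intros LIMSEQ_inverse_real_of_nat)
  moreover have "germ (real (Suc n) * x) = exp (- (inverse (real (Suc n)) * (1/x)))" for n
    using True by (simp add: exp_germ_def add_pos_nonneg field_simps)
  ultimately show ?thesis
    using True by simp
next
  case False
  then have "real (Suc n) * x \<le> 0" for n
    by (simp add: mult_nonneg_nonpos)
  then show ?thesis
    using False by (simp add: germ_bounds(4))
qed

section \<open>A compactly supported bump and the smooth step obtained by integrating it\<close>

definition bump :: "real \<Rightarrow> real" where
  "bump x = germ x * germ (1 - x)"

lemma C_k_bump: "C_k k bump"
proof -
  have "C_k k (\<lambda>x. germ (1 - x))"
    using C_k_affine[OF C_k_exp_germ, of k 1 "-1" "1::real" 1] by simp
  then show ?thesis
    unfolding bump_def by (intro C_k_mult C_k_exp_germ)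
qed

lemma bump_nonneg: "0 \<le> bump x"
  by (simp add: bump_def germ_bounds)

lemma bump_eq_0: "x \<le> 0 \<or> 1 \<le> x \<Longrightarrow> bump x = 0"
  by (auto simp: bump_def germ_bounds)

lemma continuous_on_bump: "continuous_on A bump"
  using C_k_bump[of 0] continuous_on_subset by auto

lemma bump_integral_pos: "integral {-1..1} bump > 0"
proof -
  have "integral {-1..1} bump \<noteq> 0"
  proof
    assume "integral {-1..1} bump = 0"
    then have "integral (cbox (-1) 1) bump = 0" by simp
    then have "\<forall>x\<in>cbox (-1) 1. bump x = 0"
      using integral_eq_0_iff[of "-1" "1::real" bump] by (auto simp: continuous_on_bump bump_nonneg)
    then have "bump (1/2) = 0" by (auto dest!: bspec[where x="1/2"])
    then show False by (simp add: bump_def exp_germ_def)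
  qed
  moreover have "integral {-1..1} bump \<ge> 0"
    by (intro integral_nonneg integrable_continuous_interval continuous_on_bump bump_nonneg)
  ultimately show ?thesis by linarith
qed

text \<open>The normalised primitive of the bump. The derivative s is recorded together with S:
  differences of rescaled steps are test functions with a plateau, and rescalings of s are
  approximate identities.\<close>

lemma smooth_step_exists:
  obtains S s :: "real \<Rightarrow> real"
  where "\<And>k. C_k k S" "\<And>x. (S has_real_derivative s x) (at x)" "continuous_on UNIV s"
    "\<And>x. x \<le> 0 \<Longrightarrow> S x = 0" "\<And>x. 1 \<le> x \<Longrightarrow> S x = 1" "\<And>x. 0 \<le> s x"
    "\<And>x. x \<le> 0 \<or> 1 \<le> x \<Longrightarrow> s x = 0"
proof
  define m where "m = integral {-1..1} bump"
  \<comment> \<open>The base point -1 lies strictly to the left of the support, so every x \<ge> 0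
    is interior to an interval starting at -1 and the fundamental theorem yields a two-sided
    derivative, also at 0.\<close>
  define S where "S x = integral {-1..x} bump / m" for x
  define s where "s x = bump x / m" for x
  have m: "m > 0"
    using bump_integral_pos by (simp add: m_def)
  show S0: "S x = 0" if "x \<le> 0" for x
  proof -
    have "integral {-1..x} bump = integral {-1..x} (\<lambda>x. 0)"
      using that by (intro integral_cong bump_eq_0) auto
    then show ?thesis by (simp add: S_def)
  qed
  show S1: "S x = 1" if "1 \<le> x" for x
  proof -
    have "integral {1..x} bump = integral {1..x} (\<lambda>x. 0)"
      by (intro integral_cong bump_eq_0) auto
    moreover have "integral {-1..1} bump + integral {1..x} bump = integral {-1..x} bump"
      using that by (intro Henstock_Kurzweil_Integration.integral_combine integrable_continuous_interval continuous_on_bump) auto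
    ultimately show ?thesis
      using m by (simp add: S_def m_def)
  qed
  show der: "(S has_real_derivative s x) (at x)" for x
  proof (cases "x < 0")
    case True
    have "((\<lambda>x. 0) has_real_derivative s x) (at x)"
      using True by (auto simp: s_def bump_eq_0)
    then show ?thesis
      by (rule has_field_derivative_transform_within_open[where S="{..<0}"])
         (use True S0 in auto)
  next
    case False
    have "((\<lambda>x. integral {-1..x} bump) has_real_derivative bump x) (at x within {-1..x+1})"
      using False by (intro integral_has_real_derivative continuous_on_bump) auto
    then have "((\<lambda>x. integral {-1..x} bump) has_real_derivative bump x) (at x)"
      using False by (simp add: at_within_Icc_at)
    then show ?thesis
      unfolding S_def[abs_def] s_def by (rule DERIV_cdivide)
  qed
  have Cs: "C_k k s" for k
    unfolding s_def[abs_def] divide_inverse by (intro C_k_mult C_k_bump C_k_const)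
  then show "C_k k S" for k
    using C_k_mono_Suc[OF C_k_Suc_realI[OF der Cs]] by blast
  show "continuous_on UNIV s"
    using Cs[of 0] by simp
  show "0 \<le> s x" for x
    using m by (simp add: s_def bump_nonneg)
  show "s x = 0" if "x \<le> 0 \<or> 1 \<le> x" for x
    using that by (simp add: s_def bump_eq_0)
qed

section \<open>Test functions\<close>

lemma test_functionI:
  assumes "\<And>k. C_k k \<phi>" "compact K" "K \<subseteq> \<Omega>" "\<And>x. x \<notin> K \<Longrightarrow> \<phi> x = 0"
  shows "test_function \<Omega> \<phi>"
  using assms unfolding test_function_def by blast

lemma test_function_support:
  assumes "test_function \<Omega> \<phi>"
  shows "\<exists>K. compact K \<and> K \<subseteq> \<Omega> \<and> (\<forall>x. x \<notin> K \<longrightarrow> \<phi> x = 0)"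
  using assms unfolding test_function_def by blast

lemma test_function_has_derivative:
  "test_function \<Omega> \<phi> \<Longrightarrow> (\<phi> has_derivative frechet_derivative \<phi> (at x)) (at x)"
  by (auto simp: test_function_def intro!: C_k_Suc_has_derivative[of 0] simp del: C_k.simps)

lemma test_function_partial:
  assumes "test_function \<Omega> \<phi>" "b \<in> Basis"
  shows "test_function \<Omega> (\<lambda>x. frechet_derivative \<phi> (at x) b)"
proof -
  obtain K where K: "compact K" "K \<subseteq> \<Omega>" "\<And>x. x \<notin> K \<Longrightarrow> \<phi> x = 0"
    using test_function_support[OF assms(1)] by blast
  show ?thesis
  proof (rule test_functionI[OF _ K(1,2)])
    have "C_k (Suc k) \<phi>" for k
      using assms(1) by (auto simp: test_function_def simp del: C_k.simps)
    then show "C_k k (\<lambda>x. frechet_derivative \<phi> (at x) b)" for k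
      using assms(2) by simp
    fix x assume "x \<notin> K"
    moreover have "open (- K)"
      using K(1) by (simp add: compact_imp_closed open_Compl)
    ultimately have "(\<phi> has_derivative (\<lambda>_. 0)) (at x)"
      by (intro has_derivative_transform_within_open[OF has_derivative_const, of "- K"])
         (auto simp: K(3))
    then show "frechet_derivative \<phi> (at x) b = 0"
      by (metis frechet_derivative_at)
  qed
qed

lemma test_function_mult:
  assumes "test_function \<Omega> \<phi>" "test_function \<Omega> \<psi>"
  shows "test_function \<Omega> (\<lambda>x. \<phi> x * \<psi> x)"
proof -
  obtain K where K: "compact K" "K \<subseteq> \<Omega>" "\<And>x. x \<notin> K \<Longrightarrow> \<phi> x = 0"
    using test_function_support[OF assms(1)] by blast
  show ?thesis
    using assms by (intro test_functionI[OF _ K(1,2)] C_k_mult) (auto simp: K(3) test_function_def)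
qed

lemma test_function_continuous_on: "test_function \<Omega> \<phi> \<Longrightarrow> continuous_on A \<phi>"
  unfolding test_function_def by (metis C_k.simps(1) continuous_on_subset subset_UNIV)

lemma test_function_bounded:
  assumes "test_function \<Omega> \<phi>"
  obtains B where "B \<ge> 0" "\<And>x. \<bar>\<phi> x\<bar> \<le> B"
proof -
  obtain K where K: "compact K" "K \<subseteq> \<Omega>" "\<And>x. x \<notin> K \<Longrightarrow> \<phi> x = 0"
    using test_function_support[OF assms] by blast
  have "compact (\<phi> ` K)"
    by (intro compact_continuous_image K test_function_continuous_on[OF assms])
  then obtain B where B: "\<And>y. y \<in> \<phi> ` K \<Longrightarrow> norm y \<le> B"
    using compact_imp_bounded bounded_iff by metis
  have "\<bar>\<phi> x\<bar> \<le> max 0 B" for x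
    using B[of "\<phi> x"] K(3)[of x] by (cases "x \<in> K") (auto simp: max_def)
  then show ?thesis
    by (intro that[of "max 0 B"]) auto
qed

lemma test_function_measurable:
  assumes "test_function \<Omega> \<phi>" 
  shows "\<phi> \<in> borel_measurable borel" "\<phi> \<in> borel_measurable (lebesgue_on S)"
proof -
  show "\<phi> \<in> borel_measurable borel"
    using test_function_continuous_on[OF assms] by (rule borel_measurable_continuous_onI)
  then show "\<phi> \<in> borel_measurable (lebesgue_on S)"
    by (intro measurable_restrict_space1 measurable_completion) simp
qed

lemma test_function_integrable_lborel:
  assumes "test_function \<Omega> \<phi>"
  shows "integrable lborel \<phi>"
proof -
  obtain K where K: "compact K" "K \<subseteq> \<Omega>" "\<And>x. x \<notin> K \<Longrightarrow> \<phi> x = 0"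
    using test_function_support[OF assms] by blast
  have "integrable lborel (\<lambda>x. indicator K x *\<^sub>R \<phi> x)"
    by (intro borel_integrable_compact K test_function_continuous_on[OF assms])
  moreover have "(\<lambda>x. indicator K x *\<^sub>R \<phi> x) = \<phi>"
    using K(3) by (auto simp: indicator_def fun_eq_iff)
  ultimately show ?thesis by simp
qed

text \<open>Links the integrals over \<Omega> that define weak derivatives with integrals over the
  whole space, where translation invariance is available.\<close>

lemma integral_lborel_eq_lebesgue_on:
  fixes \<phi> :: "'a::euclidean_space \<Rightarrow> real"
  assumes "open \<Omega>" "integrable lborel \<phi>" "\<And>x. x \<notin> \<Omega> \<Longrightarrow> \<phi> x = 0"
  shows "(\<integral>x. \<phi> x \<partial>lebesgue_on \<Omega>) = (\<integral>x. \<phi> x \<partial>lborel)" "integrable (lebesgue_on \<Omega>) \<phi>"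
proof -
  have eq: "(\<lambda>x. if x \<in> \<Omega> then \<phi> x else 0) = \<phi>"
    using assms(3) by auto
  have "\<Omega> \<in> sets lebesgue"
    using assms(1) by (simp add: borel_open sets_completionI_sets)
  then show "(\<integral>x. \<phi> x \<partial>lebesgue_on \<Omega>) = (\<integral>x. \<phi> x \<partial>lborel)" "integrable (lebesgue_on \<Omega>) \<phi>"
    using assms(2) Lebesgue_Measure.integral_restrict_UNIV[of \<Omega> \<phi>] Lebesgue_Measure.integrable_restrict_UNIV[of \<Omega> \<phi>]
      borel_measurable_integrable[OF assms(2)]
    by (simp_all add: eq integral_completion integrable_completion)
qed

lemma test_function_zero_outside: "test_function \<Omega> \<phi> \<Longrightarrow> x \<notin> \<Omega> \<Longrightarrow> \<phi> x = 0"
  unfolding test_function_def by blast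

text \<open>By translation invariance the difference quotients in direction \<open>b\<close> integrate to zero.\<close>

lemma integral_partial_test_function:
  fixes \<phi> :: "'a::euclidean_space \<Rightarrow> real"
  assumes \<phi>: "test_function \<Omega> \<phi>" and b: "b \<in> Basis"
  shows "(\<integral>x. frechet_derivative \<phi> (at x) b \<partial>lborel) = 0"
proof -
  define d where "d x = frechet_derivative \<phi> (at x) b" for x
  define q where "q n x = (\<phi> (x + inverse (real (Suc n)) *\<^sub>R b) - \<phi> x) / inverse (real (Suc n))" for n x
  obtain K where K: "compact K" "K \<subseteq> \<Omega>" "\<And>x. x \<notin> K \<Longrightarrow> \<phi> x = 0"
    using test_function_support[OF \<phi>] by blast
  have d: "test_function \<Omega> d"
    unfolding d_def[abs_def] by (rule test_function_partial[OF \<phi> b])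
  obtain B where B: "B \<ge> 0" "\<And>x. \<bar>d x\<bar> \<le> B"
    using test_function_bounded[OF d] by blast
  have line: "((\<lambda>t. \<phi> (x + t *\<^sub>R b)) has_real_derivative d (x + t *\<^sub>R b)) (at t)" for x t
  proof -
    have "((\<lambda>t. x + t *\<^sub>R b) has_derivative (\<lambda>t. t *\<^sub>R b)) (at t)"
      by (auto intro!: derivative_eq_intros)
    from has_derivative_compose[OF this test_function_has_derivative[OF \<phi>]]
    have "((\<lambda>t. \<phi> (x + t *\<^sub>R b)) has_derivative (\<lambda>s. frechet_derivative \<phi> (at (x + t *\<^sub>R b)) (s *\<^sub>R b))) (at t)" .
    moreover have "frechet_derivative \<phi> (at (x + t *\<^sub>R b)) (s *\<^sub>R b) = d (x + t *\<^sub>R b) * s" for s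
      using linear_scale[OF has_derivative_linear[OF test_function_has_derivative[OF \<phi>, of "x + t *\<^sub>R b"]], of s b]
      by (simp add: d_def)
    ultimately show ?thesis
      by (simp add: has_field_derivative_def)
  qed
  \<comment> \<open>The set swept out when K moves backwards along b by at most 1. Since all step
    sizes are at most 1, it contains the supports of all difference quotients.\<close>
  define K' where "K' = (\<lambda>(x, t). x - t *\<^sub>R b) ` (K \<times> {0..1})"
  have K': "compact K'"
    unfolding K'_def by (intro compact_continuous_image compact_Times K)
      (auto simp: case_prod_unfold intro!: continuous_intros)
  have inK': "x \<in> K'" if "x + t *\<^sub>R b \<in> K" "0 \<le> t" "t \<le> 1" for x t
    unfolding K'_def by (rule image_eqI[of _ _ "(x + t *\<^sub>R b, t)"]) (use that in auto)
  have bound: "\<bar>q n x\<bar> \<le> B * indicator K' x" for n x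
  proof (cases "x \<in> K'")
    case True
    define h where "h = inverse (real (Suc n))"
    have h: "0 < h" by (simp add: h_def)
    \<comment> \<open>By the mean value theorem a difference quotient is a value of the derivative,
      so \<open>B * indicator K'\<close> dominates the whole sequence.\<close>
    obtain t where t: "0 < t" "t < h" "\<phi> (x + h *\<^sub>R b) - \<phi> (x + 0 *\<^sub>R b) = (h - 0) * d (x + t *\<^sub>R b)"
      using MVT2[OF h, of "\<lambda>t. \<phi> (x + t *\<^sub>R b)" "\<lambda>t. d (x + t *\<^sub>R b)"] line by auto
    then have "q n x = d (x + t *\<^sub>R b)"
      using h unfolding q_def h_def[symmetric] by simp
    then show ?thesis
      using True B by simp
  next
    case False
    have "inverse (real (Suc n)) \<le> 1"
      by (simp add: inverse_le_1_iff)
    then have "x + inverse (real (Suc n)) *\<^sub>R b \<notin> K" "x \<notin> K"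
      using inK'[of x "inverse (real (Suc n))"] inK'[of x 0] False by auto
    then show ?thesis
      using False by (simp add: q_def K(3))
  qed
  have "(\<lambda>n. \<integral>x. q n x \<partial>lborel) \<longlonglongrightarrow> (\<integral>x. d x \<partial>lborel)"
  proof (rule integral_dominated_convergence)
    show "d \<in> borel_measurable lborel"
      using test_function_measurable(1)[OF d] by simp
    show "q n \<in> borel_measurable lborel" for n
      unfolding q_def[abs_def] using test_function_measurable(1)[OF \<phi>] by measurable
    show "integrable lborel (\<lambda>x. B * indicator K' x)"
      using K' emeasure_compact_finite[OF K']
      by (intro integrable_mult_right integrable_real_indicator) (simp_all add: borel_compact)
    have "(\<lambda>n. q n x) \<longlonglongrightarrow> d x" for x
    proof -
      have "((\<lambda>h. (\<phi> (x + (0 + h) *\<^sub>R b) - \<phi> (x + 0 *\<^sub>R b)) / h) \<longlongrightarrow> d (x + 0 *\<^sub>R b)) (at 0)"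
        using line[of x 0] by (simp add: DERIV_def)
      then have "((\<lambda>n. (\<phi> (x + (0 + inverse (real (Suc n))) *\<^sub>R b) - \<phi> (x + 0 *\<^sub>R b)) / inverse (real (Suc n))) \<longlongrightarrow> d (x + 0 *\<^sub>R b)) sequentially"
        by (rule filterlim_compose)
           (use LIMSEQ_inverse_real_of_nat in \<open>simp add: filterlim_at\<close>)
      then show ?thesis
        by (simp add: q_def)
    qed
    then show "AE x in lborel. (\<lambda>n. q n x) \<longlonglongrightarrow> d x" by simp
    show "AE x in lborel. norm (q n x) \<le> B * indicator K' x" for n
      using bound by simp
  qed
  moreover have "(\<integral>x. q n x \<partial>lborel) = 0" for n
  proof -
    define h where "h = inverse (real (Suc n)) *\<^sub>R b"
    have tr: "(\<integral>x. \<phi> (x + h) \<partial>lborel) = (\<integral>x. \<phi> x \<partial>lborel)" "integrable lborel (\<lambda>x. \<phi> (x + h))"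
    proof -
      have "distr lborel borel (\<lambda>x. x + h) = lborel"
        using lborel_distr_plus[of h] by (subst add.commute) simp
      then show "(\<integral>x. \<phi> (x + h) \<partial>lborel) = (\<integral>x. \<phi> x \<partial>lborel)"
          "integrable lborel (\<lambda>x. \<phi> (x + h))"
        using integral_distr[of "\<lambda>x. x + h" lborel borel \<phi>] 
          integrable_distr[of "\<lambda>x. x + h" lborel borel \<phi>] test_function_measurable(1)[OF \<phi>]
          test_function_integrable_lborel[OF \<phi>]
        by auto
    qed
    show ?thesis
      using tr test_function_integrable_lborel[OF \<phi>] unfolding q_def h_def[symmetric] by simp
  qed
  ultimately show ?thesis
    by (simp add: d_def LIMSEQ_const_iff)
qed

section \<open>The fundamental lemma of the calculus of variations\<close>

lemma lebesgue_setsI: "open S \<Longrightarrow> S \<in> sets lebesgue" "closed S \<Longrightarrow> S \<in> sets lebesgue"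
  by (auto intro!: sets_completionI_sets)

lemma integrable_lebesgue_on_subset:
  fixes f :: "'a::euclidean_space \<Rightarrow> 'b::{banach, second_countable_topology}"
  assumes "integrable (lebesgue_on S) f" "T \<subseteq> S" "S \<in> sets lebesgue" "T \<in> sets lebesgue"
  shows "integrable (lebesgue_on T) f"
proof -
  have "set_integrable lebesgue S f"
    using assms by (simp add: set_integrable_def integrable_restrict_space)
  then have "set_integrable lebesgue T f"
    by (rule set_integrable_subset) (use assms in auto)
  then show ?thesis
    using assms by (simp add: set_integrable_def integrable_restrict_space)
qed

text \<open>One dilated germ for each face of the box: the product is smooth, vanishes off the box,
  and converges to the indicator of the open box without any normalisation.\<close>

definition box_cutoff :: "'a::euclidean_space \<Rightarrow> 'a \<Rightarrow> nat \<Rightarrow> 'a \<Rightarrow> real" where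
  "box_cutoff a c n x =
     (\<Prod>b\<in>Basis. germ (real (Suc n) * (x \<bullet> b - a \<bullet> b)) * germ (real (Suc n) * (c \<bullet> b - x \<bullet> b)))"

lemma box_cutoff_eq_0:
  assumes "x \<notin> cbox a c"
  shows "box_cutoff a c n x = 0"
proof -
  have "\<exists>b\<in>Basis. x \<bullet> b < a \<bullet> b \<or> c \<bullet> b < x \<bullet> b"
    using assms by (auto simp: mem_box not_le)
  then obtain b where b: "b \<in> Basis" "x \<bullet> b < a \<bullet> b \<or> c \<bullet> b < x \<bullet> b"
    by blast
  then have "real (Suc n) * (x \<bullet> b - a \<bullet> b) \<le> 0 \<or> real (Suc n) * (c \<bullet> b - x \<bullet> b) \<le> 0"
    by (auto intro!: mult_nonneg_nonpos)
  then have "germ (real (Suc n) * (x \<bullet> b - a \<bullet> b)) * germ (real (Suc n) * (c \<bullet> b - x \<bullet> b)) = 0"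
    using germ_bounds(4) by auto
  then show ?thesis
    unfolding box_cutoff_def using b(1) by (intro prod_zero) auto
qed

lemma box_cutoff_test_function:
  assumes "cbox a c \<subseteq> \<Omega>"
  shows "test_function \<Omega> (box_cutoff a c n)"
proof (rule test_functionI)
  have 1: "C_k k (\<lambda>x::'a. germ (real (Suc n) * (x \<bullet> b - a \<bullet> b)))" for k b
    using C_k_affine[OF C_k_exp_germ, of k 1 "real (Suc n)" b "- real (Suc n) * (a \<bullet> b)"]
    by (simp add: algebra_simps)
  have 2: "C_k k (\<lambda>x::'a. germ (real (Suc n) * (c \<bullet> b - x \<bullet> b)))" for k b
    using C_k_affine[OF C_k_exp_germ, of k 1 "- real (Suc n)" b "real (Suc n) * (c \<bullet> b)"]
    by (simp add: algebra_simps)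
  show "C_k k (box_cutoff a c n)" for k
    unfolding box_cutoff_def[abs_def] by (intro C_k_prod C_k_mult 1 2) auto
qed (use assms box_cutoff_eq_0 in auto)

lemma box_cutoff_bounds: "0 \<le> box_cutoff a c n x" "box_cutoff a c n x \<le> 1"
  unfolding box_cutoff_def
  by (auto intro!: prod_nonneg prod_le_1 mult_nonneg_nonneg mult_le_one simp: germ_bounds)

lemma box_cutoff_tendsto: "(\<lambda>n. box_cutoff a c n x) \<longlonglongrightarrow> indicator (box a c) x"
proof -
  have "(\<lambda>n. box_cutoff a c n x) \<longlonglongrightarrow>
      (\<Prod>b\<in>Basis. indicator {0<..} (x \<bullet> b - a \<bullet> b) * indicator {0<..} (c \<bullet> b - x \<bullet> b))"
    unfolding box_cutoff_def by (intro tendsto_prod tendsto_mult germ_tendsto_indicator)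
  also have "(\<Prod>b\<in>Basis. indicator {0<..} (x \<bullet> b - a \<bullet> b) * indicator {0<..} (c \<bullet> b - x \<bullet> b))
      = (indicator (box a c) x :: real)"
  proof (cases "x \<in> box a c")
    case True
    then show ?thesis
      by (auto simp: mem_box indicator_def intro!: prod.neutral)
  next
    case False
    then obtain b where "b \<in> Basis" "x \<bullet> b \<le> a \<bullet> b \<or> c \<bullet> b \<le> x \<bullet> b"
      by (auto simp: mem_box not_less)
    then show ?thesis
      using False by (auto simp: indicator_def intro!: prod_zero bexI[of _ b])
  qed
  finally show ?thesis .
qed

text \<open>
  Testing with cut-offs of boxes shows that the integral over every box vanishes; Lebesgue's
  differentiation theorem concludes.
\<close>

lemma AE_zero_if_test_integrals_zero:
  fixes v :: "'a::euclidean_space \<Rightarrow> real"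
  assumes \<Omega>: "open \<Omega>" and v: "v \<in> borel_measurable (lebesgue_on \<Omega>)"
    and int: "\<And>a c. cbox a c \<subseteq> \<Omega> \<Longrightarrow> integrable (lebesgue_on (cbox a c)) v"
    and zero: "\<And>\<phi>. test_function \<Omega> \<phi> \<Longrightarrow> (\<integral>x. v x * \<phi> x \<partial>lebesgue_on \<Omega>) = 0"
  shows "AE x in lebesgue_on \<Omega>. v x = 0"
proof -
  have \<Omega>s: "\<Omega> \<in> sets lebesgue"
    using \<Omega> by (rule lebesgue_setsI)
  have box0: "integral (cbox a c) v = 0" if ac: "cbox a c \<subseteq> \<Omega>" for a c
  proof -
    \<comment> \<open>Integrability of v is available on boxes inside \<Omega>, so the restriction
      of v to the box serves as dominating function.\<close>
    have 1: "integrable (lebesgue_on \<Omega>) (\<lambda>x. if x \<in> cbox a c then v x else 0)"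
    proof -
      have "integrable lebesgue (\<lambda>x. if x \<in> \<Omega> then (if x \<in> cbox a c then v x else 0) else 0)
        = integrable lebesgue (\<lambda>x. if x \<in> cbox a c then v x else 0)"
        using ac by (intro Bochner_Integration.integrable_cong) auto
      then show ?thesis
        using int[OF ac] Lebesgue_Measure.integrable_restrict_UNIV[OF \<Omega>s]
          Lebesgue_Measure.integrable_restrict_UNIV[of "cbox a c" v] by (auto simp: lebesgue_setsI)
    qed
    have "(\<lambda>n. \<integral>x. v x * box_cutoff a c n x \<partial>lebesgue_on \<Omega>) \<longlonglongrightarrow> (\<integral>x. v x * indicator (box a c) x \<partial>lebesgue_on \<Omega>)"
    proof (rule integral_dominated_convergence[OF _ _ integrable_norm[OF 1]])
      show "(\<lambda>x. v x * indicator (box a c) x) \<in> borel_measurable (lebesgue_on \<Omega>)"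
        by (intro borel_measurable_times v borel_measurable_indicator)
           (use ac box_subset_cbox[of a c] in \<open>auto simp: sets_restrict_space_iff \<Omega>s lebesgue_setsI\<close>)
      show "(\<lambda>x. v x * box_cutoff a c n x) \<in> borel_measurable (lebesgue_on \<Omega>)" for n
        by (intro borel_measurable_times v test_function_measurable(2)[OF box_cutoff_test_function[OF ac]])
      show "AE x in lebesgue_on \<Omega>. (\<lambda>n. v x * box_cutoff a c n x) \<longlonglongrightarrow> v x * indicator (box a c) x"
        by (intro AE_I2 tendsto_mult tendsto_const box_cutoff_tendsto)
      show "AE x in lebesgue_on \<Omega>. norm (v x * box_cutoff a c n x) \<le> norm (if x \<in> cbox a c then v x else 0)" for n
      proof (rule AE_I2)
        fix x
        show "norm (v x * box_cutoff a c n x) \<le> norm (if x \<in> cbox a c then v x else 0)"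
          using box_cutoff_eq_0[of x a c n] box_cutoff_bounds[of a c n x] mult_left_mono[of "box_cutoff a c n x" 1 "\<bar>v x\<bar>"]
          by (auto simp: abs_mult)
      qed
    qed
    then have "(\<integral>x. v x * indicator (box a c) x \<partial>lebesgue_on \<Omega>) = 0"
      using zero[OF box_cutoff_test_function[OF ac]] LIMSEQ_unique[OF tendsto_const] by force
    moreover have "(\<lambda>x. v x * indicator (box a c) x) = (\<lambda>x. if x \<in> box a c then v x else 0)"
      by (auto simp: indicator_def)
    ultimately have "integral\<^sup>L (lebesgue_on (box a c)) v = 0"
      using Lebesgue_Measure.integral_restrict[of "box a c" \<Omega> v] ac box_subset_cbox[of a c] \<Omega>s
      by (auto simp: lebesgue_setsI)
    moreover have "integrable (lebesgue_on (box a c)) v"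
      by (rule integrable_lebesgue_on_subset[OF int[OF ac] box_subset_cbox]) (auto simp: lebesgue_setsI)
    ultimately have "integral (box a c) v = 0"
      using lebesgue_integral_eq_integral[of "box a c" v] by (auto simp: lebesgue_setsI)
    then show ?thesis
      by (simp add: integral_open_interval)
  qed
  have neg: "negligible {x \<in> cbox p q. v x \<noteq> 0}" if pq: "cbox p q \<subseteq> \<Omega>" for p q
  proof -
    \<comment> \<open>The cut-off is integrable on every box, as the differentiation theorem
      requires, and agrees with v near interior points of this box.\<close>
    define f where "f x = (if x \<in> cbox p q then v x else 0)" for x
    have "integrable lebesgue f"
      using int[OF pq] Lebesgue_Measure.integrable_restrict_UNIV[of "cbox p q" v]
      by (auto simp: f_def[abs_def] lebesgue_setsI)
    then have "f integrable_on cbox a c" for a c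
      using integrable_on_lebesgue integrable_on_subcbox by blast
    then obtain N where N: "negligible N" "\<And>x e. \<lbrakk>x \<notin> N; 0 < e\<rbrakk> \<Longrightarrow>
        \<exists>d>0. \<forall>h. 0 < h \<and> h < d \<longrightarrow> norm (integral (cbox x (x + h *\<^sub>R One)) f /\<^sub>R h ^ DIM('a) - f x) < e"
      using integrable_ccontinuous_explicit[of f] by blast
    have "v x = 0" if x: "x \<in> box p q" "x \<notin> N" for x
    proof (rule ccontr)
      assume "v x \<noteq> 0"
      then obtain d where d: "d > 0" "\<And>h. 0 < h \<Longrightarrow> h < d \<Longrightarrow>
          norm (integral (cbox x (x + h *\<^sub>R One)) f /\<^sub>R h ^ DIM('a) - f x) < \<bar>v x\<bar>"
        using N(2)[OF x(2), of "\<bar>v x\<bar>"] by auto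
      \<comment> \<open>A side length for a cube with lower corner x that stays in the box; halving
        d makes the bound \<open>h < d\<close> strict.\<close>
      define h where "h = Min (insert (d/2) ((\<lambda>b. (q \<bullet> b - x \<bullet> b)) ` Basis))"
      have h: "0 < h" "h < d" "\<And>b. b \<in> Basis \<Longrightarrow> h \<le> q \<bullet> b - x \<bullet> b"
      proof -
        let ?A = "insert (d/2) ((\<lambda>b. (q \<bullet> b - x \<bullet> b)) ` Basis)"
        have fin: "finite ?A" "?A \<noteq> {}" by auto
        show "0 < h"
          unfolding h_def Min_gr_iff[OF fin] using d(1) x(1) by (auto simp: mem_box)
        have "h \<le> d/2"
          unfolding h_def using fin by (intro Min_le) auto
        then show "h < d" using d(1) by simp
        show "h \<le> q \<bullet> b - x \<bullet> b" if "b \<in> Basis" for b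
          unfolding h_def using fin that by (intro Min_le) auto
      qed
      have sub: "cbox x (x + h *\<^sub>R One) \<subseteq> cbox p q"
      proof
        fix z assume z: "z \<in> cbox x (x + h *\<^sub>R One)"
        show "z \<in> cbox p q"
          unfolding mem_box
        proof
          fix b :: 'a assume b: "b \<in> Basis"
          then have "x \<bullet> b \<le> z \<bullet> b" "z \<bullet> b \<le> x \<bullet> b + h" "p \<bullet> b < x \<bullet> b"
            using z x(1) by (auto simp: mem_box inner_simps)
          then show "p \<bullet> b \<le> z \<bullet> b \<and> z \<bullet> b \<le> q \<bullet> b"
            using h(3)[OF b] by linarith
        qed
      qed
      have "integral (cbox x (x + h *\<^sub>R One)) f = integral (cbox x (x + h *\<^sub>R One)) v"
        using sub by (intro integral_cong) (auto simp: f_def)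
      also have "\<dots> = 0"
        using sub pq by (intro box0) auto
      finally show False
        using d(2)[OF h(1,2)] x(1) box_subset_cbox[of p q] by (auto simp: f_def)
    qed
    \<comment> \<open>The averages are over cubes with lower corner x, which need room inside the
      box. The faces are therefore left out; they form a null set.\<close>
    then have "{x \<in> cbox p q. v x \<noteq> 0} \<subseteq> N \<union> (cbox p q - box p q)"
      by auto
    then show ?thesis
      using N(1) negligible_frontier_interval[of p q] negligible_Un negligible_subset by blast
  qed
  obtain D where D: "countable D" "\<And>X. X \<in> D \<Longrightarrow> X \<subseteq> \<Omega>" "\<And>X. X \<in> D \<Longrightarrow> \<exists>a b. X = cbox a b" "\<Union>D = \<Omega>"
    by (rule open_countable_Union_open_cbox[OF \<Omega>]) blast
  have "negligible (\<Union>X\<in>D. {x \<in> X. v x \<noteq> 0})"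
  proof (rule negligible_countable_Union)
    show "countable ((\<lambda>X. {x \<in> X. v x \<noteq> 0}) ` D)"
      using D(1) by (rule countable_image)
    fix Y assume "Y \<in> (\<lambda>X. {x \<in> X. v x \<noteq> 0}) ` D"
    then obtain a b where "cbox a b \<subseteq> \<Omega>" "Y = {x \<in> cbox a b. v x \<noteq> 0}"
      using D(2,3) by blast
    then show "negligible Y"
      using neg by simp
  qed
  moreover have "(\<Union>X\<in>D. {x \<in> X. v x \<noteq> 0}) = {x \<in> \<Omega>. v x \<noteq> 0}"
    using D(4) by auto
  ultimately have "{x \<in> \<Omega>. v x \<noteq> 0} \<in> null_sets lebesgue"
    by (simp add: negligible_iff_null_sets)
  then have "AE x in lebesgue. x \<in> \<Omega> \<longrightarrow> v x = 0"
    by (auto dest: AE_not_in elim: eventually_mono)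
  then show ?thesis
    using \<Omega>s by (simp add: AE_restrict_space_iff)
qed

section \<open>Steklov averages\<close>

abbreviation leb :: "real \<Rightarrow> real measure" where "leb T \<equiv> lebesgue_on {0..T}"

lemma integral_shift:
  fixes \<beta> :: "real \<Rightarrow> real"
  assumes int: "integrable (leb T) \<beta>" and h: "0 \<le> h" "h \<le> T"
  shows "integrable (leb T) (\<lambda>t. if t < h then 0 else \<beta> (t - h))" (is ?int)
    and "(\<integral>t. (if t < h then 0 else \<beta> (t - h)) \<partial>leb T) = (\<integral>t. \<beta> t \<partial>lebesgue_on {0..T-h})" (is ?eq)
proof -
  define g where "g t = (if t \<in> {0..T-h} then \<beta> t else 0)" for t
  have "integrable (lebesgue_on {0..T-h}) \<beta>"
    using h by (intro integrable_subinterval[OF int]) auto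
  then have g: "integrable lebesgue g" "(\<integral>t. g t \<partial>lebesgue) = (\<integral>t. \<beta> t \<partial>lebesgue_on {0..T-h})"
    using Lebesgue_Measure.integral_restrict_UNIV[of "{0..T-h}" \<beta>]
      Lebesgue_Measure.integrable_restrict_UNIV[of "{0..T-h}" \<beta>]
    by (auto simp: g_def[abs_def] lebesgue_setsI)
  have shift: "integrable lebesgue (\<lambda>t. g (-h + 1 * t))" "(\<integral>t. g (-h + 1 * t) \<partial>lebesgue) = (\<integral>t. g t \<partial>lebesgue)"
    using lebesgue_integrable_real_affine_iff[of 1 g "-h"] lebesgue_integral_real_affine[of 1 g "-h"] g(1)
    by auto
  have "(\<lambda>t. g (-h + 1 * t)) = (\<lambda>t. if t \<in> {0..T} then (if t < h then 0 else \<beta> (t - h)) else 0)"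
    using h by (auto simp: g_def fun_eq_iff)
  then show ?int ?eq
    using shift g(2) Lebesgue_Measure.integral_restrict_UNIV[of "{0..T}" "\<lambda>t. if t < h then 0 else \<beta> (t - h)"]
      Lebesgue_Measure.integrable_restrict_UNIV[of "{0..T}" "\<lambda>t. if t < h then 0 else \<beta> (t - h)"]
    by (auto simp: lebesgue_setsI)
qed

text \<open>The shift pushes the mass of the last stretch of length h out of the interval and brings
  in zeros at the other end; all the rest cancels. This is the continuous form of a telescoping
  sum.\<close>

lemma integral_diff_shift:
  fixes \<beta> :: "real \<Rightarrow> real"
  assumes int: "integrable (leb T) \<beta>" and h: "0 \<le> h" "h \<le> T"
  shows "(\<integral>t. \<beta> t - (if t < h then 0 else \<beta> (t - h)) \<partial>leb T) = (\<integral>t. \<beta> t \<partial>lebesgue_on {T-h..T})"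
  using integral_shift[OF assms] int Equivalence_Measurable_On_Borel.integral_combine[OF int, of "T - h"] h
  by simp

text \<open>The integral from 0, continued by 0 to the left, so that
  \<open>primitive q (t - h)\<close> is meaningful at every time in the interval, including t <
  h.\<close>

definition primitive :: "(real \<Rightarrow> real) \<Rightarrow> real \<Rightarrow> real" where
  "primitive q t = (if t \<le> 0 then 0 else \<integral>s. q s \<partial>lebesgue_on {0..t})"

lemma primitive_0 [simp]: "t \<le> 0 \<Longrightarrow> primitive q t = 0"
  by (simp add: primitive_def)

lemma primitive_eq:
  assumes "0 \<le> t"
  shows "primitive q t = (\<integral>s. q s \<partial>lebesgue_on {0..t})"
proof (cases "t = 0")
  case True
  have "{0::real} \<in> null_sets lebesgue" by auto
  then show ?thesis
    using True integral_eq_zero_null_sets[of "{0::real}" q] by simp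
qed (use assms in \<open>simp add: primitive_def\<close>)

lemma primitive_diff:
  assumes int: "integrable (leb T) q" and st: "0 \<le> s" "s \<le> t" "t \<le> T"
  shows "primitive q t - primitive q s = (\<integral>r. q r \<partial>lebesgue_on {s..t})"
proof -
  have "integrable (lebesgue_on {0..t}) q"
    using st by (intro integrable_subinterval[OF int]) auto
  from Equivalence_Measurable_On_Borel.integral_combine[OF this, of s] show ?thesis
    using st by (simp add: primitive_eq)
qed

lemma continuous_on_primitive:
  assumes int: "integrable (leb T) q"
  shows "continuous_on {..T} (primitive q)"
proof -
  have "continuous_on ({..0} \<union> {0..T}) (primitive q)" if "0 \<le> T"
  proof (rule continuous_on_closed_Un)
    have "continuous_on {0..T} (\<lambda>x. integral\<^sup>L (lebesgue_on {0..x}) q)"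
      by (rule indefinite_integral_continuous_real[OF int])
    then show "continuous_on {0..T} (primitive q)"
      by (rule continuous_on_eq) (simp add: primitive_eq)
    show "continuous_on {..0} (primitive q)"
      by (rule continuous_on_eq[OF continuous_on_const[of _ 0]]) simp
  qed auto
  moreover have "continuous_on {..T} (primitive q)" if "T < 0"
    by (rule continuous_on_eq[OF continuous_on_const[of _ 0]]) (use that in simp)
  moreover have "{..0} \<union> {0..T} = {..T}" if "0 \<le> T"
    using that by auto
  ultimately show ?thesis by (cases "0 \<le> T") auto
qed

text \<open>Both primitives are constant before time 0, so s may be replaced by
  \<open>max 0 s\<close>; what remains is the triangle inequality for integrals.\<close>

lemma abs_primitive_diff_le:
  assumes int: "integrable (leb T) q" and "s \<le> t" "t \<le> T"
  shows "\<bar>primitive q t - primitive q s\<bar> \<le> primitive (\<lambda>r. \<bar>q r\<bar>) t - primitive (\<lambda>r. \<bar>q r\<bar>) s"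
proof -
  have "\<bar>primitive q t - primitive q (max 0 s)\<bar> \<le> primitive (\<lambda>r. \<bar>q r\<bar>) t - primitive (\<lambda>r. \<bar>q r\<bar>) (max 0 s)"
    if "0 \<le> t"
    using primitive_diff[OF int, of "max 0 s" t] primitive_diff[OF integrable_abs[OF int], of "max 0 s" t] assms that
    by (simp add: integral_abs_bound)
  moreover have "primitive r (max 0 s) = primitive r s" for r
    by (cases "0 \<le> s") auto
  ultimately show ?thesis
    using assms(2) by (cases "0 \<le> t") auto
qed

lemma primitive_mono:
  assumes int: "integrable (leb T) q" and "\<And>r. 0 \<le> q r" and "s \<le> t" "t \<le> T"
  shows "primitive q s \<le> primitive q t"
  using abs_primitive_diff_le[OF int assms(3,4)] assms(2) by simp

lemma primitive_nonneg:
  assumes "\<And>r. 0 \<le> q r"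
  shows "0 \<le> primitive q t"
  by (auto simp: primitive_def intro!: integral_nonneg_AE assms)

lemma integrable_primitive_shift:
  assumes int: "integrable (leb T) q" and h: "0 \<le> h"
  shows "integrable (leb T) (\<lambda>t. primitive q (t - h))"
proof -
  have "continuous_on {0..T} (\<lambda>t. primitive q (t - h))"
    by (intro continuous_on_compose2[OF continuous_on_primitive[OF int]] continuous_intros) (use h in auto)
  then show ?thesis
    by (rule continuous_imp_integrable_real)
qed

text \<open>The increments telescope to the integral of the primitive over the last stretch of
  length h, where monotonicity bounds it by its final value. After division by h this says that
  averaging does not increase the L1 norm.\<close>

lemma integral_primitive_diff_le:
  assumes int: "integrable (leb T) q" and nn: "\<And>r. 0 \<le> q r" and h: "0 \<le> h" "h \<le> T"
  shows "(\<integral>t. primitive q t - primitive q (t - h) \<partial>leb T) \<le> h * primitive q T"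
proof -
  have i: "integrable (leb T) (primitive q)"
    using integrable_primitive_shift[OF int, of 0] by simp
  have "(\<lambda>t. primitive q t - primitive q (t - h))
      = (\<lambda>t. primitive q t - (if t < h then 0 else primitive q (t - h)))"
    by (auto simp: fun_eq_iff)
  then have "(\<integral>t. primitive q t - primitive q (t - h) \<partial>leb T) = (\<integral>t. primitive q t \<partial>lebesgue_on {T-h..T})"
    using integral_diff_shift[OF i h] by simp
  also have "\<dots> \<le> (\<integral>t. primitive q T \<partial>lebesgue_on {T-h..T})"
  proof (rule integral_mono)
    show "integrable (lebesgue_on {T-h..T}) (primitive q)"
      using h by (intro integrable_subinterval[OF i]) auto
    show "primitive q t \<le> primitive q T" if "t \<in> space (lebesgue_on {T-h..T})" for t
      using that by (intro primitive_mono[OF int nn]) auto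
  qed auto
  also have "\<dots> = h * primitive q T"
    using h by (simp add: measure_restrict_space lebesgue_setsI)
  finally show ?thesis .
qed

text \<open>Lebesgue's differentiation theorem is available for averages to the right of a point,
  whereas the averages here look backward; the theorem is therefore applied to the time-reflected
  function.\<close>

lemma steklov_AE_tendsto:
  assumes int: "integrable (leb T) q" and T: "0 < T"
  shows "AE t in leb T. (\<lambda>n. (primitive q t - primitive q (t - T / Suc n)) / (T / Suc n)) \<longlonglongrightarrow> q t"
proof -
  define f where "f s = (if -s \<in> {0..T} then q (-s) else 0)" for s
  have "integrable lebesgue (\<lambda>s. if s \<in> {0..T} then q s else 0)"
    using Lebesgue_Measure.integrable_restrict_UNIV[of "{0..T}" q] int by (simp add: lebesgue_setsI)
  then have "integrable lebesgue f"
    using lebesgue_integrable_real_affine_iff[of "-1" "\<lambda>s. if s \<in> {0..T} then q s else 0" 0]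
    unfolding f_def[abs_def] by (simp cong: if_cong)
  then have "f integrable_on cbox a c" for a c
    using integrable_on_lebesgue integrable_on_subcbox by blast
  then obtain N where N: "negligible N" "\<And>x e. \<lbrakk>x \<notin> N; 0 < e\<rbrakk> \<Longrightarrow>
        \<exists>d>0. \<forall>h. 0 < h \<and> h < d \<longrightarrow> norm (integral (cbox x (x + h *\<^sub>R One)) f /\<^sub>R h ^ DIM(real) - f x) < e"
    using integrable_ccontinuous_explicit[of f] by blast
  have lim: "(\<lambda>n. (primitive q t - primitive q (t - T / Suc n)) / (T / Suc n)) \<longlonglongrightarrow> q t"
    if t: "0 < t" "t \<le> T" "-t \<notin> N" for t
  proof (rule LIMSEQ_I)
    fix e :: real assume "0 < e"
    then obtain d where d: "d > 0" "\<And>h. 0 < h \<Longrightarrow> h < d \<Longrightarrow>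
          norm (integral (cbox (-t) (-t + h *\<^sub>R One)) f /\<^sub>R h ^ DIM(real) - f (-t)) < e"
      using N(2)[OF t(3)] by metis
    have "(\<lambda>n. T * inverse (real (Suc n))) \<longlonglongrightarrow> T * 0"
      by (intro tendsto_intros LIMSEQ_inverse_real_of_nat)
    \<comment> \<open>Steps shorter than t keep the averaging interval at positive times, where the
      reflected function coincides with q.\<close>
    then have "\<forall>\<^sub>F n in sequentially. T / Suc n < min d t"
      using d(1) t(1) by (intro order_tendstoD(2)[of _ 0]) (auto simp: divide_inverse)
    then obtain n0 where n0: "\<And>n. n \<ge> n0 \<Longrightarrow> T / Suc n < min d t"
      by (auto simp: eventually_sequentially)
    show "\<exists>no. \<forall>n\<ge>no. norm ((primitive q t - primitive q (t - T / Suc n)) / (T / Suc n) - q t) < e"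
    proof (intro exI allI impI)
      fix n assume "n0 \<le> n"
      define h where "h = T / Suc n"
      have h: "0 < h" "h < d" "h < t"
        using n0[OF \<open>n0 \<le> n\<close>] T by (auto simp: h_def)
      have iq: "integrable (lebesgue_on {t-h..t}) q"
        using h t by (intro integrable_subinterval[OF int]) auto
      have "primitive q t - primitive q (t - h) = integral {t-h..t} q"
        using primitive_diff[OF int, of "t-h" t] h t lebesgue_integral_eq_integral[OF iq]
        by (simp add: lebesgue_setsI)
      also have "\<dots> = integral {-t..-(t-h)} (\<lambda>s. q (-s))"
        by (rule Henstock_Kurzweil_Integration.integral_reflect_real[symmetric])
      also have "\<dots> = integral {-t..-(t-h)} f"
        using h t by (intro integral_cong) (auto simp: f_def)
      finally have "(primitive q t - primitive q (t - h)) / h - q t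
          = integral (cbox (-t) (-t + h *\<^sub>R One)) f /\<^sub>R h ^ DIM(real) - f (-t)"
        using t by (simp add: f_def divide_inverse mult.commute algebra_simps)
      then show "norm ((primitive q t - primitive q (t - T / Suc n)) / (T / Suc n) - q t) < e"
        using d(2)[OF h(1,2)] by (simp add: h_def)
    qed
  qed
  have "negligible (uminus ` N)"
    using N(1) by (intro negligible_differentiable_image_negligible)
      (auto simp: differentiable_on_def)
  then have "negligible (insert 0 (uminus ` N))"
    by simp
  then have "insert 0 (uminus ` N) \<in> null_sets lebesgue"
    by (simp add: negligible_iff_null_sets)
  then have "AE t in lebesgue. t \<notin> insert 0 (uminus ` N)"
    by (rule AE_not_in)
  then have "AE t in leb T. t \<notin> insert 0 (uminus ` N)"
    by (subst AE_restrict_space_iff) (auto simp: lebesgue_setsI elim: eventually_mono)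
  then show ?thesis
  proof (rule lebesgue_on_mono)
    fix t assume "t \<notin> insert 0 (uminus ` N)" "t \<in> {0..T}"
    moreover have "t \<in> uminus ` N" if "-t \<in> N"
      using imageI[OF that, of uminus] by simp
    ultimately show "(\<lambda>n. (primitive q t - primitive q (t - T / Suc n)) / (T / Suc n)) \<longlonglongrightarrow> q t"
      by (intro lim) auto
  qed
qed

text \<open>Averages converge almost everywhere and their L1 norms do not exceed that of q, so
  Scheffe's lemma upgrades the convergence to L1; a bounded weight g preserves it.\<close>

lemma steklov_integral_tendsto:
  assumes int: "integrable (leb T) q" and T: "0 < T"
    and g: "g \<in> borel_measurable (leb T)" "\<And>t. \<bar>g t\<bar> \<le> B"
  shows "(\<lambda>n. \<integral>t. g t * ((primitive q t - primitive q (t - T / Suc n)) / (T / Suc n)) \<partial>leb T)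
    \<longlonglongrightarrow> (\<integral>t. g t * q t \<partial>leb T)"
proof -
  define a where "a n t = (primitive q t - primitive q (t - T / Suc n)) / (T / Suc n)" for n t
  have h: "0 < T / Suc n" "T / Suc n \<le> T" for n
    using T by (auto simp: field_simps)
  have ia: "integrable (leb T) (a n)" for n
    unfolding a_def[abs_def] using integrable_primitive_shift[OF int, of 0] integrable_primitive_shift[OF int, of "T / Suc n"] h(1)[of n]
    by (intro integrable_divide Bochner_Integration.integrable_diff) auto
  have le: "(\<integral>\<^sup>+t. norm (a n t) \<partial>leb T) \<le> (\<integral>\<^sup>+t. norm (q t) \<partial>leb T)" for n
  proof -
    \<comment> \<open>The average of q is dominated by the average of its absolute value, whose
      integral is controlled by telescoping.\<close>
    let ?Q = "primitive (\<lambda>r. \<bar>q r\<bar>)"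
    have iQ: "integrable (leb T) (\<lambda>t. ?Q t - ?Q (t - T / Suc n))"
      using integrable_primitive_shift[OF integrable_abs[OF int], of 0] integrable_primitive_shift[OF integrable_abs[OF int], of "T / Suc n"] h(1)[of n]
      by (intro Bochner_Integration.integrable_diff) auto
    have "(\<integral>t. norm (a n t) \<partial>leb T) \<le> (\<integral>t. (?Q t - ?Q (t - T / Suc n)) / (T / Suc n) \<partial>leb T)"
    proof (rule integral_mono)
      show "norm (a n t) \<le> (?Q t - ?Q (t - T / Suc n)) / (T / Suc n)" if "t \<in> space (leb T)" for t
        using abs_primitive_diff_le[OF int, of "t - T / Suc n" t] that h(1)[of n]
        unfolding a_def real_norm_def abs_divide by (intro frac_le) auto
    qed (use iQ ia in auto)
    also have "\<dots> = (\<integral>t. (?Q t - ?Q (t - T / Suc n)) \<partial>leb T) / (T / Suc n)"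
      by (rule integral_divide_zero)
    also have "\<dots> \<le> (T / Suc n * ?Q T) / (T / Suc n)"
      using integral_primitive_diff_le[OF integrable_abs[OF int], of "T / Suc n"] h[of n]
      by (intro divide_right_mono) auto
    also have "\<dots> = (\<integral>t. norm (q t) \<partial>leb T)"
      using h(1)[of n] T by (simp add: primitive_eq)
    finally have "ennreal (\<integral>t. norm (a n t) \<partial>leb T) \<le> ennreal (\<integral>t. norm (q t) \<partial>leb T)"
      by (rule ennreal_leI)
    then show ?thesis
      using nn_integral_eq_integral[OF integrable_norm[OF ia[of n]]] nn_integral_eq_integral[OF integrable_norm[OF int]]
      by simp
  qed
  have lim: "(\<lambda>n. \<integral>\<^sup>+t. norm (a n t - q t) \<partial>leb T) \<longlonglongrightarrow> 0"
    using steklov_AE_tendsto[OF int T] 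
    by (intro Scheffe_lemma2 le int borel_measurable_integrable[OF ia]) (simp add: a_def)
  have B: "0 \<le> B" using g(2)[of 0] by linarith
  have ig: "integrable (leb T) (\<lambda>t. g t * r t)" if "integrable (leb T) r" for r
    by (rule Bochner_Integration.integrable_bound[OF integrable_mult_right[OF integrable_abs[OF that], of B]])
       (use g that B in \<open>auto intro!: mult_right_mono simp: abs_mult\<close>)
  have "(\<lambda>n. \<integral>\<^sup>+t. norm (g t * a n t - g t * q t) \<partial>leb T) \<longlonglongrightarrow> 0"
  proof (rule tendsto_sandwich[OF _ _ tendsto_const])
    show "\<forall>\<^sub>F n in sequentially. (\<integral>\<^sup>+t. norm (g t * a n t - g t * q t) \<partial>leb T)
        \<le> ennreal B * (\<integral>\<^sup>+t. norm (a n t - q t) \<partial>leb T)"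
    proof (intro always_eventually allI)
      fix n
      have "(\<integral>\<^sup>+t. norm (g t * a n t - g t * q t) \<partial>leb T)
          \<le> (\<integral>\<^sup>+t. ennreal B * norm (a n t - q t) \<partial>leb T)"
        using g(2) B by (intro nn_integral_mono)
          (auto simp: ennreal_mult[symmetric] abs_mult mult_right_mono simp flip: right_diff_distrib)
      also have "\<dots> = ennreal B * (\<integral>\<^sup>+t. norm (a n t - q t) \<partial>leb T)"
        using ia int by (intro nn_integral_cmult) auto
      finally show "(\<integral>\<^sup>+t. norm (g t * a n t - g t * q t) \<partial>leb T)
        \<le> ennreal B * (\<integral>\<^sup>+t. norm (a n t - q t) \<partial>leb T)" .
    qed
    show "(\<lambda>n. ennreal B * (\<integral>\<^sup>+t. norm (a n t - q t) \<partial>leb T)) \<longlonglongrightarrow> 0"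
      using tendsto_mult_ennreal[OF tendsto_const lim, of "ennreal B"] by simp
  qed auto
  from tendsto_L1_int[OF ig[OF ia] ig[OF int] this] show ?thesis
    by (simp add: a_def)
qed

section \<open>Weak derivatives of scalar functions of time\<close>

text \<open>The rescaled s is a nonnegative kernel of mass 1 concentrated immediately to the right
  of a, so it reproduces the value of a continuous function at a.\<close>

lemma smooth_step_approximation:
  fixes y S s :: "real \<Rightarrow> real"
  assumes der: "\<And>x. (S has_real_derivative s x) (at x)" and s: "continuous_on UNIV s" "\<And>x. 0 \<le> s x"
    and S0: "\<And>x. x \<le> 0 \<Longrightarrow> S x = 0" and S1: "\<And>x. 1 \<le> x \<Longrightarrow> S x = 1"
    and s0: "\<And>x. x \<le> 0 \<or> 1 \<le> x \<Longrightarrow> s x = 0"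
    and y: "continuous_on {0..T} y" and a: "0 < a" "a < T"
  shows "(\<lambda>n. \<integral>t. real (Suc n) * s (real (Suc n) * (t - a)) * y t \<partial>leb T) \<longlonglongrightarrow> y a"
proof (rule LIMSEQ_I)
  fix e :: real assume e: "0 < e"
  define k where "k n t = real (Suc n) * s (real (Suc n) * (t - a))" for n t
  have k: "continuous_on A (k n)" "0 \<le> k n t" for A n t
    unfolding k_def[abs_def] using s by (auto intro!: continuous_intros continuous_on_compose2[OF s(1)])
  have "continuous (at a within {0..T}) y"
    using y a by (auto simp: continuous_on_eq_continuous_within)
  then obtain d where d: "d > 0" "\<And>t. t \<in> {0..T} \<Longrightarrow> \<bar>t - a\<bar> < d \<Longrightarrow> \<bar>y t - y a\<bar> < e / 2"
    using e by (fastforce simp: continuous_within_eps_delta dist_real_def dest: spec[where x="e/2"])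
  \<comment> \<open>The kernel is supported in [a, a + 1/(n+1)]: a length below d shows it only
    values near \<open>y a\<close>, and a length below T - a keeps its whole mass in [0, T].\<close>
  have "\<forall>\<^sub>F n in sequentially. inverse (real (Suc n)) < min d (T - a)"
    using d(1) a by (intro order_tendstoD(2)[OF LIMSEQ_inverse_real_of_nat]) auto
  then obtain n0 where n0: "\<And>n. n \<ge> n0 \<Longrightarrow> inverse (real (Suc n)) < min d (T - a)"
    by (auto simp: eventually_sequentially)
  show "\<exists>no. \<forall>n\<ge>no. norm ((\<integral>t. real (Suc n) * s (real (Suc n) * (t - a)) * y t \<partial>leb T) - y a) < e"
  proof (intro exI allI impI)
    fix n assume "n0 \<le> n"
    have n: "1 < real (Suc n) * d" "1 < real (Suc n) * (T - a)"
      using n0[OF \<open>n0 \<le> n\<close>] by (auto simp: field_simps)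
    have mass: "(\<integral>t. k n t \<partial>leb T) = 1"
    proof -
      have "((\<lambda>t. S (real (Suc n) * (t - a))) has_vector_derivative k n t) (at t within {0..T})" for t
      proof -
        have "((\<lambda>t. real (Suc n) * (t - a)) has_real_derivative real (Suc n)) (at t)"
          by (auto intro!: derivative_eq_intros)
        from DERIV_chain2[OF der this]
        have "((\<lambda>t. S (real (Suc n) * (t - a))) has_real_derivative k n t) (at t)"
          by (simp add: k_def mult.commute)
        then show ?thesis
          by (simp add: has_real_derivative_iff_has_vector_derivative has_vector_derivative_at_within)
      qed
      then have "(k n has_integral (S (real (Suc n) * (T - a)) - S (real (Suc n) * (0 - a)))) {0..T}"
        using a by (intro fundamental_theorem_of_calculus) auto
      moreover have "real (Suc n) * (0 - a) \<le> 0"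
        using a by (intro mult_nonneg_nonpos) auto
      ultimately have "(k n has_integral 1) {0..T}"
        using n(2) by (simp add: S0 S1)
      then show ?thesis
        using lebesgue_integral_eq_integral[OF continuous_imp_integrable_real[OF k(1)], of 0 T n]
        by (simp add: integral_unique lebesgue_setsI)
    qed
    have ik: "integrable (leb T) (\<lambda>t. k n t * z t)" if "continuous_on {0..T} z" for z
      by (intro continuous_imp_integrable_real continuous_on_mult k that)
    have "\<bar>(\<integral>t. k n t * y t \<partial>leb T) - y a\<bar> = \<bar>\<integral>t. k n t * (y t - y a) \<partial>leb T\<bar>"
      using ik[OF y] ik[OF continuous_on_const[of _ "y a"]] mass by (simp add: right_diff_distrib)
    also have "\<dots> \<le> (\<integral>t. k n t * (e/2) \<partial>leb T)"
    proof (rule order_trans[OF integral_abs_bound integral_mono])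
      fix t assume "t \<in> space (leb T)"
      then have t: "t \<in> {0..T}" by simp
      show "\<bar>k n t * (y t - y a)\<bar> \<le> k n t * (e/2)"
      proof (cases "\<bar>t - a\<bar> < d")
        case True
        then show ?thesis
          using mult_left_mono[OF less_imp_le[OF d(2)[OF t True]] k(2)[of n t]] k(2)[of n t]
          by (simp add: abs_mult)
      next
        case False
        then have "real (Suc n) * (t - a) \<le> 0 \<or> 1 \<le> real (Suc n) * (t - a)"
        proof (cases "t \<le> a")
          case True
          then show ?thesis by (auto intro!: mult_nonneg_nonpos)
        next
          case False
          then have "real (Suc n) * d \<le> real (Suc n) * (t - a)"
            using \<open>\<not> \<bar>t - a\<bar> < d\<close> by (intro mult_left_mono) auto
          then show ?thesis using n(1) by linarith
        qed
        then have "k n t = 0"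
          unfolding k_def using s0 by simp
        then show ?thesis by simp
      qed
    qed (intro integrable_abs ik continuous_intros y)+
    also have "\<dots> = e / 2"
      using mass by simp
    finally show "norm ((\<integral>t. real (Suc n) * s (real (Suc n) * (t - a)) * y t \<partial>leb T) - y a) < e"
      using e by (simp add: k_def)
  qed
qed

text \<open>A smoothed indicator of the interval from a to c has as derivative an approximate point
  mass at a minus one at c. Testing with it gives the increment of y as an integral of q; continuity
  of y gives the point values meaning and extends the formula to the endpoints.\<close>

lemma weak_derivative_imp_primitive:
  fixes y q :: "real \<Rightarrow> real"
  assumes y: "continuous_on {0..T} y" and int: "integrable (leb T) q" and T: "0 < T"
    and weak: "\<And>\<phi>. test_function {0<..<T} \<phi> \<Longrightarrow>
      (\<integral>t. deriv \<phi> t * y t \<partial>leb T) = - (\<integral>t. \<phi> t * q t \<partial>leb T)"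
    and t: "t \<in> {0..T}"
  shows "y t = y 0 + primitive q t"
proof -
  obtain S s :: "real \<Rightarrow> real"
    where S: "\<And>k. C_k k S" and der: "\<And>x. (S has_real_derivative s x) (at x)" and s: "continuous_on UNIV s"
    and S0: "\<And>x. x \<le> 0 \<Longrightarrow> S x = 0" and S1: "\<And>x. 1 \<le> x \<Longrightarrow> S x = 1" and s_nn: "\<And>x. 0 \<le> s x"
    and s0: "\<And>x. x \<le> 0 \<or> 1 \<le> x \<Longrightarrow> s x = 0"
    by (rule smooth_step_exists) blast
  have S_bound: "0 \<le> S x" "S x \<le> 1" for x
  proof -
    have mono: "S x \<le> S y" if "x \<le> y" for x y
      by (rule DERIV_nonneg_imp_nondecreasing[OF that]) (use der s_nn in blast)
    show "0 \<le> S x" using mono[of "min 0 x" x] S0[of "min 0 x"] by simp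
    show "S x \<le> 1" using mono[of x "max 1 x"] S1[of "max 1 x"] by simp
  qed
  have S_meas: "(\<lambda>t. S (c * (t - a))) \<in> borel_measurable (leb T)" for a c
  proof -
    have "continuous_on UNIV (\<lambda>t. S (c * (t - a)))"
      using S[of 0] by (auto intro!: continuous_intros continuous_on_compose2[of UNIV S])
    then show ?thesis
      by (intro measurable_restrict_space1 measurable_completion) (simp add: borel_measurable_continuous_onI)
  qed
  have S_lim: "(\<lambda>n. S (real (Suc n) * x)) \<longlonglongrightarrow> indicator {0<..} x" for x
  proof (cases "0 < x")
    case True
    have "\<forall>\<^sub>F n in sequentially. inverse (real (Suc n)) < x"
      using True by (intro order_tendstoD(2)[OF LIMSEQ_inverse_real_of_nat])
    then have "\<forall>\<^sub>F n in sequentially. S (real (Suc n) * x) = indicator {0<..} x"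
      by eventually_elim (use True in \<open>auto intro!: S1 simp: field_simps\<close>)
    then show ?thesis by (rule tendsto_eventually)
  next
    case False
    then have "real (Suc n) * x \<le> 0" for n by (intro mult_nonneg_nonpos) auto
    then show ?thesis using False by (simp add: S0)
  qed
  have diff: "y c - y a = primitive q c - primitive q a" if ac: "0 < a" "a < c" "c < T" for a c
  proof -
    \<comment> \<open>Rises from 0 to 1 right after a and falls back right after c. Its support ends
      at c + 1/(n+1), so it is a test function once that is below T.\<close>
    define \<phi> where "\<phi> n t = S (real (Suc n) * (t - a)) - S (real (Suc n) * (t - c))" for n t
    have d\<phi>: "deriv (\<phi> n) t = real (Suc n) * s (real (Suc n) * (t - a)) - real (Suc n) * s (real (Suc n) * (t - c))" for n t
      unfolding \<phi>_def[abs_def]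
      by (intro DERIV_imp_deriv DERIV_diff DERIV_chain2[OF der, THEN DERIV_cong])
         (auto intro!: derivative_eq_intros)
    have test: "test_function {0<..<T} (\<phi> n)" if n: "inverse (real (Suc n)) < T - c" for n
    proof (rule test_functionI)
      have Ck: "C_k k (\<lambda>t. S (real (Suc n) * (t - r)))" for k r
        using C_k_affine[OF S, of k "real (Suc n)" "1::real" "- real (Suc n) * r"] by (simp add: algebra_simps)
      show "C_k k (\<phi> n)" for k
        unfolding \<phi>_def[abs_def] by (intro C_k_diff Ck)
      show "{a..c + inverse (real (Suc n))} \<subseteq> {0<..<T}"
        using ac n by auto
      show "\<phi> n t = 0" if "t \<notin> {a..c + inverse (real (Suc n))}" for t
      proof (cases "t < a")
        case True
        then have "real (Suc n) * (t - a) \<le> 0" "real (Suc n) * (t - c) \<le> 0"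
          using ac by (intro mult_nonneg_nonpos; simp)+
        then show ?thesis by (simp add: \<phi>_def S0)
      next
        case False
        then have "inverse (real (Suc n)) \<le> t - c" "inverse (real (Suc n)) \<le> t - a"
          using that ac by auto
        then have "1 \<le> real (Suc n) * (t - a)" "1 \<le> real (Suc n) * (t - c)"
          by (simp_all add: field_simps)
        then show ?thesis unfolding \<phi>_def by (simp add: S1)
      qed
    qed simp
    have ik: "integrable (leb T) (\<lambda>t. real (Suc n) * s (real (Suc n) * (t - r)) * y t)" for n r
      by (intro continuous_imp_integrable_real continuous_intros y continuous_on_compose2[OF s]) auto
    have l1: "(\<lambda>n. \<integral>t. deriv (\<phi> n) t * y t \<partial>leb T) \<longlonglongrightarrow> y a - y c"
      unfolding d\<phi> left_diff_distrib Bochner_Integration.integral_diff[OF ik ik]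
      using ac by (intro tendsto_diff smooth_step_approximation[OF der s s_nn S0 S1 s0 y]) auto
    have l2: "(\<lambda>n. - (\<integral>t. \<phi> n t * q t \<partial>leb T)) \<longlonglongrightarrow> - (\<integral>t. indicator {a..c} t * q t \<partial>leb T)"
    proof (intro tendsto_minus integral_dominated_convergence[OF _ _ integrable_abs[OF int]])
      show "(\<lambda>t. indicator {a..c} t * q t) \<in> borel_measurable (leb T)"
        using ac by (intro borel_measurable_times borel_measurable_integrable[OF int] borel_measurable_indicator)
          (auto simp: sets_restrict_space_iff lebesgue_setsI)
      show "(\<lambda>t. \<phi> n t * q t) \<in> borel_measurable (leb T)" for n
        unfolding \<phi>_def by (intro borel_measurable_times borel_measurable_integrable[OF int] borel_measurable_diff S_meas)
      have "(\<lambda>n. \<phi> n t * q t) \<longlonglongrightarrow> (indicator {0<..} (t - a) - indicator {0<..} (t - c)) * q t" for t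
        unfolding \<phi>_def by (intro tendsto_intros S_lim)
      \<comment> \<open>The limit of the steps is the half-open indicator that omits a, which
        differs from the closed one in a single point.\<close>
      moreover have "indicator {0<..} (t - a) - indicator {0<..} (t - c) = (indicator {a..c} t :: real)" if "t \<noteq> a" for t
        using ac that by (auto simp: indicator_def)
      ultimately have "(\<lambda>n. \<phi> n t * q t) \<longlonglongrightarrow> indicator {a..c} t * q t" if "t \<notin> {a}" for t
        using that by (metis singletonI)
      moreover have "AE t in lebesgue. t \<notin> {a}"
        by (rule AE_not_in) auto
      ultimately show "AE t in leb T. (\<lambda>n. \<phi> n t * q t) \<longlonglongrightarrow> indicator {a..c} t * q t"
        by (subst AE_restrict_space_iff) (auto simp: lebesgue_setsI elim: eventually_mono)
      have "\<bar>\<phi> n t\<bar> \<le> 1" for n t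
        using S_bound unfolding \<phi>_def abs_le_iff by (smt (verit))
      then show "AE t in leb T. norm (\<phi> n t * q t) \<le> \<bar>q t\<bar>" for n
        by (auto simp: abs_mult mult_left_le_one_le)
    qed
    have "\<forall>\<^sub>F n in sequentially. inverse (real (Suc n)) < T - c"
      using ac by (intro order_tendstoD(2)[OF LIMSEQ_inverse_real_of_nat]) auto
    then have ev: "\<forall>\<^sub>F n in sequentially. (\<integral>t. deriv (\<phi> n) t * y t \<partial>leb T) = - (\<integral>t. \<phi> n t * q t \<partial>leb T)"
      by eventually_elim (intro weak test)
    have "y a - y c = - (\<integral>t. indicator {a..c} t * q t \<partial>leb T)"
      by (rule LIMSEQ_unique[OF Lim_transform_eventually[OF l1 ev] l2])
    also have "(\<integral>t. indicator {a..c} t * q t \<partial>leb T) = (\<integral>t. q t \<partial>lebesgue_on {a..c})"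
    proof -
      have "(\<lambda>t. indicator {a..c} t * q t) = (\<lambda>t. if t \<in> {a..c} then q t else 0)"
        by (auto simp: indicator_def)
      then show ?thesis
        using integral_restrict[of "{a..c}" "{0..T}" q] ac by (simp add: lebesgue_setsI subset_iff)
    qed
    also have "\<dots> = primitive q c - primitive q a"
      using ac by (subst primitive_diff[OF int]) auto
    finally show ?thesis by simp
  qed
  define r where "r t = y t - primitive q t" for t
  have r: "continuous_on {0..T} r"
    unfolding r_def[abs_def] using y continuous_on_subset[OF continuous_on_primitive[OF int]] 
    by (intro continuous_on_diff) auto
  have const: "r x = r (T/2)" if "x \<in> {0<..<T}" for x
    using diff[of x "T/2"] diff[of "T/2" x] that T by (cases x "T/2" rule: linorder_cases) (auto simp: r_def)
  have cl: "closure {0<..<T} = {0..T}"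
    using T by simp
  have "r x = r (T/2)" if "x \<in> {0..T}" for x
    by (rule continuous_constant_on_closure[of "{0<..<T}", OF _ const]) (simp_all only: cl r that)
  from this[OF t] this[of 0] T show ?thesis
    by (simp add: r_def)
qed

section \<open>Semi-inner products\<close>

text \<open>The form is only semidefinite because functions vanishing almost everywhere have norm 0
  without being 0. The laws are confined to V because the L2 pairing is an integral, additive only
  where the products are integrable.\<close>

locale semi_inner =
  fixes V :: "'v::real_vector set" and ip :: "'v \<Rightarrow> 'v \<Rightarrow> real" and N :: "'v \<Rightarrow> real"
  assumes subspace_V: "subspace V"
    and ip_sym: "\<lbrakk>x \<in> V; y \<in> V\<rbrakk> \<Longrightarrow> ip x y = ip y x"
    and ip_add_left: "\<lbrakk>x \<in> V; y \<in> V; z \<in> V\<rbrakk> \<Longrightarrow> ip (x + y) z = ip x z + ip y z"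
    and ip_scale_left: "\<lbrakk>x \<in> V; y \<in> V\<rbrakk> \<Longrightarrow> ip (c *\<^sub>R x) y = c * ip x y"
    and ip_nonneg: "x \<in> V \<Longrightarrow> 0 \<le> ip x x"
    and N_def: "N x = sqrt (ip x x)"
begin

lemma V_closed:
  "0 \<in> V" "x \<in> V \<Longrightarrow> y \<in> V \<Longrightarrow> x + y \<in> V" "x \<in> V \<Longrightarrow> y \<in> V \<Longrightarrow> x - y \<in> V"
  "x \<in> V \<Longrightarrow> c *\<^sub>R x \<in> V" "x \<in> V \<Longrightarrow> - x \<in> V"
  using subspace_V by (auto intro: subspace_0 subspace_add subspace_diff subspace_scale subspace_neg)

lemma ip_0_left: "x \<in> V \<Longrightarrow> ip 0 x = 0"
  using ip_scale_left[of 0 x 0] V_closed by simp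

lemma ip_minus_left: "\<lbrakk>x \<in> V; y \<in> V\<rbrakk> \<Longrightarrow> ip (- x) y = - ip x y"
  using ip_scale_left[of x y "-1"] by simp

lemma ip_diff_left: "\<lbrakk>x \<in> V; y \<in> V; z \<in> V\<rbrakk> \<Longrightarrow> ip (x - y) z = ip x z - ip y z"
  using ip_add_left[of x "- y" z] V_closed ip_minus_left[of y z] by simp

lemma ip_diff_right: "\<lbrakk>x \<in> V; y \<in> V; z \<in> V\<rbrakk> \<Longrightarrow> ip z (x - y) = ip z x - ip z y"
  using ip_diff_left[of x y z] V_closed ip_sym[of z] by simp

lemma ip_add_right: "\<lbrakk>x \<in> V; y \<in> V; z \<in> V\<rbrakk> \<Longrightarrow> ip z (x + y) = ip z x + ip z y"
  using ip_add_left[of x y z] V_closed ip_sym[of z] by simp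

lemma ip_sum_left:
  "finite A \<Longrightarrow> (\<And>a. a \<in> A \<Longrightarrow> x a \<in> V) \<Longrightarrow> y \<in> V \<Longrightarrow> (\<Sum>a\<in>A. x a) \<in> V \<and> ip (\<Sum>a\<in>A. x a) y = (\<Sum>a\<in>A. ip (x a) y)"
  by (induction A rule: finite_induct) (auto simp: V_closed ip_0_left ip_add_left)

lemma N_nonneg: "x \<in> V \<Longrightarrow> 0 \<le> N x"
  by (simp add: N_def ip_nonneg)

lemma N_sq: "x \<in> V \<Longrightarrow> (N x)\<^sup>2 = ip x x"
  by (simp add: N_def ip_nonneg)

lemma ip_diff_sq: "\<lbrakk>x \<in> V; y \<in> V\<rbrakk> \<Longrightarrow> ip (x - y) (x - y) = ip x x - 2 * ip x y + ip y y"
  by (simp add: ip_diff_left ip_diff_right V_closed ip_sym[of y x])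

lemma Cauchy_Schwarz:
  assumes "x \<in> V" "y \<in> V"
  shows "\<bar>ip x y\<bar> \<le> N x * N y"
proof -
  have *: "0 \<le> ip x x - 2 * (t * ip x y) + t\<^sup>2 * ip y y" for t
  proof -
    have "0 \<le> ip (x - t *\<^sub>R y) (x - t *\<^sub>R y)"
      using assms by (intro ip_nonneg V_closed)
    also have "\<dots> = ip x x - 2 * (t * ip x y) + t\<^sup>2 * ip y y"
      using assms V_closed ip_sym[of x "t *\<^sub>R y"] ip_sym[of y "t *\<^sub>R y"] ip_sym[of x y]
      by (simp add: ip_diff_sq ip_scale_left power2_eq_square)
    finally show ?thesis .
  qed
  have "(ip x y)\<^sup>2 \<le> ip x x * ip y y"
  proof (cases "ip y y = 0")
    case True
    have "ip x y = 0"
    proof (rule ccontr)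
      assume "ip x y \<noteq> 0"
      \<comment> \<open>With \<open>ip y y = 0\<close> the lower bound is affine in t, and this t
        gives it the value -1.\<close>
      then show False
        using *[of "(ip x x + 1) / (2 * ip x y)"] True ip_nonneg[OF assms(1)] by simp
    qed
    then show ?thesis using True by simp
  next
    case False
    then have c: "ip y y > 0"
      using ip_nonneg[OF assms(2)] by simp
    have "0 \<le> (ip x x - 2 * (ip x y / ip y y * ip x y) + (ip x y / ip y y)\<^sup>2 * ip y y) * ip y y"
      using *[of "ip x y / ip y y"] c by simp
    also have "\<dots> = ip x x * ip y y - (ip x y)\<^sup>2"
      using c by (simp add: field_simps power2_eq_square)
    finally show ?thesis by simp
  qed
  then have "sqrt ((ip x y)\<^sup>2) \<le> sqrt (ip x x * ip y y)"
    by (rule real_sqrt_le_mono)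
  then show ?thesis
    by (simp add: N_def real_sqrt_mult)
qed

lemma ip_eq_0: "\<lbrakk>x \<in> V; y \<in> V; N x = 0\<rbrakk> \<Longrightarrow> ip x y = 0"
  using Cauchy_Schwarz[of x y] by simp

text \<open>The weight is kept free for three uses: k = h absorbs an increment over an interval of
  length h, k / h rescales difference quotients, and small k removes an approximation error.\<close>

lemma Young:
  assumes "x \<in> V" "y \<in> V" "0 < k"
  shows "\<bar>ip x y\<bar> \<le> k / 2 * (N x)\<^sup>2 + (N y)\<^sup>2 / (2 * k)"
proof -
  have "0 \<le> (k * N x - N y)\<^sup>2 / (2 * k)"
    using assms by simp
  also have "\<dots> = k / 2 * (N x)\<^sup>2 + (N y)\<^sup>2 / (2 * k) - N x * N y"
    using assms(3) by (simp add: power2_eq_square field_simps)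
  finally show ?thesis
    using Cauchy_Schwarz[OF assms(1,2)] by linarith
qed

lemma N_triangle:
  assumes "x \<in> V" "y \<in> V"
  shows "N (x + y) \<le> N x + N y"
proof (rule power2_le_imp_le)
  have "(N (x + y))\<^sup>2 = ip x x + 2 * ip x y + ip y y"
    using assms by (simp add: N_sq V_closed ip_add_left ip_add_right ip_sym[of y x])
  also have "\<dots> \<le> (N x + N y)\<^sup>2"
    using Cauchy_Schwarz[OF assms] assms by (simp add: power2_sum N_sq)
  finally show "(N (x + y))\<^sup>2 \<le> (N x + N y)\<^sup>2" .
qed (use assms N_nonneg in auto)

lemma N_scale: "x \<in> V \<Longrightarrow> N (c *\<^sub>R x) = \<bar>c\<bar> * N x"
  using ip_sym[of x "c *\<^sub>R x"] by (simp add: N_def V_closed ip_scale_left real_sqrt_mult flip: mult.assoc)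

lemma N_0: "N 0 = 0"
  using N_scale[of 0 0] V_closed by simp

lemma N_minus_commute: "\<lbrakk>x \<in> V; y \<in> V\<rbrakk> \<Longrightarrow> N (x - y) = N (y - x)"
  using N_scale[of "x - y" "-1"] V_closed by simp

lemma N_diff_le: "\<lbrakk>x \<in> V; y \<in> V\<rbrakk> \<Longrightarrow> N (x - y) \<le> N x + N y"
  using N_triangle[of x "- y"] N_scale[of y "-1"] V_closed by simp

lemma N_reverse_triangle: "\<lbrakk>x \<in> V; y \<in> V\<rbrakk> \<Longrightarrow> \<bar>N x - N y\<bar> \<le> N (x - y)"
  using N_triangle[of "x - y" y] N_triangle[of "y - x" x] N_minus_commute[of x y] V_closed by (simp add: abs_le_iff)

lemma N_diff_sq_le: 
  assumes "x \<in> V" "y \<in> V" 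
  shows "(N (x - y))\<^sup>2 \<le> 2 * (N x)\<^sup>2 + 2 * (N y)\<^sup>2"
proof -
  have "(N (x - y))\<^sup>2 \<le> (N x + N y)\<^sup>2"
    using N_diff_le[OF assms] N_nonneg V_closed assms by (intro power_mono) auto
  also have "\<dots> \<le> 2 * (N x)\<^sup>2 + 2 * (N y)\<^sup>2"
    using sum_squares_bound[of "N x" "N y"] by (simp add: power2_sum)
  finally show ?thesis .
qed

lemma ip_tendsto:
  assumes "(\<lambda>i. N (x - s i)) \<longlonglongrightarrow> 0" "x \<in> V" "\<And>i. s i \<in> V" "y \<in> V"
  shows "(\<lambda>i. ip y (s i)) \<longlonglongrightarrow> ip y x"
proof -
  have "(\<lambda>i. ip y (s i) - ip y x) \<longlonglongrightarrow> 0"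
  proof (rule Lim_null_comparison)
    show "\<forall>\<^sub>F i in sequentially. norm (ip y (s i) - ip y x) \<le> N y * N (x - s i)"
    proof (intro always_eventually allI)
      fix i
      show "norm (ip y (s i) - ip y x) \<le> N y * N (x - s i)"
        using Cauchy_Schwarz[of y "x - s i"] assms V_closed(3) by (simp add: ip_diff_right abs_minus_commute)
    qed
    show "(\<lambda>i. N y * N (x - s i)) \<longlonglongrightarrow> 0"
      using tendsto_mult_right_zero[OF assms(1)] by simp
  qed
  then show ?thesis
    by (simp add: LIM_zero_iff)
qed

end

section \<open>Bochner spaces over a semi-inner product space\<close>

text \<open>Lebesgue measure is complete, so a change on a null set preserves measurability;
  extension by zero carries this over to \<open>lebesgue_on S\<close>.\<close>

lemma borel_measurable_lebesgue_on_AE: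
  fixes f :: "'a::euclidean_space \<Rightarrow> real"
  assumes f: "f \<in> borel_measurable (lebesgue_on S)" and ae: "AE x in lebesgue_on S. f x = g x"
    and S: "S \<in> sets lebesgue"
  shows "g \<in> borel_measurable (lebesgue_on S)"
proof (rule borel_measurable_if_D)
  show "(\<lambda>x. if x \<in> S then g x else 0) \<in> borel_measurable lebesgue"
  proof (rule borel_measurable_AE)
    show "(\<lambda>x. if x \<in> S then f x else 0) \<in> borel_measurable lebesgue"
      using f S by (rule borel_measurable_if_I)
    have "AE x in lebesgue. x \<in> S \<longrightarrow> f x = g x"
      using ae S by (simp add: AE_restrict_space_iff)
    then show "AE x in lebesgue. (if x \<in> S then f x else 0) = (if x \<in> S then g x else 0)"
      by (rule eventually_mono) simp
  qed
qed

lemma borel_measurable_lebesgue_on_AE_limit: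
  fixes f :: "nat \<Rightarrow> 'a::euclidean_space \<Rightarrow> real"
  assumes f: "\<And>i. f i \<in> borel_measurable (lebesgue_on S)" and ae: "AE x in lebesgue_on S. (\<lambda>i. f i x) \<longlonglongrightarrow> g x"
    and S: "S \<in> sets lebesgue"
  shows "g \<in> borel_measurable (lebesgue_on S)"
proof (rule borel_measurable_lebesgue_on_AE[OF _ _ S])
  show "(\<lambda>x. lim (\<lambda>i. f i x)) \<in> borel_measurable (lebesgue_on S)"
    by (rule borel_measurable_lim_metric[OF f])
  show "AE x in lebesgue_on S. lim (\<lambda>i. f i x) = g x"
    using ae by eventually_elim (rule limI)
qed

lemma AE_lebesgue_on_open_Icc:
  assumes "AE t in lebesgue_on {a<..<b::real}. P t"
  shows "AE t in lebesgue_on {a..b}. P t"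
proof -
  have "AE t in lebesgue. t \<in> {a<..<b} \<longrightarrow> P t"
    using assms by (simp add: AE_restrict_space_iff)
  moreover have "AE t in lebesgue. t \<notin> {a, b}"
    by (rule AE_not_in) auto
  ultimately have "AE t in lebesgue. t \<in> {a..b} \<longrightarrow> P t"
    by eventually_elim auto
  then show ?thesis
    by (simp add: AE_restrict_space_iff lebesgue_setsI)
qed

lemma AE_lebesgue_on_shift:
  assumes "AE t in lebesgue_on {0..T::real}. P t" "0 \<le> h"
  shows "AE t in lebesgue_on {0..T}. h \<le> t \<longrightarrow> P (t - h)"
proof -
  have "AE t in lebesgue. t \<in> {0..T} \<longrightarrow> P t"
    using assms by (simp add: AE_restrict_space_iff lebesgue_setsI)
  then have "{t \<in> {0..T}. \<not> P t} \<in> null_sets lebesgue"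
    by (auto simp: completion.AE_iff_null_sets)
  then have "negligible {t \<in> {0..T}. \<not> P t}"
    by (simp add: negligible_iff_null_sets)
  then have "negligible ((+) h ` {t \<in> {0..T}. \<not> P t})"
    by (rule negligible_translation)
  then have "(+) h ` {t \<in> {0..T}. \<not> P t} \<in> null_sets lebesgue"
    by (simp add: negligible_iff_null_sets)
  then have "AE t in lebesgue. t \<notin> (+) h ` {t \<in> {0..T}. \<not> P t}"
    by (rule AE_not_in)
  then have "AE t in lebesgue. t \<in> {0..T} \<longrightarrow> h \<le> t \<longrightarrow> P (t - h)"
  proof (rule eventually_mono, intro impI)
    fix t assume t: "t \<notin> (+) h ` {t \<in> {0..T}. \<not> P t}" "t \<in> {0..T}" "h \<le> t"
    show "P (t - h)"
    proof (rule ccontr)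
      assume "\<not> P (t - h)"
      then have "t - h \<in> {t \<in> {0..T}. \<not> P t}"
        using t assms(2) by auto
      from imageI[OF this, of "(+) h"] t(1) show False by simp
    qed
  qed
  then show ?thesis
    by (simp add: AE_restrict_space_iff lebesgue_setsI)
qed

locale semi_inner_time = semi_inner +
  fixes T :: real
  assumes T_pos: "0 < T"
begin

abbreviation M :: "real measure" where "M \<equiv> leb T"

abbreviation meas :: "(real \<Rightarrow> 'a) \<Rightarrow> bool" where "meas \<equiv> bochner_measurable M V N"

abbreviation weak_dt :: "(real \<Rightarrow> 'a) \<Rightarrow> (real \<Rightarrow> 'a) \<Rightarrow> bool" where
  "weak_dt \<equiv> has_weak_time_deriv {0..T} V N"

abbreviation cont_rep :: "(real \<Rightarrow> 'a) \<Rightarrow> (real \<Rightarrow> 'a) \<Rightarrow> bool" where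
  "cont_rep \<equiv> continuous_representative {0..T} V N"

abbreviation sbi :: "(real \<Rightarrow> 'a) \<Rightarrow> bool" where
  "sbi \<equiv> Bochner_Integration.simple_bochner_integrable M"

abbreviation simple_int :: "(real \<Rightarrow> 'a) \<Rightarrow> 'a" where
  "simple_int \<equiv> Bochner_Integration.simple_bochner_integral M"

lemma finite_measure_M: "finite_measure M"
  by (intro finite_measure_lebesgue_on) simp

section \<open>Measurability of pairings and norms\<close>

lemma bochner_measurableE:
  assumes "meas u"
  shows "\<exists>s. (\<forall>i. simple_function M (s i)) \<and> (\<forall>i. \<forall>t\<in>{0..T}. s i t \<in> V) \<and>
    (AE t in M. u t \<in> V \<and> (\<lambda>i. N (u t - s i t)) \<longlonglongrightarrow> 0)"
  using assms unfolding bochner_measurable_def by (auto simp: image_subset_iff)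

lemma AE_in_V: "meas u \<Longrightarrow> AE t in M. u t \<in> V"
  unfolding bochner_measurable_def by (auto elim: eventually_mono)

text \<open>A simple function takes finitely many values, so pairing with it is a finite combination
  of pairings with fixed vectors, weighted by indicators of level sets.\<close>

lemma ip_simple_function_sum:
  assumes "simple_function M s" "t \<in> {0..T}"
  shows "ip y (s t) = (\<Sum>c\<in>s ` {0..T}. indicator (s -` {c} \<inter> {0..T}) t * ip y c)"
proof -
  have "finite (s ` {0..T})"
    using assms(1) by (simp add: simple_function_def)
  then have "(\<Sum>c\<in>s ` {0..T}. indicator (s -` {c} \<inter> {0..T}) t * ip y c) = (\<Sum>c\<in>s ` {0..T}. if c = s t then ip y c else 0)"
    using assms(2) by (intro sum.cong) (auto simp: indicator_def)
  also have "\<dots> = ip y (s t)"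
    using assms(2) \<open>finite (s ` {0..T})\<close> by simp
  finally show ?thesis by simp
qed

lemma simple_function_preimage_indicator:
  assumes "simple_function M s"
  shows "(\<lambda>t. indicator (s -` {c} \<inter> {0..T}) t :: real) \<in> borel_measurable M"
  using simple_functionD(2)[OF assms, of "{c}"] by (intro borel_measurable_indicator) simp

text \<open>Weak measurability of y suffices for pairing with a strongly measurable z. This covers
  the increments of a continuous representative, which are accessible through their pairings with
  fixed vectors.\<close>

lemma borel_measurable_ip:
  assumes y: "AE t in M. y t \<in> V" and wm: "\<And>c. c \<in> V \<Longrightarrow> (\<lambda>t. ip (y t) c) \<in> borel_measurable M"
    and z: "meas z"
  shows "(\<lambda>t. ip (y t) (z t)) \<in> borel_measurable M"
proof -
  obtain s where s: "\<And>i. simple_function M (s i)" "\<And>i t. t \<in> {0..T} \<Longrightarrow> s i t \<in> V"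
    and ae: "AE t in M. z t \<in> V \<and> (\<lambda>i. N (z t - s i t)) \<longlonglongrightarrow> 0"
    using bochner_measurableE[OF z] by blast
  show ?thesis
  proof (rule borel_measurable_lebesgue_on_AE_limit)
    fix i
    have "(\<lambda>t. \<Sum>c\<in>s i ` {0..T}. indicator (s i -` {c} \<inter> {0..T}) t * ip (y t) c) \<in> borel_measurable M"
      using s by (intro borel_measurable_sum borel_measurable_times simple_function_preimage_indicator wm) auto
    then show "(\<lambda>t. ip (y t) (s i t)) \<in> borel_measurable M"
      by (rule measurable_cong[THEN iffD1, rotated]) (simp add: ip_simple_function_sum[OF s(1)])
  next
    have "AE t in M. t \<in> space M" by (rule AE_space)
    with y ae show "AE t in M. (\<lambda>i. ip (y t) (s i t)) \<longlonglongrightarrow> ip (y t) (z t)"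
      by eventually_elim (intro ip_tendsto, auto simp: s)
  qed (simp add: lebesgue_setsI)
qed

lemma borel_measurable_ip_const:
  assumes "meas u" "c \<in> V"
  shows "(\<lambda>t. ip (u t) c) \<in> borel_measurable M"
proof (rule borel_measurable_lebesgue_on_AE)
  show "(\<lambda>t. ip c (u t)) \<in> borel_measurable M"
    by (rule borel_measurable_ip[OF _ _ assms(1)]) (use assms in auto)
  show "AE t in M. ip c (u t) = ip (u t) c"
    using AE_in_V[OF assms(1)] by eventually_elim (rule ip_sym[OF assms(2)])
qed (simp add: lebesgue_setsI)

lemma borel_measurable_ip_pair:
  assumes "meas u" "meas z"
  shows "(\<lambda>t. ip (u t) (z t)) \<in> borel_measurable M"
  by (rule borel_measurable_ip[OF AE_in_V[OF assms(1)] borel_measurable_ip_const[OF assms(1)] assms(2)])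

lemma borel_measurable_N:
  assumes "meas u"
  shows "(\<lambda>t. N (u t)) \<in> borel_measurable M"
proof -
  have "(\<lambda>t. sqrt (ip (u t) (u t))) \<in> borel_measurable M"
    using borel_measurable_ip_pair[OF assms assms] by measurable
  then show ?thesis by (simp only: N_def)
qed

lemma simple_function_bochner_measurable:
  assumes "simple_function M s" "s ` space M \<subseteq> V"
  shows "meas s"
  unfolding bochner_measurable_def
  by (rule exI[of _ "\<lambda>_. s"]) (use assms N_0 in \<open>auto intro!: AE_I2\<close>)

lemma bochner_measurable_diff:
  assumes "meas u" "meas v"
  shows "meas (\<lambda>t. u t - v t)"
proof -
  obtain s where s: "\<And>i. simple_function M (s i)" "\<And>i t. t \<in> {0..T} \<Longrightarrow> s i t \<in> V"
    and s_ae: "AE t in M. u t \<in> V \<and> (\<lambda>i. N (u t - s i t)) \<longlonglongrightarrow> 0"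
    using bochner_measurableE[OF assms(1)] by blast
  obtain r where r: "\<And>i. simple_function M (r i)" "\<And>i t. t \<in> {0..T} \<Longrightarrow> r i t \<in> V"
    and r_ae: "AE t in M. v t \<in> V \<and> (\<lambda>i. N (v t - r i t)) \<longlonglongrightarrow> 0"
    using bochner_measurableE[OF assms(2)] by blast
  have "AE t in M. t \<in> space M" by (rule AE_space)
  with s_ae r_ae have "AE t in M. u t - v t \<in> V \<and> (\<lambda>i. N ((u t - v t) - (s i t - r i t))) \<longlonglongrightarrow> 0"
  proof eventually_elim
    case (elim t)
    then have sr: "s i t \<in> V" "r i t \<in> V" "u t \<in> V" "v t \<in> V" for i
      using s(2) r(2) by auto
    have eq: "(u t - v t) - (s i t - r i t) = (u t - s i t) - (v t - r i t)" for i
      by simp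
    have "(\<lambda>i. N ((u t - v t) - (s i t - r i t))) \<longlonglongrightarrow> 0"
      unfolding eq
    proof (rule Lim_null_comparison[OF always_eventually], rule allI)
      show "norm (N ((u t - s i t) - (v t - r i t))) \<le> N (u t - s i t) + N (v t - r i t)" for i
        using N_diff_le[of "u t - s i t" "v t - r i t"] N_nonneg[of "(u t - s i t) - (v t - r i t)"] sr V_closed(3)
        by simp
      show "(\<lambda>i. N (u t - s i t) + N (v t - r i t)) \<longlonglongrightarrow> 0"
        using tendsto_add[of "\<lambda>i. N (u t - s i t)" 0 _ "\<lambda>i. N (v t - r i t)" 0] elim by simp
    qed
    then show ?case
      using sr V_closed by auto
  qed
  moreover have "simple_function M (\<lambda>t. s i t - r i t)" for i
    using s(1) r(1) by (rule simple_function_compose2)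
  ultimately show ?thesis
    unfolding bochner_measurable_def using s(2) r(2) V_closed(3)
    by (intro exI[of _ "\<lambda>i t. s i t - r i t"]) auto
qed

section \<open>Square integrable functions of time and their approximation by simple
  functions\<close>

abbreviation L2V :: "(real \<Rightarrow> 'a) set" where "L2V \<equiv> L2_time {0..T} V N"

lemma L2V_diff:
  assumes "u \<in> L2V" "v \<in> L2V"
  shows "(\<lambda>t. u t - v t) \<in> L2V"
proof -
  have bm: "meas u" "meas v" "meas (\<lambda>t. u t - v t)"
    using assms bochner_measurable_diff by (auto simp: L2_time_def)
  have "integrable M (\<lambda>t. (N (u t - v t))\<^sup>2)"
  proof (rule Bochner_Integration.integrable_bound)
    show "integrable M (\<lambda>t. 2 * (N (u t))\<^sup>2 + 2 * (N (v t))\<^sup>2)"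
      using assms by (auto simp: L2_time_def)
    show "AE t in M. norm ((N (u t - v t))\<^sup>2) \<le> norm (2 * (N (u t))\<^sup>2 + 2 * (N (v t))\<^sup>2)"
      using AE_in_V[OF bm(1)] AE_in_V[OF bm(2)] by eventually_elim (use N_diff_sq_le in auto)
  qed (use borel_measurable_N[OF bm(3)] in measurable)
  then show ?thesis
    using bm by (simp add: L2_time_def)
qed

lemma integrable_ip:
  assumes u: "u \<in> L2V" and v: "v \<in> L2V"
  shows "integrable M (\<lambda>t. ip (u t) (v t))"
proof -
  have bm: "meas u" "meas v"
    using assms by (auto simp: L2_time_def)
  show ?thesis
  proof (rule Bochner_Integration.integrable_bound)
    show "integrable M (\<lambda>t. 1 / 2 * (N (u t))\<^sup>2 + (N (v t))\<^sup>2 / (2 * 1))"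
      using assms by (auto simp: L2_time_def)
    show "AE t in M. norm (ip (u t) (v t)) \<le> norm (1 / 2 * (N (u t))\<^sup>2 + (N (v t))\<^sup>2 / (2 * 1))"
      using AE_in_V[OF bm(1)] AE_in_V[OF bm(2)]
    proof eventually_elim
      case (elim t)
      then show ?case
        using Young[of "u t" "v t" 1] by simp
    qed
  qed (rule borel_measurable_ip_pair[OF bm])
qed

lemma const_L2V: "c \<in> V \<Longrightarrow> (\<lambda>_. c) \<in> L2V"
  using simple_function_bochner_measurable[of "\<lambda>_. c"] finite_measure.integrable_const[OF finite_measure_M]
  by (auto simp: L2_time_def)

text \<open>The approximating simple functions are set to zero where they exceed twice the limit.\<close>

lemma L2V_approx:
  assumes z: "z \<in> L2V"
  shows "\<exists>s. (\<forall>i. simple_function M (s i) \<and> (\<forall>t\<in>{0..T}. s i t \<in> V) \<and> s i \<in> L2V) \<and>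
    (\<lambda>i. \<integral>t. (N (z t - s i t))\<^sup>2 \<partial>M) \<longlonglongrightarrow> 0"
proof -
  have bm: "meas z"
    using z by (auto simp: L2_time_def)
  obtain s where s: "\<And>i. simple_function M (s i)" "\<And>i t. t \<in> {0..T} \<Longrightarrow> s i t \<in> V"
    and s_ae: "AE t in M. z t \<in> V \<and> (\<lambda>i. N (z t - s i t)) \<longlonglongrightarrow> 0"
    using bochner_measurableE[OF bm] by blast
  define E where "E i = {t \<in> space M. N (s i t) \<le> 2 * N (z t)}" for i
  define r where "r i t = (if t \<in> E i then s i t else 0)" for i t
  have bs: "meas (s i)" for i
    using s by (intro simple_function_bochner_measurable) auto
  have E: "E i \<in> sets M" for i
    unfolding E_def using borel_measurable_N[OF bs[of i]] borel_measurable_N[OF bm] by measurable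
  have r_sf: "simple_function M (r i)" for i
    unfolding r_def[abs_def] using E[of i] sets.sets_into_space[OF E[of i]] s(1)
    by (intro simple_function_If_set) (auto simp: Int_absorb2)
  have rV: "r i t \<in> V" if "t \<in> {0..T}" for i t
    using that s(2) V_closed by (auto simp: r_def)
  have br: "meas (r i)" for i
    using r_sf rV by (intro simple_function_bochner_measurable) auto
  have int_z: "integrable M (\<lambda>t. (N (z t))\<^sup>2)"
    using z by (simp add: L2_time_def)
  have r_bound: "N (r i t) \<le> 2 * N (z t)" if "z t \<in> V" for i t
    using N_nonneg[OF that] N_0 by (auto simp: r_def E_def)
  have rL: "r i \<in> L2V" for i
  proof -
    have "integrable M (\<lambda>t. (N (r i t))\<^sup>2)"
    proof (rule Bochner_Integration.integrable_bound)
      show "integrable M (\<lambda>t. 4 * (N (z t))\<^sup>2)" using int_z by simp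
      have "AE t in M. t \<in> space M" by (rule AE_space)
      with AE_in_V[OF bm] show "AE t in M. norm ((N (r i t))\<^sup>2) \<le> norm (4 * (N (z t))\<^sup>2)"
      proof eventually_elim
        case (elim t)
        then have "(N (r i t))\<^sup>2 \<le> (2 * N (z t))\<^sup>2"
          using r_bound rV N_nonneg by (intro power_mono) auto
        then show ?case by (simp add: power_mult_distrib)
      qed
    qed (use borel_measurable_N[OF br] in measurable)
    then show ?thesis using br by (simp add: L2_time_def)
  qed
  have "(\<lambda>i. \<integral>t. (N (z t - r i t))\<^sup>2 \<partial>M) \<longlonglongrightarrow> (\<integral>t. 0 \<partial>M)"
  proof (rule integral_dominated_convergence)
    show "(\<lambda>t. (N (z t - r i t))\<^sup>2) \<in> borel_measurable M" for i
      using borel_measurable_N[OF bochner_measurable_diff[OF bm br]] by measurable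
    \<comment> \<open>From \<open>N_diff_sq_le\<close> and the truncation bound
      \<open>N (r i t) \<le> 2 * N (z t)\<close>: 2 + 2 * 4 = 10.\<close>
    show "integrable M (\<lambda>t. 10 * (N (z t))\<^sup>2)"
      using int_z by simp
    have sp: "AE t in M. t \<in> space M" by (rule AE_space)
    with s_ae show "AE t in M. (\<lambda>i. (N (z t - r i t))\<^sup>2) \<longlonglongrightarrow> 0"
    proof eventually_elim
      case (elim t)
      then have V: "z t \<in> V" "s i t \<in> V" for i using s(2) by auto
      have "(\<lambda>i. N (z t - r i t)) \<longlonglongrightarrow> 0"
      proof (cases "N (z t) = 0")
        \<comment> \<open>A limit of norm 0 forces every truncated value to have norm 0 as well, so
          the error vanishes for each i.\<close>
        case True
        have "N (z t - r i t) = 0" for i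
        proof -
          have "N (r i t) \<le> 0" "r i t \<in> V"
            using r_bound[OF V(1), of i] True rV elim by auto
          then show ?thesis
            using N_diff_le[OF V(1), of "r i t"] N_nonneg[OF V_closed(3)[OF V(1)], of "r i t"] True by simp
        qed
        then show ?thesis by simp
      next
        case False
        then have pos: "0 < N (z t)" using N_nonneg[OF V(1)] by simp
        \<comment> \<open>Once \<open>s i t\<close> is closer to \<open>z t\<close> than
          \<open>N (z t)\<close>, its norm is below twice \<open>N (z t)\<close> and the truncation
          is inactive.\<close>
        have "\<forall>\<^sub>F i in sequentially. N (z t - s i t) < N (z t)"
          using elim pos by (intro order_tendstoD(2)) auto
        then have "\<forall>\<^sub>F i in sequentially. N (z t - s i t) = N (z t - r i t)"
        proof eventually_elim
          case (elim i)
          then have "N (s i t) \<le> 2 * N (z t)"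
            using N_reverse_triangle[OF V(1) V(2)[of i]] by simp
          then show ?case
            using \<open>t \<in> space M\<close> by (simp add: r_def E_def)
        qed
        then show ?thesis
          using elim by (auto intro: Lim_transform_eventually)
      qed
      from tendsto_power[OF this, of 2] show ?case by simp
    qed
    from sp AE_in_V[OF bm] show "AE t in M. norm ((N (z t - r i t))\<^sup>2) \<le> 10 * (N (z t))\<^sup>2" for i
    proof eventually_elim
      case (elim t)
      then have "(N (r i t))\<^sup>2 \<le> (2 * N (z t))\<^sup>2"
        using r_bound rV N_nonneg by (intro power_mono) auto
      then show ?case
        using N_diff_sq_le[of "z t" "r i t"] elim rV by (simp add: power_mult_distrib)
    qed
  qed simp
  then show ?thesis
    using r_sf rV rL by (intro exI[of _ r]) auto
qed

subsection \<open>Bochner integrals and weak time derivatives\<close>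

text \<open>The integral of a simple function is a finite sum over its values, so it stays in the
  subspace V and pairing with c passes through it by linearity alone.\<close>

lemma ip_simple_bochner_integral:
  assumes s: "sbi s" "s ` space M \<subseteq> V" and c: "c \<in> V"
  shows "has_bochner_integral M (\<lambda>t. ip (s t) c) (ip (simple_int s) c)"
    and "simple_int s \<in> V"
proof -
  have fin: "finite (s ` space M)"
    using s(1) by (auto simp: simple_function_def elim!: Bochner_Integration.simple_bochner_integrable.cases)
  have sum: "simple_int s \<in> V \<and>
      ip (simple_int s) c = (\<Sum>y\<in>s ` space M. ip (measure M {x\<in>space M. s x = y} *\<^sub>R y) c)"
    unfolding Bochner_Integration.simple_bochner_integral_def
    using fin s(2) c V_closed by (intro ip_sum_left) auto
  then show "simple_int s \<in> V" by simp
  have "Bochner_Integration.simple_bochner_integrable M (\<lambda>t. ip (s t) c)"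
    using simple_bochner_integrable_compose2[of "\<lambda>x y. ip x c", OF _ s(1) s(1)] ip_0_left[OF c] by simp
  then have "has_bochner_integral M (\<lambda>t. ip (s t) c) (Bochner_Integration.simple_bochner_integral M (\<lambda>t. ip (s t) c))"
    by (rule has_bochner_integral_simple_bochner_integrable)
  also have "Bochner_Integration.simple_bochner_integral M (\<lambda>t. ip (s t) c)
      = (\<Sum>y\<in>s ` space M. measure M {x\<in>space M. s x = y} *\<^sub>R ip y c)"
    by (rule simple_bochner_integral_partition[OF \<open>Bochner_Integration.simple_bochner_integrable M (\<lambda>t. ip (s t) c)\<close>])
       (use s(1) in \<open>auto elim: Bochner_Integration.simple_bochner_integrable.cases\<close>)
  also have "\<dots> = ip (simple_int s) c"
    using sum s(2) c by (auto simp: ip_scale_left intro!: sum.cong)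
  finally show "has_bochner_integral M (\<lambda>t. ip (s t) c) (ip (simple_int s) c)" .
qed

lemma nn_integral_ip_le:
  assumes u: "meas u" and c: "c \<in> V"
  shows "(\<integral>\<^sup>+t. norm (ip (u t) c) \<partial>M) \<le> (\<integral>\<^sup>+t. N (u t) \<partial>M) * ennreal (N c)"
proof -
  have "(\<integral>\<^sup>+t. norm (ip (u t) c) \<partial>M) \<le> (\<integral>\<^sup>+t. ennreal (N (u t)) * ennreal (N c) \<partial>M)"
  proof (rule nn_integral_mono_AE)
    show "AE t in M. ennreal (norm (ip (u t) c)) \<le> ennreal (N (u t)) * ennreal (N c)"
      using AE_in_V[OF u]
    proof eventually_elim
      case (elim t)
      then show ?case
        using Cauchy_Schwarz[OF elim c] N_nonneg[OF elim] N_nonneg[OF c] by (auto simp: ennreal_mult[symmetric])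
    qed
  qed
  also have "\<dots> = (\<integral>\<^sup>+t. N (u t) \<partial>M) * ennreal (N c)"
    using borel_measurable_N[OF u] by (intro nn_integral_multc) auto
  finally show ?thesis .
qed

text \<open>By Cauchy-Schwarz pairing with c is continuous for the seminorm, so L1 approximation by
  simple functions passes to the paired scalar functions. Vector-valued integral identities thereby
  become scalar ones.\<close>

lemma has_bochner_integral_in_ip:
  assumes "has_bochner_integral_in M V N u w" and c: "c \<in> V"
  shows "has_bochner_integral M (\<lambda>t. ip (u t) c) (ip w c)"
proof -
  have bm: "meas u" and w: "w \<in> V"
    using assms(1) by (auto simp: has_bochner_integral_in_def)
  obtain s where s: "\<And>i. sbi (s i)" "\<And>i. s i ` space M \<subseteq> V"
    and lim: "(\<lambda>i. \<integral>\<^sup>+t. ennreal (N (u t - s i t)) \<partial>M) \<longlonglongrightarrow> 0"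
    and lim': "(\<lambda>i. N (simple_int (s i) - w)) \<longlonglongrightarrow> 0"
    using assms(1) unfolding has_bochner_integral_in_def by blast
  have sb: "meas (s i)" for i
    using s[of i] by (intro simple_function_bochner_measurable) (auto elim: Bochner_Integration.simple_bochner_integrable.cases)
  have diff: "(\<integral>\<^sup>+t. norm (ip (u t) c - ip (s i t) c) \<partial>M) \<le> (\<integral>\<^sup>+t. N (u t - s i t) \<partial>M) * ennreal (N c)" for i
  proof -
    have "(\<integral>\<^sup>+t. norm (ip (u t) c - ip (s i t) c) \<partial>M) = (\<integral>\<^sup>+t. norm (ip (u t - s i t) c) \<partial>M)"
    proof (rule nn_integral_cong_AE)
      show "AE t in M. ennreal (norm (ip (u t) c - ip (s i t) c)) = ennreal (norm (ip (u t - s i t) c))"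
        using AE_in_V[OF bm] AE_in_V[OF sb[of i]] by eventually_elim (simp add: ip_diff_left c)
    qed
    then show ?thesis
      using nn_integral_ip_le[OF bochner_measurable_diff[OF bm sb[of i]] c] by simp
  qed
  have L1: "(\<lambda>i. \<integral>\<^sup>+t. norm (ip (u t) c - ip (s i t) c) \<partial>M) \<longlonglongrightarrow> 0"
  proof (rule tendsto_sandwich[OF _ _ tendsto_const])
    show "(\<lambda>i. (\<integral>\<^sup>+t. N (u t - s i t) \<partial>M) * ennreal (N c)) \<longlonglongrightarrow> 0"
      using tendsto_mult_ennreal[OF lim tendsto_const, of "ennreal (N c)"] by simp
  qed (use diff in auto)
  have lim'': "(\<lambda>i. ip (simple_int (s i)) c) \<longlonglongrightarrow> ip w c"
  proof -
    have "(\<lambda>i. N (w - simple_int (s i))) \<longlonglongrightarrow> 0"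
      using lim' N_minus_commute[OF w ip_simple_bochner_integral(2)[OF s c]] by simp
    from ip_tendsto[OF this w ip_simple_bochner_integral(2)[OF s c] c] show ?thesis
      using ip_sym[OF c] w ip_simple_bochner_integral(2)[OF s c] by simp
  qed
  have si: "integrable M (\<lambda>t. ip (s i t) c)" "(\<integral>t. ip (s i t) c \<partial>M) = ip (simple_int (s i)) c" for i
    using ip_simple_bochner_integral(1)[OF s c, of i] by (auto simp: has_bochner_integral_iff)
  have int: "integrable M (\<lambda>t. ip (u t) c)"
  proof -
    have "\<forall>\<^sub>F i in sequentially. (\<integral>\<^sup>+t. norm (ip (u t) c - ip (s i t) c) \<partial>M) < 1"
      using L1 by (rule order_tendstoD) simp
    then obtain i where i: "(\<integral>\<^sup>+t. norm (ip (u t) c - ip (s i t) c) \<partial>M) < 1"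
      by (auto simp: eventually_sequentially)
    have "(\<integral>\<^sup>+t. norm (ip (u t) c - ip (s i t) c) \<partial>M) < \<infinity>"
      using i by (rule less_trans) simp
    then have "integrable M (\<lambda>t. ip (u t) c - ip (s i t) c)"
      using borel_measurable_ip_const[OF bm c] borel_measurable_ip_const[OF sb[of i] c]
      by (intro integrableI_bounded) auto
    from Bochner_Integration.integrable_add[OF this si(1)[of i]] show ?thesis by simp
  qed
  have "(\<lambda>i. \<integral>t. ip (s i t) c \<partial>M) \<longlonglongrightarrow> (\<integral>t. ip (u t) c \<partial>M)"
    using L1 by (intro tendsto_L1_int si int) (simp add: abs_minus_commute)
  then have "(\<integral>t. ip (u t) c \<partial>M) = ip w c"
    using lim'' LIMSEQ_unique by (simp add: si(2))
  then show ?thesis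
    using int by (simp add: has_bochner_integral_iff)
qed

lemma has_bochner_integral_in_diff:
  assumes "has_bochner_integral_in M V N u w" "has_bochner_integral_in M V N u' w'"
  shows "has_bochner_integral_in M V N (\<lambda>t. u t - u' t) (w - w')"
proof -
  let ?I = simple_int
  have bm: "meas u" "meas u'" and w: "w \<in> V" "w' \<in> V"
    using assms by (auto simp: has_bochner_integral_in_def)
  obtain s where s: "\<And>i. sbi (s i)" "\<And>i. s i ` space M \<subseteq> V"
    and s_lim: "(\<lambda>i. \<integral>\<^sup>+t. ennreal (N (u t - s i t)) \<partial>M) \<longlonglongrightarrow> 0" "(\<lambda>i. N (?I (s i) - w)) \<longlonglongrightarrow> 0"
    using assms(1) unfolding has_bochner_integral_in_def by blast
  obtain r where r: "\<And>i. sbi (r i)" "\<And>i. r i ` space M \<subseteq> V"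
    and r_lim: "(\<lambda>i. \<integral>\<^sup>+t. ennreal (N (u' t - r i t)) \<partial>M) \<longlonglongrightarrow> 0" "(\<lambda>i. N (?I (r i) - w')) \<longlonglongrightarrow> 0"
    using assms(2) unfolding has_bochner_integral_in_def by blast
  have sb: "meas (s i)" "meas (r i)" for i
    using s[of i] r[of i] by (auto intro!: simple_function_bochner_measurable elim: Bochner_Integration.simple_bochner_integrable.cases)
  have sr: "sbi (\<lambda>t. s i t - r i t)" "(\<lambda>t. s i t - r i t) ` space M \<subseteq> V" for i
    using simple_bochner_integrable_compose2[of "\<lambda>x y. x - y", OF _ s(1) r(1)] s(2)[of i] r(2)[of i] V_closed(3)
    by (auto simp: image_subset_iff)
  have bound: "(\<integral>\<^sup>+t. ennreal (N ((u t - u' t) - (s i t - r i t))) \<partial>M)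
      \<le> (\<integral>\<^sup>+t. ennreal (N (u t - s i t)) \<partial>M) + (\<integral>\<^sup>+t. ennreal (N (u' t - r i t)) \<partial>M)" for i
  proof -
    have "(\<integral>\<^sup>+t. ennreal (N ((u t - u' t) - (s i t - r i t))) \<partial>M)
      \<le> (\<integral>\<^sup>+t. ennreal (N (u t - s i t)) + ennreal (N (u' t - r i t)) \<partial>M)"
    proof (rule nn_integral_mono_AE)
      show "AE t in M. ennreal (N ((u t - u' t) - (s i t - r i t))) \<le> ennreal (N (u t - s i t)) + ennreal (N (u' t - r i t))"
        using AE_in_V[OF bm(1)] AE_in_V[OF bm(2)] AE_in_V[OF sb(1)[of i]] AE_in_V[OF sb(2)[of i]]
      proof eventually_elim
        case (elim t)
        have eq: "(u t - u' t) - (s i t - r i t) = (u t - s i t) - (u' t - r i t)" by simp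
        show ?case
          unfolding eq
          using N_diff_le[of "u t - s i t" "u' t - r i t"] elim V_closed N_nonneg
          by (simp add: ennreal_plus[symmetric] del: ennreal_plus)
      qed
    qed
    also have "\<dots> = (\<integral>\<^sup>+t. ennreal (N (u t - s i t)) \<partial>M) + (\<integral>\<^sup>+t. ennreal (N (u' t - r i t)) \<partial>M)"
      using borel_measurable_N[OF bochner_measurable_diff[OF bm(1) sb(1)[of i]]]
        borel_measurable_N[OF bochner_measurable_diff[OF bm(2) sb(2)[of i]]]
      by (intro nn_integral_add) auto
    finally show ?thesis .
  qed
  have l1: "(\<lambda>i. \<integral>\<^sup>+t. ennreal (N ((u t - u' t) - (s i t - r i t))) \<partial>M) \<longlonglongrightarrow> 0"
  proof (rule tendsto_sandwich[OF _ _ tendsto_const])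
    show "(\<lambda>i. (\<integral>\<^sup>+t. ennreal (N (u t - s i t)) \<partial>M) + (\<integral>\<^sup>+t. ennreal (N (u' t - r i t)) \<partial>M)) \<longlonglongrightarrow> 0"
      using tendsto_add[OF s_lim(1) r_lim(1)] by simp
  qed (use bound in auto)
  have IV: "?I (s i) \<in> V" "?I (r i) \<in> V" for i
    using ip_simple_bochner_integral(2)[OF s V_closed(1)] ip_simple_bochner_integral(2)[OF r V_closed(1)] by auto
  have eq: "?I (\<lambda>t. s i t - r i t) - (w - w') = (?I (s i) - w) - (?I (r i) - w')" for i
    by (simp add: simple_bochner_integral_diff[OF s(1) r(1)])
  have "(\<lambda>i. N (?I (s i) - w) + N (?I (r i) - w')) \<longlonglongrightarrow> 0"
    using tendsto_add[OF s_lim(2) r_lim(2)] by simp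
  then have "(\<lambda>i. N ((?I (s i) - w) - (?I (r i) - w'))) \<longlonglongrightarrow> 0"
  proof (rule Lim_null_comparison[OF always_eventually, rotated], intro allI)
    show "norm (N ((?I (s i) - w) - (?I (r i) - w'))) \<le> N (?I (s i) - w) + N (?I (r i) - w')" for i
      using N_diff_le[of "?I (s i) - w" "?I (r i) - w'"] N_nonneg[of "(?I (s i) - w) - (?I (r i) - w')"]
        IV[of i] w V_closed(3) by simp
  qed
  then have l2: "(\<lambda>i. N (?I (\<lambda>t. s i t - r i t) - (w - w'))) \<longlonglongrightarrow> 0"
    by (simp only: eq)
  show ?thesis
    unfolding has_bochner_integral_in_def
    using bochner_measurable_diff[OF bm] w V_closed(3) sr l1 l2
    by (intro conjI exI[of _ "\<lambda>i t. s i t - r i t"]) auto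
qed

lemma has_weak_time_deriv_diff:
  assumes "weak_dt u p" "weak_dt u' p'"
  shows "weak_dt (\<lambda>t. u t - u' t) (\<lambda>t. p t - p' t)"
  unfolding has_weak_time_deriv_def
proof (intro allI impI)
  fix \<phi> assume \<phi>: "test_function (interior {0..T}) \<phi>"
  obtain w where w: "has_bochner_integral_in M V N (\<lambda>t. deriv \<phi> t *\<^sub>R u t) w"
      "has_bochner_integral_in M V N (\<lambda>t. \<phi> t *\<^sub>R p t) (- w)"
    using assms(1) \<phi> unfolding has_weak_time_deriv_def by blast
  obtain w' where w': "has_bochner_integral_in M V N (\<lambda>t. deriv \<phi> t *\<^sub>R u' t) w'"
      "has_bochner_integral_in M V N (\<lambda>t. \<phi> t *\<^sub>R p' t) (- w')"
    using assms(2) \<phi> unfolding has_weak_time_deriv_def by blast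
  show "\<exists>w. has_bochner_integral_in M V N (\<lambda>t. deriv \<phi> t *\<^sub>R (u t - u' t)) w \<and>
      has_bochner_integral_in M V N (\<lambda>t. \<phi> t *\<^sub>R (p t - p' t)) (- w)"
    using has_bochner_integral_in_diff[OF w(1) w'(1)] has_bochner_integral_in_diff[OF w(2) w'(2)]
    by (intro exI[of _ "w - w'"]) (simp add: scaleR_diff_right)
qed

text \<open>Homogeneity of \<open>ip\<close> holds on V, and the values lie in V only almost
  everywhere; the scalar factor is therefore pulled out of the pairing up to a null set.\<close>

lemma weak_time_deriv_ip:
  assumes weak: "weak_dt u p" and \<phi>: "test_function {0<..<T} \<phi>" and c: "c \<in> V"
    and bm: "meas u" "meas p"
  shows "(\<integral>t. deriv \<phi> t * ip (u t) c \<partial>M) = - (\<integral>t. \<phi> t * ip (p t) c \<partial>M)"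
proof -
  obtain w where w: "has_bochner_integral_in M V N (\<lambda>t. deriv \<phi> t *\<^sub>R u t) w"
      "has_bochner_integral_in M V N (\<lambda>t. \<phi> t *\<^sub>R p t) (- w)"
    using weak \<phi> unfolding has_weak_time_deriv_def by (auto simp: interior_atLeastAtMost_real)
  have wV: "w \<in> V"
    using w(1) by (simp add: has_bochner_integral_in_def)
  have 1: "has_bochner_integral M (\<lambda>t. ip (deriv \<phi> t *\<^sub>R u t) c) (ip w c)"
    "has_bochner_integral M (\<lambda>t. ip (\<phi> t *\<^sub>R p t) c) (- ip w c)"
    using has_bochner_integral_in_ip[OF w(1) c] has_bochner_integral_in_ip[OF w(2) c] ip_minus_left[OF wV c] by auto
  have ae: "AE t in M. ip (a t *\<^sub>R v t) c = a t * ip (v t) c" if "meas v" for a v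
    using AE_in_V[OF that] by eventually_elim (simp add: ip_scale_left c)
  have eq: "(\<integral>t. a t * ip (v t) c \<partial>M) = x" if "meas v" "has_bochner_integral M (\<lambda>t. ip (a t *\<^sub>R v t) c) x" for a v x
  proof -
    have m: "(\<lambda>t. ip (a t *\<^sub>R v t) c) \<in> borel_measurable M"
      using that(2) by (auto simp: has_bochner_integral_iff)
    have "(\<integral>t. a t * ip (v t) c \<partial>M) = (\<integral>t. ip (a t *\<^sub>R v t) c \<partial>M)"
      using ae[OF that(1), of a]
      by (intro integral_cong_AE m borel_measurable_lebesgue_on_AE[OF m ae[OF that(1), of a]])
         (auto simp: lebesgue_setsI elim: eventually_mono)
    then show ?thesis using that(2) by (simp add: has_bochner_integral_iff)
  qed
  show ?thesis
    using eq[OF bm(1) 1(1)] eq[OF bm(2) 1(2)] by simp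
qed

lemma L2V_ip_integrable: "p \<in> L2V \<Longrightarrow> c \<in> V \<Longrightarrow> integrable M (\<lambda>t. ip (p t) c)"
  using integrable_ip[OF _ const_L2V] by simp

text \<open>
  The exceptional null set of the scalar statement depends on the test vector; the countably many
  values of an approximating sequence of simple functions suffice as test vectors.
\<close>

lemma weak_time_deriv_unique:
  assumes u: "meas u"
    and p: "p \<in> L2V" "weak_dt u p" and p': "p' \<in> L2V" "weak_dt u p'"
  shows "AE t in M. p t - p' t \<in> V \<and> N (p t - p' t) = 0"
proof -
  define r where "r t = p t - p' t" for t
  have r: "r \<in> L2V"
    unfolding r_def[abs_def] by (rule L2V_diff[OF p(1) p'(1)])
  have bm: "meas r" "meas p" "meas p'"
    using r p p' by (auto simp: L2_time_def)
  have scalar: "AE t in M. ip (r t) c = 0" if c: "c \<in> V" for c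
  \<comment> \<open>Test functions live on the open interval, so the fundamental lemma is applied
    there and the two endpoints are added as a null set.\<close>
  proof (rule AE_lebesgue_on_open_Icc, rule AE_zero_if_test_integrals_zero)
    have i: "integrable M (\<lambda>t. ip (r t) c)"
      by (rule L2V_ip_integrable[OF r c])
    show "(\<lambda>t. ip (r t) c) \<in> borel_measurable (lebesgue_on {0<..<T})"
      using integrable_lebesgue_on_subset[OF i, of "{0<..<T}"]
      by (intro borel_measurable_integrable) (auto simp: lebesgue_setsI greaterThanLessThan_subseteq_atLeastAtMost_iff)
    show "integrable (lebesgue_on (cbox a d)) (\<lambda>t. ip (r t) c)" if "cbox a d \<subseteq> {0<..<T}" for a d
      using that by (intro integrable_lebesgue_on_subset[OF i]) (auto simp: lebesgue_setsI)
    fix \<phi> assume \<phi>: "test_function {0<..<T} \<phi>"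
    obtain B where B: "\<And>x. \<bar>\<phi> x\<bar> \<le> B"
      using test_function_bounded[OF \<phi>] by metis
    have ip\<phi>: "integrable M (\<lambda>t. \<phi> t * ip (q t) c)" if "q \<in> L2V" for q
    proof (rule Bochner_Integration.integrable_bound)
      show "integrable M (\<lambda>t. B * ip (q t) c)"
        using L2V_ip_integrable[OF that c] by simp
      show "(\<lambda>t. \<phi> t * ip (q t) c) \<in> borel_measurable M"
        using test_function_measurable(2)[OF \<phi>] L2V_ip_integrable[OF that c] by measurable
      have "\<bar>\<phi> t\<bar> \<le> \<bar>B\<bar>" for t using B[of t] by linarith
      then show "AE t in M. norm (\<phi> t * ip (q t) c) \<le> norm (B * ip (q t) c)"
        by (auto simp: abs_mult intro!: mult_right_mono)
    qed
    have "(\<integral>t. \<phi> t * ip (p t) c \<partial>M) = (\<integral>t. \<phi> t * ip (p' t) c \<partial>M)"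
      using weak_time_deriv_ip[OF p(2) \<phi> c u bm(2)] weak_time_deriv_ip[OF p'(2) \<phi> c u bm(3)] by simp
    then have "(\<integral>t. \<phi> t * ip (p t) c - \<phi> t * ip (p' t) c \<partial>M) = 0"
      using ip\<phi>[OF p(1)] ip\<phi>[OF p'(1)] by simp
    also have "(\<integral>t. \<phi> t * ip (p t) c - \<phi> t * ip (p' t) c \<partial>M) = (\<integral>t. \<phi> t * ip (r t) c \<partial>M)"
    proof (rule integral_cong_AE)
      show "AE t in M. \<phi> t * ip (p t) c - \<phi> t * ip (p' t) c = \<phi> t * ip (r t) c"
        using AE_in_V[OF bm(2)] AE_in_V[OF bm(3)]
        by eventually_elim (simp add: r_def ip_diff_left c right_diff_distrib)
    qed (use ip\<phi>[OF p(1)] ip\<phi>[OF p'(1)] ip\<phi>[OF r] in auto)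
    also have "(\<lambda>t. \<phi> t * ip (r t) c) = (\<lambda>t. if t \<in> {0<..<T} then ip (r t) c * \<phi> t else 0)"
      using test_function_zero_outside[OF \<phi>] by (auto simp: fun_eq_iff)
    also have "(\<integral>t. (if t \<in> {0<..<T} then ip (r t) c * \<phi> t else 0) \<partial>M) = (\<integral>t. ip (r t) c * \<phi> t \<partial>lebesgue_on {0<..<T})"
      by (intro integral_restrict) (auto simp: lebesgue_setsI)
    finally show "(\<integral>t. ip (r t) c * \<phi> t \<partial>lebesgue_on {0<..<T}) = 0" .
  qed simp
  obtain s where s: "\<And>i. simple_function M (s i)" "\<And>i t. t \<in> {0..T} \<Longrightarrow> s i t \<in> V"
    and ae: "AE t in M. r t \<in> V \<and> (\<lambda>i. N (r t - s i t)) \<longlonglongrightarrow> 0"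
    using bochner_measurableE[OF bm(1)] by blast
  have "AE t in M. \<forall>i. \<forall>c\<in>s i ` {0..T}. ip (r t) c = 0"
    unfolding AE_all_countable
  proof
    fix i
    have "finite (s i ` {0..T})"
      using s(1)[of i] by (simp add: simple_function_def)
    then show "AE t in M. \<forall>c\<in>s i ` {0..T}. ip (r t) c = 0"
      using scalar s(2) by (intro AE_finite_allI) auto
  qed
  moreover have "AE t in M. t \<in> space M" by (rule AE_space)
  ultimately have "AE t in M. r t \<in> V \<and> N (r t) = 0"
    using ae
  proof eventually_elim
    case (elim t)
    then have "(\<lambda>i. ip (r t) (s i t)) \<longlonglongrightarrow> ip (r t) (r t)"
      using s(2) by (intro ip_tendsto) auto
    moreover have "ip (r t) (s i t) = 0" for i
      using elim by auto
    ultimately have "ip (r t) (r t) = 0"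
      by (simp add: LIMSEQ_const_iff)
    then show ?case
      using elim by (simp add: N_def)
  qed
  then show ?thesis by (simp add: r_def)
qed

text \<open>For fixed c the real function \<open>ip (w t) c\<close> is continuous with weak
  derivative \<open>ip (p t) c\<close>. Continuity is what makes the formula valid at every time
  rather than at almost every time.\<close>

lemma continuous_representative_primitive:
  assumes weak: "weak_dt u p" and p: "p \<in> L2V" and u: "meas u"
    and w: "cont_rep u w" and c: "c \<in> V" and t: "t \<in> {0..T}"
  shows "ip (w t) c = ip (w 0) c + primitive (\<lambda>s. ip (p s) c) t"
proof (rule weak_derivative_imp_primitive[OF _ L2V_ip_integrable[OF p c] T_pos _ t])
  have wV: "w t \<in> V" if "t \<in> {0..T}" for t
    using w that by (auto simp: continuous_representative_def)
  have bp: "meas p"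
    using p by (simp add: L2_time_def)
  show cont: "continuous_on {0..T} (\<lambda>t. ip (w t) c)"
    unfolding continuous_on
  proof
    fix t assume t: "t \<in> {0..T}"
    have "((\<lambda>s. ip (w s) c - ip (w t) c) \<longlongrightarrow> 0) (at t within {0..T})"
    proof (rule Lim_null_comparison)
      have "\<forall>\<^sub>F s in at t within {0..T}. s \<in> {0..T}"
        by (simp add: eventually_at_filter)
      then show "\<forall>\<^sub>F s in at t within {0..T}. norm (ip (w s) c - ip (w t) c) \<le> N (w s - w t) * N c"
        by eventually_elim (use wV t c Cauchy_Schwarz V_closed(3) ip_diff_left in \<open>metis real_norm_def\<close>)
      show "((\<lambda>s. N (w s - w t) * N c) \<longlongrightarrow> 0) (at t within {0..T})"
        using w t by (intro tendsto_mult_left_zero) (auto simp: continuous_representative_def)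
    qed
    then show "((\<lambda>s. ip (w s) c) \<longlongrightarrow> ip (w t) c) (at t within {0..T})"
      by (simp add: LIM_zero_iff)
  qed
  fix \<phi> assume \<phi>: "test_function {0<..<T} \<phi>"
  have d\<phi>: "deriv \<phi> \<in> borel_measurable M"
  proof -
    have "test_function {0<..<T} (\<lambda>t. frechet_derivative \<phi> (at t) 1)"
      using test_function_partial[OF \<phi>, of 1] by simp
    moreover have "\<phi> differentiable (at t)" for t
      using test_function_has_derivative[OF \<phi>] by (auto simp: differentiable_def)
    ultimately have "test_function {0<..<T} (deriv \<phi>)"
      by (simp add: frechet_derivative_real)
    then show ?thesis
      by (rule test_function_measurable(2))
  qed
  have "(\<integral>t. deriv \<phi> t * ip (w t) c \<partial>M) = (\<integral>t. deriv \<phi> t * ip (u t) c \<partial>M)"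
  proof (rule integral_cong_AE)
    have "(\<lambda>t. ip (w t) c) \<in> borel_measurable M"
      using cont by (intro continuous_imp_measurable_on_sets_lebesgue) (auto simp: lebesgue_setsI)
    then show "(\<lambda>t. deriv \<phi> t * ip (w t) c) \<in> borel_measurable M"
      using d\<phi> by measurable
    show "(\<lambda>t. deriv \<phi> t * ip (u t) c) \<in> borel_measurable M"
      using d\<phi> borel_measurable_ip_const[OF u c] by measurable
    have "AE t in M. u t \<in> V \<and> N (u t - w t) = 0"
      using w by (simp add: continuous_representative_def)
    moreover have "AE t in M. t \<in> space M" by (rule AE_space)
    ultimately show "AE t in M. deriv \<phi> t * ip (w t) c = deriv \<phi> t * ip (u t) c"
    proof eventually_elim
      case (elim t)
      then have "ip (u t - w t) c = 0"
        using wV V_closed(3) c by (intro ip_eq_0) auto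
      then show ?case
        using elim wV c by (simp add: ip_diff_left)
    qed
  qed
  then show "(\<integral>t. deriv \<phi> t * ip (w t) c \<partial>M) = - (\<integral>t. \<phi> t * ip (p t) c \<partial>M)"
    using weak_time_deriv_ip[OF weak \<phi> c u bp] by simp
qed

end

section \<open>The energy inequality\<close>

context semi_inner_time
begin

abbreviation prim :: "(real \<Rightarrow> 'a) \<Rightarrow> 'a \<Rightarrow> real \<Rightarrow> real" where
  "prim p c \<equiv> primitive (\<lambda>s. ip (p s) c)"

abbreviation prim2 :: "(real \<Rightarrow> 'a) \<Rightarrow> real \<Rightarrow> real" where
  "prim2 p \<equiv> primitive (\<lambda>s. (N (p s))\<^sup>2)"

text \<open>A vanishing initial value makes the extension of w by zero consistent with the extension
  of primitives by zero, so one formula covers t < h as well.\<close>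

lemma continuous_representative_increment:
  assumes weak: "weak_dt u p" and p: "p \<in> L2V" and u: "meas u"
    and w: "cont_rep u w" and w0: "N (w 0) = 0"
    and h: "0 \<le> h" and t: "t \<in> {0..T}" and c: "c \<in> V"
  shows "ip (w t - (if t < h then 0 else w (t - h))) c
    = prim p c t - prim p c (t - h)"
proof -
  have wV: "w t \<in> V" if "t \<in> {0..T}" for t
    using w that by (auto simp: continuous_representative_def)
  have "ip (w 0) c = 0"
    using wV[of 0] T_pos c w0 by (intro ip_eq_0) auto
  then have *: "ip (w t) c = prim p c t" if "t \<in> {0..T}" for t
    using continuous_representative_primitive[OF weak p u w c that] by simp
  show ?thesis
  proof (cases "t < h")
    case True
    then show ?thesis using *[OF t] by simp
  next
    case False
    then have "t - h \<in> {0..T}" using t h by auto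
    then show ?thesis
      using False *[OF t] *[of "t - h"] wV[OF t] wV[of "t - h"] c by (simp add: ip_diff_left)
  qed
qed

text \<open>Formally y is the integral of p over [t-h, t] and this is Cauchy-Schwarz in time. To
  stay with scalar integrals, y is paired with itself, and Young's inequality with weight h lets
  half of the squared norm be absorbed on the left.\<close>

lemma N_increment_le:
  assumes p: "p \<in> L2V" and h: "0 < h" and t: "t \<in> {0..T}" and y: "y \<in> V"
    and inc: "ip y y = prim p y t - prim p y (t - h)"
  shows "(N y)\<^sup>2 \<le> h * (prim2 p t - prim2 p (t - h))"
proof -
  \<comment> \<open>The primitives vanish at negative times, so starting the interval at 0 instead
    leaves their increments unchanged and keeps the integrals inside [0, T].\<close>
  define a where "a = max 0 (t - h)"
  have a: "0 \<le> a" "a \<le> t" "t \<le> T" "t - a \<le> h"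
    using h t by (auto simp: a_def)
  have pa: "primitive q (t - h) = primitive q a" for q
    by (auto simp: a_def max_def)
  have bp: "meas p" and int_p: "integrable M (\<lambda>s. (N (p s))\<^sup>2)"
    using p by (auto simp: L2_time_def)
  have sub: "{a..t} \<subseteq> {0..T}" using a by auto
  have i1: "integrable (lebesgue_on {a..t}) (\<lambda>s. ip (p s) y)"
    by (rule integrable_subinterval[OF L2V_ip_integrable[OF p y] sub])
  have i2: "integrable (lebesgue_on {a..t}) (\<lambda>s. (N (p s))\<^sup>2)"
    by (rule integrable_subinterval[OF int_p sub])
  have "(N y)\<^sup>2 = (\<integral>s. ip (p s) y \<partial>lebesgue_on {a..t})"
    using inc y a primitive_diff[OF L2V_ip_integrable[OF p y], of a t] by (simp add: pa N_sq)
  also have "\<dots> \<le> (\<integral>s. h / 2 * (N (p s))\<^sup>2 + (N y)\<^sup>2 / (2 * h) \<partial>lebesgue_on {a..t})"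
  proof (rule integral_mono_AE[OF i1])
    show "integrable (lebesgue_on {a..t}) (\<lambda>s. h / 2 * (N (p s))\<^sup>2 + (N y)\<^sup>2 / (2 * h))"
      using i2 by simp
    have "AE s in lebesgue. s \<in> {0..T} \<longrightarrow> p s \<in> V"
      using AE_in_V[OF bp] by (simp add: AE_restrict_space_iff lebesgue_setsI)
    then have "AE s in lebesgue. s \<in> {a..t} \<longrightarrow> ip (p s) y \<le> h / 2 * (N (p s))\<^sup>2 + (N y)\<^sup>2 / (2 * h)"
    proof (rule eventually_mono, intro impI)
      fix s assume "s \<in> {0..T} \<longrightarrow> p s \<in> V" "s \<in> {a..t}"
      then have "p s \<in> V" using sub by auto
      from Young[OF this y h] show "ip (p s) y \<le> h / 2 * (N (p s))\<^sup>2 + (N y)\<^sup>2 / (2 * h)" by simp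
    qed
    then show "AE s in lebesgue_on {a..t}. ip (p s) y \<le> h / 2 * (N (p s))\<^sup>2 + (N y)\<^sup>2 / (2 * h)"
      by (simp add: AE_restrict_space_iff lebesgue_setsI)
  qed
  also have "\<dots> = h / 2 * (\<integral>s. (N (p s))\<^sup>2 \<partial>lebesgue_on {a..t}) + (t - a) * ((N y)\<^sup>2 / (2 * h))"
    using i2 a by (simp add: measure_restrict_space lebesgue_setsI)
  also have "\<dots> \<le> h / 2 * (\<integral>s. (N (p s))\<^sup>2 \<partial>lebesgue_on {a..t}) + h * ((N y)\<^sup>2 / (2 * h))"
    using a h by (intro add_left_mono mult_right_mono) auto
  also have "h * ((N y)\<^sup>2 / (2 * h)) = (N y)\<^sup>2 / 2"
    using h by simp
  finally have "(N y)\<^sup>2 \<le> h * (\<integral>s. (N (p s))\<^sup>2 \<partial>lebesgue_on {a..t})"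
    by simp
  then show ?thesis
    using primitive_diff[OF int_p, of a t] a by (simp add: pa)
qed

lemma integral_ip_simple:
  assumes s: "simple_function M s" "\<And>t. t \<in> {0..T} \<Longrightarrow> s t \<in> V"
    and int: "\<And>c. c \<in> V \<Longrightarrow> integrable M (\<lambda>t. ip (y t) c)"
  shows "(\<integral>t. ip (y t) (s t) \<partial>M) = (\<Sum>c\<in>s ` {0..T}. \<integral>t. indicator (s -` {c} \<inter> {0..T}) t * ip (y t) c \<partial>M)"
proof -
  have "(\<integral>t. ip (y t) (s t) \<partial>M) = (\<integral>t. (\<Sum>c\<in>s ` {0..T}. indicator (s -` {c} \<inter> {0..T}) t * ip (y t) c) \<partial>M)"
    by (intro Bochner_Integration.integral_cong refl ip_simple_function_sum[OF s(1)]) simp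
  also have "\<dots> = (\<Sum>c\<in>s ` {0..T}. \<integral>t. indicator (s -` {c} \<inter> {0..T}) t * ip (y t) c \<partial>M)"
  proof (rule Bochner_Integration.integral_sum)
    fix c assume "c \<in> s ` {0..T}"
    then have "integrable M (\<lambda>t. ip (y t) c)" using int s(2) by auto
    then show "integrable M (\<lambda>t. indicator (s -` {c} \<inter> {0..T}) t * ip (y t) c)"
      using integrable_mult_indicator[of "s -` {c} \<inter> {0..T}" M "\<lambda>t. ip (y t) c"] simple_functionD(2)[OF s(1), of "{c}"]
      by simp
  qed
  finally show ?thesis .
qed

text \<open>
  With \<open>w\<close> extended by zero to negative times, the backward difference quotients
  \<open>(w t - w (t - h)) / h\<close> have nonpositive pairing with \<open>A (u t)\<close>, since the lower bound for the
  pairing telescopes.  They converge weakly in \<open>L2V\<close> to the weak time derivative.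
\<close>

lemma weak_time_deriv_dissipative:
  assumes weak: "weak_dt u p" and p: "p \<in> L2V" and u: "u \<in> L2V"
    and w: "cont_rep u w" and w0: "N (w 0) = 0"
    and D: "D \<subseteq> V" "AE t in M. u t \<in> D" and A: "\<And>x. x \<in> D \<Longrightarrow> A x \<in> V" and z: "(\<lambda>t. A (u t)) \<in> L2V"
    and diss: "\<And>x. x \<in> D \<Longrightarrow> ip x (A x) \<le> 0"
    and convex: "\<And>x y. x \<in> D \<Longrightarrow> y \<in> D \<Longrightarrow> ip (x - y) (A x) \<le> (ip x (A x) - ip y (A y)) / 2"
  shows "(\<integral>t. ip (p t) (A (u t)) \<partial>M) \<le> 0"
proof -
  define z where "z t = A (u t)" for t
  note z = z[folded z_def]
  have bm: "meas u" "meas p" "meas z"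
    using u p z by (auto simp: L2_time_def)
  have int_p: "integrable M (\<lambda>s. (N (p s))\<^sup>2)"
    using p by (auto simp: L2_time_def)
  have wV: "w t \<in> V" if "t \<in> {0..T}" for t
    using w that by (auto simp: continuous_representative_def)
  define y where "y h t = w t - (if t < h then 0 else w (t - h))" for h t
  have yV: "y h t \<in> V" if "t \<in> {0..T}" "0 \<le> h" for h t
    using that wV[of t] wV[of "t - h"] V_closed by (auto simp: y_def)
  have y_ip: "ip (y h t) c = prim p c t - prim p c (t - h)"
    if "0 \<le> h" "t \<in> {0..T}" "c \<in> V" for h t c
    unfolding y_def by (rule continuous_representative_increment[OF weak p bm(1) w w0 that])
  have int_y: "integrable M (\<lambda>t. ip (y h t) c)" if h: "0 \<le> h" and c: "c \<in> V" for h c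
  proof -
    have "integrable M (\<lambda>t. prim p c t - prim p c (t - h))"
      using integrable_primitive_shift[OF L2V_ip_integrable[OF p c], of 0]
        integrable_primitive_shift[OF L2V_ip_integrable[OF p c] h] by simp
    then show ?thesis
      by (rule Bochner_Integration.integrable_cong[THEN iffD1, rotated 2]) (simp_all add: y_ip h c)
  qed
  define P where "P = prim2 p"
  have P_int: "integrable M (\<lambda>t. P t - P (t - h))" "(\<integral>t. P t - P (t - h) \<partial>M) \<le> h * P T" if "0 \<le> h" "h \<le> T" for h
    using integrable_primitive_shift[OF int_p, of 0] integrable_primitive_shift[OF int_p, of h]
      integral_primitive_diff_le[OF int_p _ that] that by (simp_all add: P_def)
  have P_T: "(\<integral>t. (N (p t))\<^sup>2 \<partial>M) = P T"
    using T_pos by (simp add: P_def primitive_eq)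

  \<comment> \<open>A bound on difference quotients paired with r that is uniform in h; the free
    weight k trades the size of p against the size of r.\<close>
  have pairing: "integrable M (\<lambda>t. ip (y h t) (r t))"
      "\<bar>\<integral>t. ip (y h t) (r t) \<partial>M\<bar> / h \<le> k / 2 * P T + (\<integral>t. (N (r t))\<^sup>2 \<partial>M) / (2 * k)"
    if h: "0 < h" "h \<le> T" and r: "r \<in> L2V" and k: "0 < k" for h r k
  proof -
    have br: "meas r" and int_r: "integrable M (\<lambda>t. (N (r t))\<^sup>2)"
      using r by (auto simp: L2_time_def)
    have sp: "AE t in M. t \<in> space M" by (rule AE_space)
    have bound: "AE t in M. \<bar>ip (y h t) (r t)\<bar> \<le> k / 2 * (P t - P (t - h)) + h * (N (r t))\<^sup>2 / (2 * k)"
      using sp AE_in_V[OF br]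
    proof eventually_elim
      case (elim t)
      then have t: "t \<in> {0..T}" by simp
      have V: "y h t \<in> V" using yV[OF t] h by simp
      have "(N (y h t))\<^sup>2 \<le> h * (P t - P (t - h))"
        unfolding P_def by (rule N_increment_le[OF p h(1) t V y_ip]) (use h t V in auto)
      \<comment> \<open>The weight k / h cancels the factor h gained from the increment estimate, so
        that a factor h remains in both terms and can be divided out at the end.\<close>
      then have "(k / h) / 2 * (N (y h t))\<^sup>2 \<le> (k / h) / 2 * (h * (P t - P (t - h)))"
        using h k by (intro mult_left_mono) auto
      also have "\<dots> = k / 2 * (P t - P (t - h))"
        using h by simp
      finally have "(k / h) / 2 * (N (y h t))\<^sup>2 \<le> k / 2 * (P t - P (t - h))" .
      moreover have "(N (r t))\<^sup>2 / (2 * (k / h)) = h * (N (r t))\<^sup>2 / (2 * k)"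
        using h k by (simp add: field_simps)
      moreover have "\<bar>ip (y h t) (r t)\<bar> \<le> (k / h) / 2 * (N (y h t))\<^sup>2 + (N (r t))\<^sup>2 / (2 * (k / h))"
        using h k by (intro Young V elim(2)) auto
      ultimately show ?case by linarith
    qed
    have int_b: "integrable M (\<lambda>t. k / 2 * (P t - P (t - h)) + h * (N (r t))\<^sup>2 / (2 * k))"
      using P_int[of h] int_r h by simp
    show int: "integrable M (\<lambda>t. ip (y h t) (r t))"
    proof (rule Bochner_Integration.integrable_bound[OF int_b])
      show "(\<lambda>t. ip (y h t) (r t)) \<in> borel_measurable M"
        using yV h int_y by (intro borel_measurable_ip[OF _ _ br]) (auto intro!: AE_I2)
      show "AE t in M. norm (ip (y h t) (r t)) \<le> norm (k / 2 * (P t - P (t - h)) + h * (N (r t))\<^sup>2 / (2 * k))"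
        using bound by eventually_elim simp
    qed
    have "\<bar>\<integral>t. ip (y h t) (r t) \<partial>M\<bar> \<le> (\<integral>t. \<bar>ip (y h t) (r t)\<bar> \<partial>M)"
      by (rule integral_abs_bound)
    also have "\<dots> \<le> (\<integral>t. k / 2 * (P t - P (t - h)) + h * (N (r t))\<^sup>2 / (2 * k) \<partial>M)"
      by (rule integral_mono_AE[OF integrable_abs[OF int] int_b bound])
    also have "\<dots> = k / 2 * (\<integral>t. P t - P (t - h) \<partial>M) + h * (\<integral>t. (N (r t))\<^sup>2 \<partial>M) / (2 * k)"
    proof -
      have "integrable M (\<lambda>t. k / 2 * (P t - P (t - h)))" "integrable M (\<lambda>t. h * (N (r t))\<^sup>2 / (2 * k))"
        using P_int(1)[of h] int_r h by auto
      then show ?thesis by simp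
    qed
    also have "\<dots> \<le> k / 2 * (h * P T) + h * (\<integral>t. (N (r t))\<^sup>2 \<partial>M) / (2 * k)"
      using P_int(2)[of h] h k by (intro add_right_mono mult_left_mono) auto
    also have "\<dots> = (k / 2 * P T + (\<integral>t. (N (r t))\<^sup>2 \<partial>M) / (2 * k)) * h"
      using k by (simp add: field_simps)
    finally show "\<bar>\<integral>t. ip (y h t) (r t) \<partial>M\<bar> / h \<le> k / 2 * P T + (\<integral>t. (N (r t))\<^sup>2 \<partial>M) / (2 * k)"
      using h by (simp add: pos_divide_le_eq)
  qed

  have nonpos: "(\<integral>t. ip (y h t) (z t) \<partial>M) \<le> 0" if h: "0 < h" "h \<le> T" for h
  proof -
    \<comment> \<open>The quadratic form along u, which in the application is minus the Dirichlet
      energy. Setting it to 0 where \<open>u t\<close> leaves D makes it nonpositive at every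
      time.\<close>
    define \<beta> where "\<beta> t = (if u t \<in> D then ip (u t) (A (u t)) else 0)" for t
    have \<beta>: "integrable M \<beta>"
    proof (rule integrable_cong_AE_imp)
      show i: "integrable M (\<lambda>t. ip (u t) (z t))"
        by (rule integrable_ip[OF u z])
      show ae: "AE t in M. ip (u t) (z t) = \<beta> t"
        using D(2) by eventually_elim (simp add: \<beta>_def z_def)
      show "\<beta> \<in> borel_measurable M"
        by (rule borel_measurable_lebesgue_on_AE[OF borel_measurable_integrable[OF i] ae]) (simp add: lebesgue_setsI)
    qed
    have uw: "AE t in M. u t \<in> D \<and> N (u t - w t) = 0"
      using D(2) w unfolding continuous_representative_def by (auto elim: eventually_elim2)
    have sp: "AE t in M. t \<in> space M" by (rule AE_space)
    have "AE t in M. ip (y h t) (z t) \<le> (\<beta> t - (if t < h then 0 else \<beta> (t - h))) / 2"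
      using uw AE_lebesgue_on_shift[OF uw less_imp_le[OF h(1)]] sp
    proof eventually_elim
      case (elim t)
      then have t: "t \<in> {0..T}" by simp
      \<comment> \<open>The hypotheses on A speak about u and the increments about w; both have the
        same pairings wherever their difference has norm 0.\<close>
      have subst: "ip (w s) c = ip (u s) c" if "s \<in> {0..T}" "u s \<in> D" "N (u s - w s) = 0" "c \<in> V" for s c
      proof -
        have "ip (u s - w s) c = 0"
          using that wV D(1) V_closed(3) by (intro ip_eq_0) auto
        then show ?thesis
          using that wV D(1) by (auto simp: ip_diff_left subset_iff)
      qed
      have V: "u t \<in> V" "A (u t) \<in> V" using elim D(1) A by auto
      show ?case
      proof (cases "t < h")
        \<comment> \<open>The shifted term is 0 here and the pairing is \<open>\<beta> t\<close>
          itself, which is at most half of itself because it is nonpositive.\<close>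
        case True
        then show ?thesis
          using subst[OF t _ _ V(2)] elim diss[of "u t"] by (simp add: y_def z_def \<beta>_def)
      next
        case False
        then have th: "t - h \<in> {0..T}" "u (t - h) \<in> D" "N (u (t - h) - w (t - h)) = 0"
          using elim t h by auto
        have "ip (y h t) (z t) = ip (u t) (A (u t)) - ip (u (t - h)) (A (u t))"
          using False subst[OF t _ _ V(2)] subst[OF th V(2)] elim wV[OF t] wV[OF th(1)] V(2)
          by (simp add: y_def z_def ip_diff_left)
        also have "\<dots> = ip (u t - u (t - h)) (A (u t))"
          using V th(2) D(1) by (subst ip_diff_left) auto
        also have "\<dots> \<le> (ip (u t) (A (u t)) - ip (u (t - h)) (A (u (t - h)))) / 2"
          using elim th by (intro convex) auto
        finally show ?thesis
          using False elim th by (simp add: \<beta>_def)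
      qed
    qed
    then have "(\<integral>t. ip (y h t) (z t) \<partial>M) \<le> (\<integral>t. (\<beta> t - (if t < h then 0 else \<beta> (t - h))) / 2 \<partial>M)"
      using pairing(1)[OF h z, of 1] \<beta> integral_shift(1)[OF \<beta>, of h] h
      by (intro integral_mono_AE) auto
    also have "\<dots> = (\<integral>t. \<beta> t - (if t < h then 0 else \<beta> (t - h)) \<partial>M) / 2"
      by (rule integral_divide_zero)
    \<comment> \<open>After telescoping only the energy near the final time is left, and it enters
      with the favourable sign.\<close>
    also have "\<dots> = (\<integral>t. \<beta> t \<partial>lebesgue_on {T-h..T}) / 2"
      using integral_diff_shift[OF \<beta>, of h] h by simp
    also have "\<dots> \<le> 0"
    proof -
      have "0 \<le> (\<integral>t. - \<beta> t \<partial>lebesgue_on {T-h..T})"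
        using diss by (intro integral_nonneg_AE AE_I2) (simp add: \<beta>_def)
      then show ?thesis by simp
    qed
    finally show ?thesis .
  qed

  obtain s where s: "\<And>i. simple_function M (s i)" "\<And>i t. t \<in> {0..T} \<Longrightarrow> s i t \<in> V" "\<And>i. s i \<in> L2V"
    and s_lim: "(\<lambda>i. \<integral>t. (N (z t - s i t))\<^sup>2 \<partial>M) \<longlonglongrightarrow> 0"
    using L2V_approx[OF z] by blast
  \<comment> \<open>z is split into a simple function and a remainder r. The remainder costs e once
    for the difference quotients and once for p itself, whence e + e. Weak convergence is only
    needed against the simple part.\<close>
  have est: "(\<integral>t. ip (p t) (z t) \<partial>M) \<le> k * P T + (\<integral>t. (N (z t - s i t))\<^sup>2 \<partial>M) / k" if k: "0 < k" for k i
  proof -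
    define r where "r t = z t - s i t" for t
    have r: "r \<in> L2V"
      unfolding r_def[abs_def] by (rule L2V_diff[OF z s(3)])
    have bs: "meas (s i)"
      using s(3)[of i] by (simp add: L2_time_def)
    define e where "e = k / 2 * P T + (\<integral>t. (N (r t))\<^sup>2 \<partial>M) / (2 * k)"
    have conv: "(\<lambda>n. (\<integral>t. ip (y (T / Suc n) t) (s i t) \<partial>M) / (T / Suc n)) \<longlonglongrightarrow> (\<integral>t. ip (p t) (s i t) \<partial>M)"
    proof -
      have c: "c \<in> V" if "c \<in> s i ` {0..T}" for c
        using that s(2) by auto
      have "(\<integral>t. ip (y (T / Suc n) t) (s i t) \<partial>M) / (T / Suc n)
          = (\<Sum>c\<in>s i ` {0..T}. \<integral>t. indicator (s i -` {c} \<inter> {0..T}) t *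
              ((prim p c t - prim p c (t - T / Suc n)) / (T / Suc n)) \<partial>M)" for n
      proof -
        have "(\<integral>t. ip (y (T / Suc n) t) (s i t) \<partial>M)
            = (\<Sum>c\<in>s i ` {0..T}. \<integral>t. indicator (s i -` {c} \<inter> {0..T}) t * ip (y (T / Suc n) t) c \<partial>M)"
          using T_pos by (intro integral_ip_simple s(1,2) int_y) auto
        also have "\<dots> = (\<Sum>c\<in>s i ` {0..T}. \<integral>t. indicator (s i -` {c} \<inter> {0..T}) t *
            (prim p c t - prim p c (t - T / Suc n)) \<partial>M)"
          using T_pos c by (intro sum.cong Bochner_Integration.integral_cong refl) (simp add: y_ip)
        finally show ?thesis
          by (simp only: sum_divide_distrib integral_divide_zero[symmetric] times_divide_eq_right)
      qed
      \<comment> \<open>For a fixed simple function finitely many scalar functions occur, and each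
        converges as a Steklov average against the indicator of a level set.\<close>
      moreover have "(\<lambda>n. \<Sum>c\<in>s i ` {0..T}. \<integral>t. indicator (s i -` {c} \<inter> {0..T}) t *
              ((prim p c t - prim p c (t - T / Suc n)) / (T / Suc n)) \<partial>M)
          \<longlonglongrightarrow> (\<Sum>c\<in>s i ` {0..T}. \<integral>t. indicator (s i -` {c} \<inter> {0..T}) t * ip (p t) c \<partial>M)"
        by (intro tendsto_sum steklov_integral_tendsto[where B=1] L2V_ip_integrable[OF p c] T_pos
            simple_function_preimage_indicator s(1)) (auto simp: indicator_def)
      ultimately show ?thesis
        using integral_ip_simple[OF s(1,2) L2V_ip_integrable[OF p], of i] by simp
    qed
    have "(\<integral>t. ip (p t) (s i t) \<partial>M) \<le> e"
    proof (rule LIMSEQ_le_const2[OF conv], intro exI allI impI)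
      fix n :: nat
      define h where "h = T / Suc n"
      have h: "0 < h" "h \<le> T" using T_pos by (auto simp: h_def field_simps)
      have "(\<integral>t. ip (y h t) (s i t) \<partial>M) = (\<integral>t. ip (y h t) (z t) - ip (y h t) (r t) \<partial>M)"
      proof (rule integral_cong_AE)
        have sp: "AE t in M. t \<in> space M" by (rule AE_space)
        from sp AE_in_V[OF bm(3)] AE_in_V[OF bs]
        show "AE t in M. ip (y h t) (s i t) = ip (y h t) (z t) - ip (y h t) (r t)"
        proof eventually_elim
          case (elim t)
          then show ?case
            using yV[of t h] h by (simp add: r_def ip_diff_right)
        qed
      qed (use pairing(1)[OF h s(3) k] pairing(1)[OF h z k] pairing(1)[OF h r k] in auto)
      also have "\<dots> = (\<integral>t. ip (y h t) (z t) \<partial>M) - (\<integral>t. ip (y h t) (r t) \<partial>M)"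
        by (rule Bochner_Integration.integral_diff[OF pairing(1)[OF h z k] pairing(1)[OF h r k]])
      also have "\<dots> \<le> \<bar>\<integral>t. ip (y h t) (r t) \<partial>M\<bar>"
        using nonpos[OF h] by simp
      finally have "(\<integral>t. ip (y h t) (s i t) \<partial>M) / h \<le> \<bar>\<integral>t. ip (y h t) (r t) \<partial>M\<bar> / h"
        using h by (intro divide_right_mono) auto
      also have "\<dots> \<le> e"
        unfolding e_def by (rule pairing(2)[OF h r k])
      finally show "(\<integral>t. ip (y (T / Suc n) t) (s i t) \<partial>M) / (T / Suc n) \<le> e"
        by (simp add: h_def)
    qed
    moreover have "(\<integral>t. ip (p t) (r t) \<partial>M) \<le> e"
    proof -
      have int_r: "integrable M (\<lambda>t. (N (r t))\<^sup>2)" and br: "meas r"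
        using r by (auto simp: L2_time_def)
      have "(\<integral>t. ip (p t) (r t) \<partial>M) \<le> (\<integral>t. k / 2 * (N (p t))\<^sup>2 + (N (r t))\<^sup>2 / (2 * k) \<partial>M)"
      proof (rule integral_mono_AE[OF integrable_ip[OF p r]])
        show "AE t in M. ip (p t) (r t) \<le> k / 2 * (N (p t))\<^sup>2 + (N (r t))\<^sup>2 / (2 * k)"
          using AE_in_V[OF bm(2)] AE_in_V[OF br]
        proof eventually_elim
          case (elim t)
          from Young[OF this k] show ?case by simp
        qed
      qed (use int_p int_r in simp)
      also have "\<dots> = e"
        using int_p int_r P_T by (simp add: e_def)
      finally show ?thesis .
    qed
    moreover have "(\<integral>t. ip (p t) (z t) \<partial>M) = (\<integral>t. ip (p t) (s i t) + ip (p t) (r t) \<partial>M)"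
    proof (rule integral_cong_AE)
      show "AE t in M. ip (p t) (z t) = ip (p t) (s i t) + ip (p t) (r t)"
        using AE_in_V[OF bm(2)] AE_in_V[OF bm(3)] AE_in_V[OF bs]
        by eventually_elim (simp add: r_def ip_diff_right)
    qed (use integrable_ip[OF p z] integrable_ip[OF p s(3)] integrable_ip[OF p r] in auto)
    ultimately have "(\<integral>t. ip (p t) (z t) \<partial>M) \<le> e + e"
      using integrable_ip[OF p s(3)[of i]] integrable_ip[OF p r] by simp
    also have "e + e = k * P T + (\<integral>t. (N (z t - s i t))\<^sup>2 \<partial>M) / k"
      using k by (simp add: e_def r_def field_simps)
    finally show ?thesis .
  qed
  \<comment> \<open>The approximation error is divided by k, so the simple functions are refined
    with k fixed; k is made small only afterwards.\<close>
  have bound: "(\<integral>t. ip (p t) (z t) \<partial>M) \<le> k * P T" if k: "0 < k" for k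
  proof (rule LIMSEQ_le_const)
    show "(\<lambda>i. k * P T + (\<integral>t. (N (z t - s i t))\<^sup>2 \<partial>M) / k) \<longlonglongrightarrow> k * P T"
      using tendsto_add[OF tendsto_const tendsto_divide_zero[OF s_lim]] by simp
  qed (use est[OF k] in auto)
  have "P T \<ge> 0"
    unfolding P_def by (rule primitive_nonneg) simp
  have "(\<integral>t. ip (p t) (z t) \<partial>M) \<le> 0 + e" if e: "0 < e" for e
  proof -
    \<comment> \<open>The summand 1 keeps the choice of k valid when \<open>P T = 0\<close>.\<close>
    have "(\<integral>t. ip (p t) (z t) \<partial>M) \<le> e / (P T + 1) * P T"
      using e \<open>P T \<ge> 0\<close> by (intro bound) (auto intro!: divide_pos_pos)
    also have "\<dots> \<le> e"
      using e \<open>P T \<ge> 0\<close> by (simp add: field_simps)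
    finally show ?thesis by simp
  qed
  then show ?thesis
    unfolding z_def[symmetric] by (rule field_le_epsilon)
qed

lemma dissipative_norm_le:
  assumes p: "p \<in> L2V" and z: "z \<in> L2V" and le: "(\<integral>t. ip (p t) (z t) \<partial>M) \<le> 0"
  shows "L2_time_norm {0..T} N p \<le> L2_time_norm {0..T} N (\<lambda>t. p t - z t)"
    and "L2_time_norm {0..T} N z \<le> L2_time_norm {0..T} N (\<lambda>t. p t - z t)"
proof -
  have bm: "meas p" "meas z"
    and int: "integrable M (\<lambda>t. (N (p t))\<^sup>2)" "integrable M (\<lambda>t. (N (z t))\<^sup>2)"
    using p z by (auto simp: L2_time_def)
  have int_d: "integrable M (\<lambda>t. (N (p t - z t))\<^sup>2)"
    using L2V_diff[OF p z] by (auto simp: L2_time_def)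
  have "(\<integral>t. (N (p t - z t))\<^sup>2 \<partial>M) = (\<integral>t. (N (p t))\<^sup>2 - 2 * ip (p t) (z t) + (N (z t))\<^sup>2 \<partial>M)"
  proof (rule integral_cong_AE)
    show "AE t in M. (N (p t - z t))\<^sup>2 = (N (p t))\<^sup>2 - 2 * ip (p t) (z t) + (N (z t))\<^sup>2"
      using AE_in_V[OF bm(1)] AE_in_V[OF bm(2)]
      by eventually_elim (simp add: N_sq V_closed ip_diff_sq)
  qed (use int int_d integrable_ip[OF p z] in auto)
  also have "\<dots> = (\<integral>t. (N (p t))\<^sup>2 \<partial>M) - 2 * (\<integral>t. ip (p t) (z t) \<partial>M) + (\<integral>t. (N (z t))\<^sup>2 \<partial>M)"
    using int integrable_ip[OF p z] by simp
  finally have eq: "(\<integral>t. (N (p t - z t))\<^sup>2 \<partial>M) = \<dots>" .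
  have "0 \<le> (\<integral>t. (N (p t))\<^sup>2 \<partial>M)" "0 \<le> (\<integral>t. (N (z t))\<^sup>2 \<partial>M)"
    by simp_all
  then have "(\<integral>t. (N (p t))\<^sup>2 \<partial>M) \<le> (\<integral>t. (N (p t - z t))\<^sup>2 \<partial>M)" "(\<integral>t. (N (z t))\<^sup>2 \<partial>M) \<le> (\<integral>t. (N (p t - z t))\<^sup>2 \<partial>M)"
    using eq le by linarith+
  then show "L2_time_norm {0..T} N p \<le> L2_time_norm {0..T} N (\<lambda>t. p t - z t)"
    "L2_time_norm {0..T} N z \<le> L2_time_norm {0..T} N (\<lambda>t. p t - z t)"
    unfolding L2_time_norm_def by (auto intro!: real_sqrt_le_mono)
qed

end

section \<open>Weak partial derivatives\<close>

abbreviation "pd \<equiv> weak_partial"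

definition L2_ip :: "'a::euclidean_space set \<Rightarrow> ('a \<Rightarrow> real) \<Rightarrow> ('a \<Rightarrow> real) \<Rightarrow> real" where
  "L2_ip \<Omega> u v = (\<integral>x. u x * v x \<partial>lebesgue_on \<Omega>)"

lemma L2_measurable: "u \<in> L2 \<Omega> \<Longrightarrow> u \<in> borel_measurable (lebesgue_on \<Omega>)"
  by (simp add: L2_def)

lemma L2_integrable_mult:
  assumes "u \<in> L2 \<Omega>" "v \<in> L2 \<Omega>"
  shows "integrable (lebesgue_on \<Omega>) (\<lambda>x. u x * v x)"
proof (rule Bochner_Integration.integrable_bound)
  show "integrable (lebesgue_on \<Omega>) (\<lambda>x. (u x)\<^sup>2 + (v x)\<^sup>2)"
    using assms by (simp add: L2_def)
  show "(\<lambda>x. u x * v x) \<in> borel_measurable (lebesgue_on \<Omega>)"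
    using assms L2_measurable by (intro borel_measurable_times) auto
  have "\<bar>a * b\<bar> \<le> a\<^sup>2 + b\<^sup>2" for a b :: real
  proof -
    have "2 * (\<bar>a\<bar> * \<bar>b\<bar>) \<le> a\<^sup>2 + b\<^sup>2"
      using sum_squares_bound[of "\<bar>a\<bar>" "\<bar>b\<bar>"] by (simp add: mult.assoc)
    moreover have "0 \<le> \<bar>a\<bar> * \<bar>b\<bar>" by simp
    ultimately show ?thesis unfolding abs_mult by linarith
  qed
  then show "AE x in lebesgue_on \<Omega>. norm (u x * v x) \<le> norm ((u x)\<^sup>2 + (v x)\<^sup>2)"
    by simp
qed

lemma L2_add: 
  assumes "u \<in> L2 \<Omega>" "v \<in> L2 \<Omega>"
  shows "u + v \<in> L2 \<Omega>"
proof -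
  have "integrable (lebesgue_on \<Omega>) (\<lambda>x. (u x)\<^sup>2 + (v x)\<^sup>2 + 2 * (u x * v x))"
    using assms L2_integrable_mult[OF assms] by (simp add: L2_def)
  moreover have "(u x)\<^sup>2 + (v x)\<^sup>2 + 2 * (u x * v x) = ((u + v) x)\<^sup>2" for x
    by (simp add: power2_sum)
  ultimately show ?thesis
    using assms by (auto simp: L2_def plus_fun_def)
qed

lemma L2_scale: "u \<in> L2 \<Omega> \<Longrightarrow> c *\<^sub>R u \<in> L2 \<Omega>"
  by (auto simp: L2_def scaleR_fun_def power_mult_distrib)

lemma semi_inner_L2: "semi_inner (L2 \<Omega>) (L2_ip \<Omega>) (L2_norm \<Omega>)"
proof
  show "subspace (L2 \<Omega>)"
    using L2_add L2_scale by (auto simp: subspace_def) (simp add: L2_def zero_fun_def)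
qed (auto simp: L2_ip_def L2_norm_def L2_integrable_mult distrib_right scaleR_fun_def power2_eq_square
    mult.assoc intro: Bochner_Integration.integral_cong)

lemma L2_diff: "u \<in> L2 \<Omega> \<Longrightarrow> v \<in> L2 \<Omega> \<Longrightarrow> u - v \<in> L2 \<Omega>"
  by (rule semi_inner.V_closed(3)[OF semi_inner_L2])

lemma L2_cong_AE:
  assumes u: "u \<in> L2 \<Omega>" and ae: "AE x in lebesgue_on \<Omega>. u x = v x" and \<Omega>: "open \<Omega>"
  shows "v \<in> L2 \<Omega>"
proof -
  have v: "v \<in> borel_measurable (lebesgue_on \<Omega>)"
    using L2_measurable[OF u] ae lebesgue_setsI(1)[OF \<Omega>] by (rule borel_measurable_lebesgue_on_AE)
  have "integrable (lebesgue_on \<Omega>) (\<lambda>x. (v x)\<^sup>2)"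
  proof (rule integrable_cong_AE_imp)
    show "integrable (lebesgue_on \<Omega>) (\<lambda>x. (u x)\<^sup>2)" using u by (simp add: L2_def)
    show "AE x in lebesgue_on \<Omega>. (u x)\<^sup>2 = (v x)\<^sup>2" using ae by eventually_elim simp
  qed (use v in measurable)
  with v show ?thesis by (simp add: L2_def)
qed

lemma L2_norm_cong_AE:
  assumes u: "u \<in> L2 \<Omega>" and v: "v \<in> L2 \<Omega>" and ae: "AE x in lebesgue_on \<Omega>. u x = v x"
  shows "L2_norm \<Omega> u = L2_norm \<Omega> v"
proof -
  have "(\<integral>x. (u x)\<^sup>2 \<partial>lebesgue_on \<Omega>) = (\<integral>x. (v x)\<^sup>2 \<partial>lebesgue_on \<Omega>)"
    using ae u v by (intro integral_cong_AE) (auto simp: L2_def elim: eventually_mono)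
  then show ?thesis by (simp add: L2_norm_def)
qed

lemma L2_norm_diff_eq_0:
  assumes "AE x in lebesgue_on \<Omega>. u x = v x"
  shows "L2_norm \<Omega> (u - v) = 0"
proof -
  have "(\<integral>x. ((u - v) x)\<^sup>2 \<partial>lebesgue_on \<Omega>) = 0"
    using assms by (intro integral_eq_zero_AE) (auto elim: eventually_mono)
  then show ?thesis by (simp add: L2_norm_def)
qed

lemma L2_norm_nonneg: "0 \<le> L2_norm \<Omega> u"
  by (simp add: L2_norm_def)

lemma test_function_L2:
  assumes \<Omega>: "open \<Omega>" and \<phi>: "test_function \<Omega> \<phi>"
  shows "\<phi> \<in> L2 \<Omega>"
proof -
  have \<phi>2: "test_function \<Omega> (\<lambda>x. \<phi> x * \<phi> x)"
    using \<phi> by (intro test_function_mult)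
  have "integrable (lebesgue_on \<Omega>) (\<lambda>x. \<phi> x * \<phi> x)"
    using integral_lborel_eq_lebesgue_on(2)[OF \<Omega> test_function_integrable_lborel[OF \<phi>2]]
      test_function_zero_outside[OF \<phi>] by simp
  then show ?thesis
    using test_function_measurable(2)[OF \<phi>] by (simp add: L2_def power2_eq_square)
qed

lemma has_weak_partial_diff:
  assumes \<Omega>: "open \<Omega>" and b: "b \<in> Basis"
    and u: "u \<in> L2 \<Omega>" "u' \<in> L2 \<Omega>" and v: "v \<in> L2 \<Omega>" "v' \<in> L2 \<Omega>"
    and weak: "has_weak_partial \<Omega> b u v" "has_weak_partial \<Omega> b u' v'"
  shows "has_weak_partial \<Omega> b (u - u') (v - v')"
  unfolding has_weak_partial_def
proof (intro allI impI)
  fix \<phi> assume \<phi>: "test_function \<Omega> \<phi>"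
  have L: "\<phi> \<in> L2 \<Omega>" "(\<lambda>x. frechet_derivative \<phi> (at x) b) \<in> L2 \<Omega>"
    using \<phi> b by (auto intro!: test_function_L2 \<Omega> test_function_partial)
  show "(\<integral>x. (u - u') x * frechet_derivative \<phi> (at x) b \<partial>lebesgue_on \<Omega>)
      = - (\<integral>x. (v - v') x * \<phi> x \<partial>lebesgue_on \<Omega>)"
    using weak \<phi> L2_integrable_mult[OF u(1) L(2)] L2_integrable_mult[OF u(2) L(2)]
      L2_integrable_mult[OF v(1) L(1)] L2_integrable_mult[OF v(2) L(1)]
    by (simp add: has_weak_partial_def left_diff_distrib)
qed

lemma has_weak_partial_cong_AE:
  assumes \<Omega>: "open \<Omega>" and b: "b \<in> Basis" and u: "u \<in> L2 \<Omega>" "u' \<in> L2 \<Omega>"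
    and ae: "AE x in lebesgue_on \<Omega>. u x = u' x" and weak: "has_weak_partial \<Omega> b u v"
  shows "has_weak_partial \<Omega> b u' v"
  unfolding has_weak_partial_def
proof (intro allI impI)
  fix \<phi> assume \<phi>: "test_function \<Omega> \<phi>"
  have "(\<lambda>x. frechet_derivative \<phi> (at x) b) \<in> L2 \<Omega>"
    using \<phi> b by (auto intro!: test_function_L2 \<Omega> test_function_partial)
  then have "(\<integral>x. u' x * frechet_derivative \<phi> (at x) b \<partial>lebesgue_on \<Omega>)
      = (\<integral>x. u x * frechet_derivative \<phi> (at x) b \<partial>lebesgue_on \<Omega>)"
    using ae L2_measurable u by (intro integral_cong_AE borel_measurable_times) (auto elim: eventually_mono)
  then show "(\<integral>x. u' x * frechet_derivative \<phi> (at x) b \<partial>lebesgue_on \<Omega>)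
      = - (\<integral>x. v x * \<phi> x \<partial>lebesgue_on \<Omega>)"
    using weak \<phi> by (simp add: has_weak_partial_def)
qed

text \<open>The difference integrates to 0 against every test function. On a domain of infinite
  measure square integrability does not give integrability, but on each box inside \<Omega> it does,
  which is all that the fundamental lemma asks for.\<close>

lemma has_weak_partial_unique:
  assumes \<Omega>: "open \<Omega>" and v: "v \<in> L2 \<Omega>" "v' \<in> L2 \<Omega>"
    and weak: "has_weak_partial \<Omega> b u v" "has_weak_partial \<Omega> b u v'"
  shows "AE x in lebesgue_on \<Omega>. v x = v' x"
proof -
  have vv: "v - v' \<in> L2 \<Omega>" using v by (rule L2_diff)
  have "AE x in lebesgue_on \<Omega>. (v - v') x = 0"
  proof (rule AE_zero_if_test_integrals_zero[OF \<Omega> L2_measurable[OF vv]])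
    fix a c :: 'a assume ac: "cbox a c \<subseteq> \<Omega>"
    have fin: "finite_measure (lebesgue_on (cbox a c))"
      by (intro finite_measure_lebesgue_on) simp
    have sq: "integrable (lebesgue_on (cbox a c)) (\<lambda>x. ((v - v') x)\<^sup>2)"
      using vv by (intro integrable_lebesgue_on_subset[OF _ ac lebesgue_setsI(1)[OF \<Omega>] lebesgue_setsI(2)[OF closed_cbox]])
        (simp add: L2_def)
    show "integrable (lebesgue_on (cbox a c)) (v - v')"
      by (rule finite_measure.square_integrable_imp_integrable[OF fin measurable_restrict_mono[OF L2_measurable[OF vv] ac] sq])
  next
    fix \<phi> assume \<phi>: "test_function \<Omega> \<phi>"
    have "\<phi> \<in> L2 \<Omega>" by (rule test_function_L2[OF \<Omega> \<phi>])
    then show "(\<integral>x. (v - v') x * \<phi> x \<partial>lebesgue_on \<Omega>) = 0"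
      using weak \<phi> L2_integrable_mult[OF v(1)] L2_integrable_mult[OF v(2)]
      by (simp add: has_weak_partial_def left_diff_distrib)
  qed
  then show ?thesis by eventually_elim simp
qed

section \<open>Sobolev functions under differences and almost everywhere equality\<close>

lemma weak_partial_works:
  assumes "u \<in> H1 \<Omega>" "b \<in> Basis"
  shows "pd \<Omega> b u \<in> L2 \<Omega>" "has_weak_partial \<Omega> b u (pd \<Omega> b u)"
proof -
  have "\<exists>v. v \<in> L2 \<Omega> \<and> has_weak_partial \<Omega> b u v"
    using assms by (auto simp: H1_def)
  from someI_ex[OF this] show "pd \<Omega> b u \<in> L2 \<Omega>" "has_weak_partial \<Omega> b u (pd \<Omega> b u)"
    by (auto simp: weak_partial_def)
qed

lemma H1_L2: "u \<in> H1 \<Omega> \<Longrightarrow> u \<in> L2 \<Omega>"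
  by (simp add: H1_def)

lemma H2_H1: "u \<in> H2 \<Omega> \<Longrightarrow> u \<in> H1 \<Omega>"
  by (simp add: H2_def)

lemma H2_weak_partial: "u \<in> H2 \<Omega> \<Longrightarrow> b \<in> Basis \<Longrightarrow> pd \<Omega> b u \<in> H1 \<Omega>"
  by (simp add: H2_def)

lemma H1_diff:
  assumes \<Omega>: "open \<Omega>" and u: "u \<in> H1 \<Omega>" and v: "v \<in> H1 \<Omega>"
  shows "u - v \<in> H1 \<Omega>"
proof -
  have "\<exists>w\<in>L2 \<Omega>. has_weak_partial \<Omega> b (u - v) w" if b: "b \<in> Basis" for b
    using has_weak_partial_diff[OF \<Omega> b H1_L2[OF u] H1_L2[OF v] weak_partial_works(1)[OF u b] weak_partial_works(1)[OF v b]
      weak_partial_works(2)[OF u b] weak_partial_works(2)[OF v b]]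
      L2_diff weak_partial_works(1)[OF u b] weak_partial_works(1)[OF v b] by blast
  then show ?thesis
    using L2_diff[OF H1_L2[OF u] H1_L2[OF v]] by (simp add: H1_def)
qed

text \<open>\<open>weak_partial\<close> selects an arbitrary representative, so linearity can hold
  only almost everywhere and is a consequence of uniqueness.\<close>

lemma weak_partial_diff:
  assumes \<Omega>: "open \<Omega>" and u: "u \<in> H1 \<Omega>" and v: "v \<in> H1 \<Omega>" and b: "b \<in> Basis"
  shows "AE x in lebesgue_on \<Omega>. pd \<Omega> b (u - v) x = (pd \<Omega> b u - pd \<Omega> b v) x"
  by (rule has_weak_partial_unique[OF \<Omega> _ _ weak_partial_works(2)[OF H1_diff[OF \<Omega> u v] b]])
     (intro weak_partial_works has_weak_partial_diff H1_diff H1_L2 L2_diff \<Omega> u v b)+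

lemma H1_cong_AE:
  assumes \<Omega>: "open \<Omega>" and u: "u \<in> H1 \<Omega>" and ae: "AE x in lebesgue_on \<Omega>. u x = v x"
  shows "v \<in> H1 \<Omega>"
proof -
  have v: "v \<in> L2 \<Omega>"
    by (rule L2_cong_AE[OF H1_L2[OF u] ae \<Omega>])
  show ?thesis
    using v u has_weak_partial_cong_AE[OF \<Omega> _ H1_L2[OF u] v ae] unfolding H1_def by blast
qed

lemma weak_partial_cong_AE:
  assumes \<Omega>: "open \<Omega>" and u: "u \<in> H1 \<Omega>" and ae: "AE x in lebesgue_on \<Omega>. u x = v x" and b: "b \<in> Basis"
  shows "AE x in lebesgue_on \<Omega>. pd \<Omega> b u x = pd \<Omega> b v x"
proof -
  have v: "v \<in> H1 \<Omega>" by (rule H1_cong_AE[OF \<Omega> u ae])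
  show ?thesis
    by (rule has_weak_partial_unique[OF \<Omega> weak_partial_works(1)[OF u b] weak_partial_works(1)[OF v b]
        has_weak_partial_cong_AE[OF \<Omega> b H1_L2[OF u] H1_L2[OF v] ae weak_partial_works(2)[OF u b]] weak_partial_works(2)[OF v b]])
qed

lemma AE_sym: "AE x in M. f x = g x \<Longrightarrow> AE x in M. g x = f x"
  by (auto elim: eventually_mono)

text \<open>The chosen derivative of u - v agrees almost everywhere with a difference of H1
  functions, and membership in H1 is stable under such a change.\<close>

lemma H2_diff:
  assumes \<Omega>: "open \<Omega>" and u: "u \<in> H2 \<Omega>" and v: "v \<in> H2 \<Omega>"
  shows "u - v \<in> H2 \<Omega>"
  unfolding H2_def using H1_diff[OF \<Omega> H2_H1[OF u] H2_H1[OF v]]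
    H1_cong_AE[OF \<Omega> H1_diff[OF \<Omega> H2_weak_partial[OF u] H2_weak_partial[OF v]] AE_sym[OF weak_partial_diff[OF \<Omega> H2_H1[OF u] H2_H1[OF v]]]]
  by auto

lemma laplacian_apply: "laplacian \<Omega> u x = (\<Sum>b\<in>Basis. pd \<Omega> b (pd \<Omega> b u) x)"
proof -
  have "(\<Sum>b\<in>B. F b) x = (\<Sum>b\<in>B. F b x)" if "finite B" for B :: "'a set" and F :: "'a \<Rightarrow> 'a \<Rightarrow> real"
    using that by (induction B rule: finite_induct) auto
  then show ?thesis
    unfolding laplacian_def by simp
qed

text \<open>There are two layers of choice: the inner derivative is first replaced by a difference
  of derivatives, which changes the outer derivative on a null set only, and then the outer one is
  split.\<close>

lemma laplacian_diff:
  assumes \<Omega>: "open \<Omega>" and u: "u \<in> H2 \<Omega>" and v: "v \<in> H2 \<Omega>"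
  shows "AE x in lebesgue_on \<Omega>. laplacian \<Omega> (u - v) x = (laplacian \<Omega> u - laplacian \<Omega> v) x"
proof -
  have "AE x in lebesgue_on \<Omega>. pd \<Omega> b (pd \<Omega> b (u - v)) x =
      pd \<Omega> b (pd \<Omega> b u) x - pd \<Omega> b (pd \<Omega> b v) x" if b: "b \<in> Basis" for b
    using weak_partial_cong_AE[where v="pd \<Omega> b u - pd \<Omega> b v", OF \<Omega> H2_weak_partial[OF H2_diff[OF \<Omega> u v] b] weak_partial_diff[OF \<Omega> H2_H1[OF u] H2_H1[OF v] b] b]
      weak_partial_diff[OF \<Omega> H2_weak_partial[OF u b] H2_weak_partial[OF v b] b]
    by eventually_elim simp
  then have "AE x in lebesgue_on \<Omega>. \<forall>b\<in>Basis. pd \<Omega> b (pd \<Omega> b (u - v)) x =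
      pd \<Omega> b (pd \<Omega> b u) x - pd \<Omega> b (pd \<Omega> b v) x"
    by (intro AE_finite_allI) auto
  then show ?thesis
    by eventually_elim (simp add: laplacian_apply sum_subtractf)
qed

text \<open>The triangle inequality over the diagonal second derivatives, each bounded by the full
  H2 norm; their number is the factor. The bound carries measurability and integrability in time
  from u to its Laplacian.\<close>

lemma laplacian_L2:
  assumes u: "u \<in> H2 \<Omega>"
  shows "laplacian \<Omega> u \<in> L2 \<Omega>" "L2_norm \<Omega> (laplacian \<Omega> u) \<le> DIM('a::euclidean_space) * H2_norm (\<Omega> :: 'a set) u"
proof -
  interpret semi_inner "L2 \<Omega>" "L2_ip \<Omega>" "L2_norm \<Omega>" by (rule semi_inner_L2)
  have d: "pd \<Omega> b (pd \<Omega> b u) \<in> L2 \<Omega>" if "b \<in> Basis" for b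
    using u that by (intro weak_partial_works H2_weak_partial)
  have sum: "sum F B \<in> L2 \<Omega> \<and> L2_norm \<Omega> (sum F B) \<le> (\<Sum>b\<in>B. L2_norm \<Omega> (F b))"
    if "finite B" "\<And>b. b \<in> B \<Longrightarrow> F b \<in> L2 \<Omega>" for B :: "'a set" and F
    using that
  proof (induction B rule: finite_induct)
    case (insert b B)
    then have IH: "sum F B \<in> L2 \<Omega>" "L2_norm \<Omega> (sum F B) \<le> (\<Sum>b\<in>B. L2_norm \<Omega> (F b))" and b: "F b \<in> L2 \<Omega>"
      by simp_all
    have "L2_norm \<Omega> (F b + sum F B) \<le> L2_norm \<Omega> (F b) + (\<Sum>b\<in>B. L2_norm \<Omega> (F b))"
      using N_triangle[OF b IH(1)] IH(2) by linarith
    then show ?case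
      using V_closed(2)[OF b IH(1)] by (simp only: sum.insert[OF insert.hyps])
  qed (use N_0 V_closed(1) in simp)
  show "laplacian \<Omega> u \<in> L2 \<Omega>"
    using sum[OF finite_Basis d] by (simp add: laplacian_def)
  have "L2_norm \<Omega> (laplacian \<Omega> u) \<le> (\<Sum>b\<in>Basis. L2_norm \<Omega> (pd \<Omega> b (pd \<Omega> b u)))"
    using sum[OF finite_Basis d] by (simp add: laplacian_def)
  also have "\<dots> \<le> (\<Sum>b\<in>(Basis::'a set). H2_norm \<Omega> u)"
  proof (rule sum_mono)
    fix b :: 'a assume b: "b \<in> Basis"
    let ?f = "\<lambda>b c. (L2_norm \<Omega> (pd \<Omega> c (pd \<Omega> b u)))\<^sup>2"
    have "?f b b \<le> (\<Sum>c\<in>Basis. ?f b c)"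
      using b by (intro member_le_sum) auto
    also have "\<dots> \<le> (\<Sum>b\<in>Basis. \<Sum>c\<in>Basis. ?f b c)"
      using b by (intro member_le_sum[of b _ "\<lambda>b. \<Sum>c\<in>Basis. ?f b c"]) (auto intro: sum_nonneg)
    finally have "?f b b \<le> (L2_norm \<Omega> u)\<^sup>2 + (\<Sum>b\<in>Basis. (L2_norm \<Omega> (pd \<Omega> b u))\<^sup>2)
        + (\<Sum>b\<in>Basis. \<Sum>c\<in>Basis. ?f b c)"
      using sum_nonneg[of Basis "\<lambda>b. (L2_norm \<Omega> (pd \<Omega> b u))\<^sup>2"] zero_le_power2[of "L2_norm \<Omega> u"]
      by (smt (verit) zero_le_power2)
    then have "sqrt (?f b b) \<le> H2_norm \<Omega> u"
      unfolding H2_norm_def by (rule real_sqrt_le_mono)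
    then show "L2_norm \<Omega> (pd \<Omega> b (pd \<Omega> b u)) \<le> H2_norm \<Omega> u"
      by (simp add: L2_norm_nonneg)
  qed
  finally show "L2_norm \<Omega> (laplacian \<Omega> u) \<le> DIM('a) * H2_norm \<Omega> u"
    by simp
qed

section \<open>Integration by parts and the Dirichlet energy\<close>

lemma has_weak_partial_test_function:
  assumes \<Omega>: "open \<Omega>" and \<phi>: "test_function \<Omega> \<phi>" and b: "b \<in> Basis"
  shows "has_weak_partial \<Omega> b \<phi> (\<lambda>x. frechet_derivative \<phi> (at x) b)"
  unfolding has_weak_partial_def
proof (intro allI impI)
  fix \<psi> assume \<psi>: "test_function \<Omega> \<psi>"
  let ?d = "\<lambda>\<phi> x. frechet_derivative \<phi> (at x) b"
  have eq: "?d (\<lambda>x. \<phi> x * \<psi> x) x = \<phi> x * ?d \<psi> x + ?d \<phi> x * \<psi> x" for x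
    using fun_cong[OF frechet_derivative_at[OF has_derivative_mult[OF
      test_function_has_derivative[OF \<phi>, of x] test_function_has_derivative[OF \<psi>, of x]]], of b] by simp
  have t: "test_function \<Omega> (\<lambda>x. \<phi> x * ?d \<psi> x)" "test_function \<Omega> (\<lambda>x. ?d \<phi> x * \<psi> x)"
    by (rule test_function_mult[OF \<phi> test_function_partial[OF \<psi> b]],
        rule test_function_mult[OF test_function_partial[OF \<phi> b] \<psi>])
  \<comment> \<open>The derivative of the compactly supported product \<phi>\<psi> integrates to 0
    over the whole space; the product rule then is integration by parts.\<close>
  have "0 = (\<integral>x. \<phi> x * ?d \<psi> x + ?d \<phi> x * \<psi> x \<partial>lborel)"
    using integral_partial_test_function[OF test_function_mult[OF \<phi> \<psi>] b] by (simp add: eq)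
  also have "\<dots> = (\<integral>x. \<phi> x * ?d \<psi> x \<partial>lborel) + (\<integral>x. ?d \<phi> x * \<psi> x \<partial>lborel)"
    by (rule Bochner_Integration.integral_add[OF test_function_integrable_lborel[OF t(1)] test_function_integrable_lborel[OF t(2)]])
  also have "(\<integral>x. \<phi> x * ?d \<psi> x \<partial>lborel) = (\<integral>x. \<phi> x * ?d \<psi> x \<partial>lebesgue_on \<Omega>)"
    by (rule integral_lborel_eq_lebesgue_on(1)[symmetric, OF \<Omega> test_function_integrable_lborel[OF t(1)] test_function_zero_outside[OF t(1)]])
  also have "(\<integral>x. ?d \<phi> x * \<psi> x \<partial>lborel) = (\<integral>x. ?d \<phi> x * \<psi> x \<partial>lebesgue_on \<Omega>)"
    by (rule integral_lborel_eq_lebesgue_on(1)[symmetric, OF \<Omega> test_function_integrable_lborel[OF t(2)] test_function_zero_outside[OF t(2)]])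
  finally show "(\<integral>x. \<phi> x * ?d \<psi> x \<partial>lebesgue_on \<Omega>) = - (\<integral>x. ?d \<phi> x * \<psi> x \<partial>lebesgue_on \<Omega>)"
    by simp
qed

lemma test_function_H1:
  assumes "open \<Omega>" "test_function \<Omega> \<phi>"
  shows "\<phi> \<in> H1 \<Omega>"
proof -
  have "\<exists>v\<in>L2 \<Omega>. has_weak_partial \<Omega> b \<phi> v" if b: "b \<in> Basis" for b
    using has_weak_partial_test_function[OF assms b] test_function_L2[OF assms(1) test_function_partial[OF assms(2) b]]
    by (rule bexI)
  then show ?thesis
    using test_function_L2[OF assms] by (simp add: H1_def)
qed

lemma L2_norm_le_H1_norm:
  "L2_norm \<Omega> u \<le> H1_norm \<Omega> u" "b \<in> Basis \<Longrightarrow> L2_norm \<Omega> (pd \<Omega> b u) \<le> H1_norm \<Omega> u"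
proof -
  have "sqrt ((L2_norm \<Omega> u)\<^sup>2) \<le> H1_norm \<Omega> u"
    unfolding H1_norm_def by (intro real_sqrt_le_mono) (simp add: sum_nonneg)
  then show "L2_norm \<Omega> u \<le> H1_norm \<Omega> u" by (simp add: L2_norm_nonneg)
  assume b: "b \<in> Basis"
  have "(L2_norm \<Omega> (pd \<Omega> b u))\<^sup>2 \<le> (\<Sum>b\<in>Basis. (L2_norm \<Omega> (pd \<Omega> b u))\<^sup>2)"
    using b by (intro member_le_sum[of b _ "\<lambda>b. (L2_norm \<Omega> (pd \<Omega> b u))\<^sup>2"]) auto
  then have "sqrt ((L2_norm \<Omega> (pd \<Omega> b u))\<^sup>2) \<le> H1_norm \<Omega> u"
    unfolding H1_norm_def by (intro real_sqrt_le_mono) (simp add: add_increasing)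
  then show "L2_norm \<Omega> (pd \<Omega> b u) \<le> H1_norm \<Omega> u"
    by (simp add: L2_norm_nonneg)
qed

text \<open>For a test function in place of w this is the definition of the weak derivatives of
  \<open>pd \<Omega> b u\<close>. Both sides are continuous in w for the H1 norm and w is an H1
  limit of test functions, so no boundary integral appears.\<close>

lemma Green:
  assumes \<Omega>: "open \<Omega>" and u: "u \<in> H2 \<Omega>" and w: "w \<in> H1_0 \<Omega>"
  shows "L2_ip \<Omega> (laplacian \<Omega> u) w = - (\<Sum>b\<in>Basis. L2_ip \<Omega> (pd \<Omega> b u) (pd \<Omega> b w))"
proof -
  interpret semi_inner "L2 \<Omega>" "L2_ip \<Omega>" "L2_norm \<Omega>" by (rule semi_inner_L2)
  obtain \<phi> where \<phi>: "\<And>n. test_function \<Omega> (\<phi> n)" and lim: "(\<lambda>n. H1_norm \<Omega> (\<phi> n - w)) \<longlonglongrightarrow> 0"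
    using w by (auto simp: H1_0_def)
  have w1: "w \<in> H1 \<Omega>" and w2: "w \<in> L2 \<Omega>"
    using w H1_L2 by (auto simp: H1_0_def)
  have dd: "pd \<Omega> b (pd \<Omega> b u) \<in> L2 \<Omega>" if "b \<in> Basis" for b
    using u that by (intro weak_partial_works H2_weak_partial)
  have parts: "L2_ip \<Omega> (pd \<Omega> b (pd \<Omega> b u)) w = - L2_ip \<Omega> (pd \<Omega> b u) (pd \<Omega> b w)"
    if b: "b \<in> Basis" for b
  proof -
    let ?d = "\<lambda>n x. frechet_derivative (\<phi> n) (at x) b"
    have d: "?d n \<in> L2 \<Omega>" for n
      by (rule test_function_L2[OF \<Omega> test_function_partial[OF \<phi> b]])
    have \<phi>L: "\<phi> n \<in> L2 \<Omega>" for n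
      by (rule test_function_L2[OF \<Omega> \<phi>])
    have pw: "pd \<Omega> b w \<in> L2 \<Omega>"
      by (rule weak_partial_works(1)[OF w1 b])
    have pu: "pd \<Omega> b u \<in> H1 \<Omega>" "pd \<Omega> b u \<in> L2 \<Omega>"
      using H2_weak_partial[OF u b] H1_L2 by auto
    \<comment> \<open>The classical derivative of \<open>\<phi> n\<close> minus the weak one of w is
      a weak derivative of \<open>\<phi> n - w\<close>, hence agrees almost everywhere with the
      representative that enters \<open>H1_norm\<close>.\<close>
    have "L2_norm \<Omega> (pd \<Omega> b w - ?d n) \<le> H1_norm \<Omega> (\<phi> n - w)" for n
    proof -
      have \<phi>w: "\<phi> n - w \<in> H1 \<Omega>"
        by (rule H1_diff[OF \<Omega> test_function_H1[OF \<Omega> \<phi>] w1])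
      have "AE x in lebesgue_on \<Omega>. pd \<Omega> b (\<phi> n - w) x = (?d n - pd \<Omega> b w) x"
        by (rule has_weak_partial_unique[OF \<Omega> weak_partial_works(1)[OF \<phi>w b] L2_diff[OF d pw] weak_partial_works(2)[OF \<phi>w b]
            has_weak_partial_diff[OF \<Omega> b \<phi>L w2 d pw has_weak_partial_test_function[OF \<Omega> \<phi> b] weak_partial_works(2)[OF w1 b]]])
      from L2_norm_cong_AE[where v="?d n - pd \<Omega> b w", OF weak_partial_works(1)[OF \<phi>w b] L2_diff[OF d pw] this]
      have "L2_norm \<Omega> (pd \<Omega> b w - ?d n) = L2_norm \<Omega> (pd \<Omega> b (\<phi> n - w))"
        using N_minus_commute[OF pw d[of n]] by simp
      then show ?thesis
        using L2_norm_le_H1_norm(2)[OF b] by simp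
    qed
    then have "(\<lambda>n. L2_norm \<Omega> (pd \<Omega> b w - ?d n)) \<longlonglongrightarrow> 0"
      by (intro Lim_null_comparison[OF _ lim]) (simp add: L2_norm_nonneg)
    from ip_tendsto[OF this pw d pu(2)]
    have l1: "(\<lambda>n. L2_ip \<Omega> (pd \<Omega> b u) (?d n)) \<longlonglongrightarrow> L2_ip \<Omega> (pd \<Omega> b u) (pd \<Omega> b w)" .
    have "L2_norm \<Omega> (w - \<phi> n) \<le> H1_norm \<Omega> (\<phi> n - w)" for n
      using L2_norm_le_H1_norm(1)[of \<Omega> "\<phi> n - w"] N_minus_commute[OF w2 \<phi>L[of n]] by simp
    then have "(\<lambda>n. L2_norm \<Omega> (w - \<phi> n)) \<longlonglongrightarrow> 0"
      by (intro Lim_null_comparison[OF _ lim]) (simp add: L2_norm_nonneg)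
    from ip_tendsto[OF this w2 \<phi>L dd[OF b]]
    have l2: "(\<lambda>n. L2_ip \<Omega> (pd \<Omega> b (pd \<Omega> b u)) (\<phi> n)) \<longlonglongrightarrow> L2_ip \<Omega> (pd \<Omega> b (pd \<Omega> b u)) w" .
    have "L2_ip \<Omega> (pd \<Omega> b u) (?d n) = - L2_ip \<Omega> (pd \<Omega> b (pd \<Omega> b u)) (\<phi> n)" for n
      using weak_partial_works(2)[OF pu(1) b] \<phi> by (simp add: has_weak_partial_def L2_ip_def)
    then have "L2_ip \<Omega> (pd \<Omega> b u) (pd \<Omega> b w) = - L2_ip \<Omega> (pd \<Omega> b (pd \<Omega> b u)) w"
      using LIMSEQ_unique[OF l1] tendsto_minus[OF l2] by simp
    then show ?thesis by simp
  qed
  have "L2_ip \<Omega> (laplacian \<Omega> u) w = (\<Sum>b\<in>Basis. L2_ip \<Omega> (pd \<Omega> b (pd \<Omega> b u)) w)"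
    unfolding laplacian_def
    using ip_sum_left[of Basis "\<lambda>b. pd \<Omega> b (pd \<Omega> b u)" w] dd w2 by simp
  then show ?thesis
    by (simp add: parts sum_negf)
qed

lemma laplacian_dissipative:
  assumes \<Omega>: "open \<Omega>" and x: "x \<in> H2 \<Omega> \<inter> H1_0 \<Omega>"
  shows "L2_ip \<Omega> x (laplacian \<Omega> x) \<le> 0"
proof -
  interpret semi_inner "L2 \<Omega>" "L2_ip \<Omega>" "L2_norm \<Omega>" by (rule semi_inner_L2)
  have "L2_ip \<Omega> x (laplacian \<Omega> x) = L2_ip \<Omega> (laplacian \<Omega> x) x"
    using x H1_L2 H2_H1 laplacian_L2(1) by (intro ip_sym) auto
  also have "\<dots> = - (\<Sum>b\<in>Basis. L2_ip \<Omega> (pd \<Omega> b x) (pd \<Omega> b x))"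
    using x by (intro Green \<Omega>) auto
  also have "\<dots> \<le> 0"
    using x by (auto intro!: sum_nonneg ip_nonneg weak_partial_works(1) H2_H1)
  finally show ?thesis .
qed

text \<open>Green's formula turns the claim into twice the Dirichlet product of x and y being at
  most the sum of their energies, that is, convexity of the Dirichlet energy with its gradient taken
  at x.\<close>

lemma laplacian_increment_le:
  assumes \<Omega>: "open \<Omega>" and x: "x \<in> H2 \<Omega> \<inter> H1_0 \<Omega>" and y: "y \<in> H2 \<Omega> \<inter> H1_0 \<Omega>"
  shows "L2_ip \<Omega> (x - y) (laplacian \<Omega> x) \<le> (L2_ip \<Omega> x (laplacian \<Omega> x) - L2_ip \<Omega> y (laplacian \<Omega> y)) / 2"
proof -
  interpret semi_inner "L2 \<Omega>" "L2_ip \<Omega>" "L2_norm \<Omega>" by (rule semi_inner_L2)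
  let ?D = "\<lambda>u v. \<Sum>b\<in>Basis. L2_ip \<Omega> (pd \<Omega> b u) (pd \<Omega> b v)"
  have L: "x \<in> L2 \<Omega>" "y \<in> L2 \<Omega>" "laplacian \<Omega> x \<in> L2 \<Omega>" "laplacian \<Omega> y \<in> L2 \<Omega>"
    using x y H1_L2 H2_H1 laplacian_L2(1) by auto
  have G: "L2_ip \<Omega> v (laplacian \<Omega> u) = - ?D u v" if "u \<in> H2 \<Omega> \<inter> H1_0 \<Omega>" "v \<in> H2 \<Omega> \<inter> H1_0 \<Omega>" for u v
  proof -
    have "u \<in> H2 \<Omega>" "v \<in> H1_0 \<Omega>" "v \<in> L2 \<Omega>"
      using that by (auto intro: H1_L2 H2_H1)
    then show ?thesis
      using Green[OF \<Omega>] ip_sym laplacian_L2(1) by metis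
  qed
  have "2 * ?D x y \<le> ?D x x + ?D y y"
    unfolding sum_distrib_left sum.distrib[symmetric]
  proof (rule sum_mono)
    fix b :: 'a assume b: "b \<in> Basis"
    have V: "pd \<Omega> b x \<in> L2 \<Omega>" "pd \<Omega> b y \<in> L2 \<Omega>"
      using x y b by (auto intro: weak_partial_works(1) H2_H1)
    show "2 * L2_ip \<Omega> (pd \<Omega> b x) (pd \<Omega> b y) \<le>
        L2_ip \<Omega> (pd \<Omega> b x) (pd \<Omega> b x) + L2_ip \<Omega> (pd \<Omega> b y) (pd \<Omega> b y)"
      using Young[OF V, of 1] by (simp add: N_sq V)
  qed
  moreover have "L2_ip \<Omega> (x - y) (laplacian \<Omega> x) = - ?D x x + ?D x y"
    using G[OF x x] G[OF x y] L by (simp add: ip_diff_left)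
  ultimately show ?thesis
    using G[OF x x] G[OF y y] by simp
qed

section \<open>Equal boundary values as membership of the difference in \<open>H1_0\<close>\<close>

lemma zero_H1_0:
  assumes \<Omega>: "open \<Omega>"
  shows "(0 :: 'a::euclidean_space \<Rightarrow> real) \<in> H1_0 \<Omega>"
proof -
  interpret semi_inner "L2 \<Omega>" "L2_ip \<Omega>" "L2_norm \<Omega>" by (rule semi_inner_L2)
  have z: "test_function \<Omega> (0 :: 'a \<Rightarrow> real)"
    using C_k_const[of _ "0::real"] by (auto simp: zero_fun_def intro!: test_functionI[of _ "{}"])
  have H: "(0 :: 'a \<Rightarrow> real) \<in> H1 \<Omega>"
    by (rule test_function_H1[OF \<Omega> z])
  \<comment> \<open>The chosen weak derivative of 0 may differ from 0 on a null set, so only its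
    norm is shown to vanish.\<close>
  have "L2_norm \<Omega> (pd \<Omega> b 0) = 0" if b: "b \<in> Basis" for b
  proof -
    have "has_weak_partial \<Omega> b 0 0"
      by (simp add: has_weak_partial_def)
    from has_weak_partial_unique[OF \<Omega> weak_partial_works(1)[OF H b] V_closed(1) weak_partial_works(2)[OF H b] this]
    show ?thesis
      using L2_norm_cong_AE[OF weak_partial_works(1)[OF H b] V_closed(1)] N_0 by simp
  qed
  then have "H1_norm \<Omega> 0 = 0"
    by (simp add: H1_norm_def N_0)
  then show ?thesis
    using H z unfolding H1_0_def by (auto intro!: exI[of _ "\<lambda>_. 0"])
qed

text \<open>A trace is a coset, and u lies in its own coset because \<open>H1_0\<close> contains 0;
  equality of cosets then places u in the coset of v.\<close>

lemma H1_bc_diff: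
  assumes \<Omega>: "open \<Omega>" and "u \<in> H1_bc \<Omega> g" "v \<in> H1_bc \<Omega> g"
  shows "u - v \<in> H1_0 \<Omega>"
proof -
  have u: "u \<in> H1 \<Omega>" and "boundary_trace \<Omega> u = boundary_trace \<Omega> v"
    using assms by (simp_all add: H1_bc_def)
  moreover have "u \<in> boundary_trace \<Omega> u"
    using u zero_H1_0[OF \<Omega>] by (simp add: boundary_trace_def)
  ultimately have "u \<in> boundary_trace \<Omega> v"
    by simp
  then show ?thesis
    by (simp add: boundary_trace_def)
qed

section \<open>The parabolic problem\<close>

text \<open>The simple functions that approximate u also approximate v. This is what allows chosen
  derivatives of a difference to be exchanged for differences of chosen derivatives.\<close>

lemma (in semi_inner_time) L2V_cong:
  assumes u: "u \<in> L2V" and ae: "AE t in M. v t \<in> V \<and> N (v t - u t) = 0"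
  shows "v \<in> L2V" "AE t in M. N (v t) = N (u t)"
proof -
  have bm: "meas u"
    using u by (simp add: L2_time_def)
  show N_eq: "AE t in M. N (v t) = N (u t)"
    using ae AE_in_V[OF bm]
  proof eventually_elim
    case (elim t)
    then show ?case
      using N_reverse_triangle[of "v t" "u t"] by simp
  qed
  obtain s where s: "\<And>i. simple_function M (s i)" "\<And>i t. t \<in> {0..T} \<Longrightarrow> s i t \<in> V"
    and s_ae: "AE t in M. u t \<in> V \<and> (\<lambda>i. N (u t - s i t)) \<longlonglongrightarrow> 0"
    using bochner_measurableE[OF bm] by blast
  have "AE t in M. t \<in> space M" by (rule AE_space)
  with ae s_ae have "AE t in M. v t \<in> V \<and> (\<lambda>i. N (v t - s i t)) \<longlonglongrightarrow> 0"
  proof eventually_elim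
    case (elim t)
    then have V: "v t \<in> V" "u t \<in> V" "s i t \<in> V" for i
      using s(2) by auto
    have "(\<lambda>i. N (v t - s i t)) \<longlonglongrightarrow> 0"
    proof (rule Lim_null_comparison[OF always_eventually], rule allI)
      show "norm (N (v t - s i t)) \<le> N (u t - s i t)" for i
        using N_triangle[of "v t - u t" "u t - s i t"] N_nonneg[of "v t - s i t"] V V_closed(3) elim by simp
      show "(\<lambda>i. N (u t - s i t)) \<longlonglongrightarrow> 0" using elim by simp
    qed
    then show ?case using V by simp
  qed
  then have bv: "meas v"
    unfolding bochner_measurable_def using s by (intro exI[of _ s]) auto
  have "integrable M (\<lambda>t. (N (v t))\<^sup>2)"
  proof (rule integrable_cong_AE_imp)
    show "integrable M (\<lambda>t. (N (u t))\<^sup>2)" using u by (simp add: L2_time_def)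
    show "AE t in M. (N (u t))\<^sup>2 = (N (v t))\<^sup>2" using N_eq by eventually_elim simp
  qed (use borel_measurable_N[OF bv] in measurable)
  with bv show "v \<in> L2V" by (simp add: L2_time_def)
qed

lemma (in semi_inner_time) continuous_representative_diff:
  assumes "cont_rep u w" "cont_rep u' w'"
  shows "cont_rep (\<lambda>t. u t - u' t) (\<lambda>t. w t - w' t)"
  unfolding continuous_representative_def
proof (intro conjI ballI)
  have V: "w t \<in> V" "w' t \<in> V" if "t \<in> {0..T}" for t
    using assms that by (auto simp: continuous_representative_def)
  have bound: "norm (N ((a - b) - (c - d))) \<le> N (a - c) + N (b - d)" if "a \<in> V" "b \<in> V" "c \<in> V" "d \<in> V" for a b c d
  proof -
    have eq: "(a - b) - (c - d) = (a - c) - (b - d)" by simp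
    show ?thesis
      unfolding eq
      using N_diff_le[of "a - c" "b - d"] N_nonneg[of "(a - c) - (b - d)"] that V_closed(3) by simp
  qed
  have "AE t in M. u t \<in> V \<and> N (u t - w t) = 0" "AE t in M. u' t \<in> V \<and> N (u' t - w' t) = 0" "AE t in M. t \<in> space M"
    using assms by (auto simp: continuous_representative_def)
  then show "AE t in M. u t - u' t \<in> V \<and> N (u t - u' t - (w t - w' t)) = 0"
  proof eventually_elim
    case (elim t)
    then show ?case
      using bound[of "u t" "u' t" "w t" "w' t"] V[of t] V_closed(3) by simp
  qed
  fix t assume t: "t \<in> {0..T}"
  show "w t - w' t \<in> V"
    using V[OF t] V_closed(3) by simp
  show "((\<lambda>s. N (w s - w' s - (w t - w' t))) \<longlongrightarrow> 0) (at t within {0..T})"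
  proof (rule Lim_null_comparison)
    have "\<forall>\<^sub>F s in at t within {0..T}. s \<in> {0..T}"
      by (simp add: eventually_at_filter)
    then show "\<forall>\<^sub>F s in at t within {0..T}. norm (N (w s - w' s - (w t - w' t))) \<le> N (w s - w t) + N (w' s - w' t)"
      by eventually_elim (use V t in \<open>intro bound; simp\<close>)
    show "((\<lambda>s. N (w s - w t) + N (w' s - w' t)) \<longlongrightarrow> 0) (at t within {0..T})"
      using tendsto_add[of "\<lambda>s. N (w s - w t)" 0 _ "\<lambda>s. N (w' s - w' t)" 0] assms t
      by (simp add: continuous_representative_def)
  qed
qed

lemma (in semi_inner_time) time_deriv_works:
  assumes "u \<in> H1_time {0..T} V N"
  shows "time_deriv {0..T} V N u \<in> L2V" "weak_dt u (time_deriv {0..T} V N u)"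
proof -
  have "\<exists>v. v \<in> L2V \<and> weak_dt u v"
    using assms by (auto simp: H1_time_def)
  from someI_ex[OF this] show "time_deriv {0..T} V N u \<in> L2V" "weak_dt u (time_deriv {0..T} V N u)"
    by (auto simp: time_deriv_def)
qed

text \<open>The Laplacian maps simple functions to simple functions and is bounded on differences
  from the H2 to the L2 norm. In the application D is the affine set of functions with boundary
  values g, so it is treated as a plain set of values with \<open>H2_norm\<close> measuring
  differences.\<close>

lemma laplacian_L2_time:
  fixes \<Omega> :: "'a::euclidean_space set"
  assumes \<Omega>: "open \<Omega>" and T: "0 < T" and D: "D \<subseteq> H2 \<Omega>" and u: "u \<in> L2_time {0..T} D (H2_norm \<Omega>)"
  shows "(\<lambda>t. laplacian \<Omega> (u t)) \<in> L2_time {0..T} (L2 \<Omega>) (L2_norm \<Omega>)"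
proof -
  interpret semi_inner_time "L2 \<Omega>" "L2_ip \<Omega>" "L2_norm \<Omega>" T
    using semi_inner_L2 T by (simp add: semi_inner_time_def semi_inner_time_axioms_def)
  let ?d = "real DIM('a)"
  have int: "integrable M (\<lambda>t. (H2_norm \<Omega> (u t))\<^sup>2)"
    using u by (simp add: L2_time_def)
  obtain s where s: "\<And>i. simple_function M (s i)" "\<And>i. s i ` space M \<subseteq> D"
    and s_ae: "AE t in M. u t \<in> D \<and> (\<lambda>i. H2_norm \<Omega> (u t - s i t)) \<longlonglongrightarrow> 0"
    using u unfolding L2_time_def bochner_measurable_def by blast
  have "AE t in M. laplacian \<Omega> (u t) \<in> L2 \<Omega> \<and> (\<lambda>i. L2_norm \<Omega> (laplacian \<Omega> (u t) - laplacian \<Omega> (s i t))) \<longlonglongrightarrow> 0"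
    using s_ae AE_space[of M]
  proof eventually_elim
    case (elim t)
    have H2: "u t \<in> H2 \<Omega>" "s i t \<in> H2 \<Omega>" for i
      using elim s(2)[of i] D by (auto simp: image_subset_iff subset_iff)
    have "(\<lambda>i. L2_norm \<Omega> (laplacian \<Omega> (u t) - laplacian \<Omega> (s i t))) \<longlonglongrightarrow> 0"
    proof (rule Lim_null_comparison[OF always_eventually], rule allI)
      fix i
      have "L2_norm \<Omega> (laplacian \<Omega> (u t) - laplacian \<Omega> (s i t)) = L2_norm \<Omega> (laplacian \<Omega> (u t - s i t))"
        using H2 by (intro L2_norm_cong_AE AE_sym[OF laplacian_diff] L2_diff laplacian_L2 H2_diff \<Omega>)
      then show "norm (L2_norm \<Omega> (laplacian \<Omega> (u t) - laplacian \<Omega> (s i t))) \<le> ?d * H2_norm \<Omega> (u t - s i t)"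
        using laplacian_L2(2)[OF H2_diff[OF \<Omega> H2(1) H2(2)[of i]]] by (simp add: L2_norm_nonneg)
    next
      show "(\<lambda>i. ?d * H2_norm \<Omega> (u t - s i t)) \<longlonglongrightarrow> 0"
        using elim by (intro tendsto_mult_right_zero) simp
    qed
    then show ?case
      using laplacian_L2(1)[OF H2(1)] by simp
  qed
  moreover have "simple_function M (\<lambda>t. laplacian \<Omega> (s i t))" for i
    using s(1)[of i] by (rule simple_function_compose1)
  moreover have "(\<lambda>t. laplacian \<Omega> (s i t)) ` space M \<subseteq> L2 \<Omega>" for i
  proof (rule image_subsetI)
    fix t assume "t \<in> space M"
    then have "s i t \<in> H2 \<Omega>" using s(2)[of i] D by blast
    then show "laplacian \<Omega> (s i t) \<in> L2 \<Omega>" by (rule laplacian_L2(1))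
  qed
  ultimately have bm: "meas (\<lambda>t. laplacian \<Omega> (u t))"
    unfolding bochner_measurable_def by (intro exI[of _ "\<lambda>i t. laplacian \<Omega> (s i t)"]) blast
  have "integrable M (\<lambda>t. (L2_norm \<Omega> (laplacian \<Omega> (u t)))\<^sup>2)"
  proof (rule Bochner_Integration.integrable_bound)
    show "integrable M (\<lambda>t. ?d\<^sup>2 * (H2_norm \<Omega> (u t))\<^sup>2)"
      using int by simp
    show "AE t in M. norm ((L2_norm \<Omega> (laplacian \<Omega> (u t)))\<^sup>2) \<le> norm (?d\<^sup>2 * (H2_norm \<Omega> (u t))\<^sup>2)"
      using s_ae
    proof eventually_elim
      case (elim t)
      then have "(L2_norm \<Omega> (laplacian \<Omega> (u t)))\<^sup>2 \<le> (?d * H2_norm \<Omega> (u t))\<^sup>2"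
        using D by (intro power_mono laplacian_L2(2) L2_norm_nonneg) auto
      then show ?case by (simp add: power_mult_distrib)
    qed
  qed (use borel_measurable_N[OF bm] in measurable)
  with bm show ?thesis by (simp add: L2_time_def)
qed

text \<open>The constant adds the two parts of the norm: the time derivative of the error is bounded
  by the residual with factor 1, and its H2 part by the Laplacian with the regularity constant C and
  then by the residual.\<close>

lemma parabolic_error_estimate:
  fixes \<Omega> :: "'a::euclidean_space set"
  assumes \<Omega>: "open \<Omega>" and T: "0 < T" and f: "f \<in> L2_time {0..T} (L2 \<Omega>) (L2_norm \<Omega>)"
    and reg: "\<And>v. v \<in> H2 \<Omega> \<inter> H1_0 \<Omega> \<Longrightarrow> H2_norm \<Omega> v \<le> C * L2_norm \<Omega> (laplacian \<Omega> v)" and C: "0 < C"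
    and uf: "parabolic_solution \<Omega> T f g u0 uf"
    and u: "u \<in> X_space \<Omega> T g" "has_initial_value \<Omega> T u u0"
  shows "X_norm \<Omega> T (u - uf) \<le> (1 + C) * L2_time_norm {0..T} (L2_norm \<Omega>) (parabolic_residual \<Omega> T f u)"
proof -
  interpret semi_inner_time "L2 \<Omega>" "L2_ip \<Omega>" "L2_norm \<Omega>" T
    using semi_inner_L2 T by (simp add: semi_inner_time_def semi_inner_time_axioms_def)
  let ?B = "H2 \<Omega> \<inter> H1_bc \<Omega> g"
  have X: "u \<in> H1_time {0..T} (L2 \<Omega>) (L2_norm \<Omega>)" "u \<in> L2_time {0..T} ?B (H2_norm \<Omega>)"
    "uf \<in> H1_time {0..T} (L2 \<Omega>) (L2_norm \<Omega>)" "uf \<in> L2_time {0..T} ?B (H2_norm \<Omega>)"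
    using u uf by (auto simp: X_space_def parabolic_solution_def)
  have B: "AE t in M. u t \<in> ?B" "AE t in M. uf t \<in> ?B"
    using X(2,4) by (auto simp: L2_time_def bochner_measurable_def elim: eventually_mono)
  have L: "u \<in> L2V" "uf \<in> L2V"
    using X by (auto simp: H1_time_def)
  define v where "v t = u t - uf t" for t
  have v_eq: "u - uf = v"
    by (simp add: v_def fun_eq_iff)
  have vL: "v \<in> L2V"
    unfolding v_def[abs_def] by (rule L2V_diff[OF L])
  have vD: "AE t in M. v t \<in> H2 \<Omega> \<inter> H1_0 \<Omega>"
    using B by eventually_elim (auto simp: v_def intro!: H2_diff H1_bc_diff \<Omega>)
  note dtu = time_deriv_works[OF X(1)] and dtuf = time_deriv_works[OF X(3)]
  have weak: "weak_dt v (\<lambda>t. dt \<Omega> T u t - dt \<Omega> T uf t)"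
    unfolding v_def[abs_def] by (rule has_weak_time_deriv_diff[OF dtu(2) dtuf(2)])
  have dL: "(\<lambda>t. dt \<Omega> T u t - dt \<Omega> T uf t) \<in> L2V"
    by (rule L2V_diff[OF dtu(1) dtuf(1)])
  have vH: "v \<in> H1_time {0..T} (L2 \<Omega>) (L2_norm \<Omega>)"
    using vL dL weak by (auto simp: H1_time_def)
  note dtv = time_deriv_works[OF vH]
  have vb: "meas v"
    using vL by (simp add: L2_time_def)
  \<comment> \<open>\<open>dt\<close> is a choice, so the derivative of v and the difference of
    derivatives are only equal up to vectors of norm 0.\<close>
  have p_eq: "AE t in M. dt \<Omega> T v t - (dt \<Omega> T u t - dt \<Omega> T uf t) \<in> L2 \<Omega> \<and>
      L2_norm \<Omega> (dt \<Omega> T v t - (dt \<Omega> T u t - dt \<Omega> T uf t)) = 0"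
    by (rule weak_time_deriv_unique[OF vb dtv dL weak])

  have lap: "(\<lambda>t. laplacian \<Omega> (u t)) \<in> L2V" "(\<lambda>t. laplacian \<Omega> (uf t)) \<in> L2V"
    using laplacian_L2_time[OF \<Omega> T _ X(2)] laplacian_L2_time[OF \<Omega> T _ X(4)] by auto
  have z_eq: "AE t in M. laplacian \<Omega> (v t) \<in> L2 \<Omega> \<and>
      L2_norm \<Omega> (laplacian \<Omega> (v t) - (laplacian \<Omega> (u t) - laplacian \<Omega> (uf t))) = 0"
    using B
  proof eventually_elim
    case (elim t)
    then have H: "u t \<in> H2 \<Omega>" "uf t \<in> H2 \<Omega>" by auto
    show ?case
      unfolding v_def
      using L2_norm_diff_eq_0[where v="laplacian \<Omega> (u t) - laplacian \<Omega> (uf t)", OF laplacian_diff[OF \<Omega> H]]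
        laplacian_L2(1)[OF H2_diff[OF \<Omega> H]] by simp
  qed
  \<comment> \<open>Obtained from the Laplacians of the two functions rather than from v, since
    those come with simple approximants valued in the set with boundary values g.\<close>
  have zL: "(\<lambda>t. laplacian \<Omega> (v t)) \<in> L2V"
    by (rule L2V_cong(1)[OF L2V_diff[OF lap] z_eq])

  obtain w where w: "cont_rep u w" "AE x in lebesgue_on \<Omega>. w 0 x = u0 x"
    using u(2) by (auto simp: has_initial_value_def)
  obtain wf where wf: "cont_rep uf wf" "AE x in lebesgue_on \<Omega>. wf 0 x = u0 x"
    using uf by (auto simp: has_initial_value_def parabolic_solution_def)
  have cr: "cont_rep v (\<lambda>t. w t - wf t)"
    unfolding v_def[abs_def] by (rule continuous_representative_diff[OF w(1) wf(1)])
  have "AE x in lebesgue_on \<Omega>. w 0 x = wf 0 x"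
    using w(2) wf(2) by eventually_elim simp
  then have w0: "L2_norm \<Omega> (w 0 - wf 0) = 0"
    by (rule L2_norm_diff_eq_0)

  \<comment> \<open>The abstract inequality with A the Laplacian on the functions in H2 and H1_0.
    Equal initial values of the two representatives give the zero start.\<close>
  have "(\<integral>t. L2_ip \<Omega> (dt \<Omega> T v t) (laplacian \<Omega> (v t)) \<partial>M) \<le> 0"
    by (rule weak_time_deriv_dissipative[OF dtv(2,1) vL cr w0 _ vD _ zL laplacian_dissipative[OF \<Omega>] laplacian_increment_le[OF \<Omega>]])
       (auto intro: laplacian_L2(1) H1_L2 H2_H1)
  note energy = dissipative_norm_le[OF dtv(1) zL this]

  define R where "R = L2_time_norm {0..T} (L2_norm \<Omega>) (\<lambda>t. dt \<Omega> T v t - laplacian \<Omega> (v t))"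
  have resL: "parabolic_residual \<Omega> T f u \<in> L2V"
    unfolding parabolic_residual_def by (intro L2V_diff dtu(1) lap f)
  have bmem: "AE t in M. h t \<in> L2 \<Omega>" if "h \<in> L2V" for h
    using that AE_in_V by (auto simp: L2_time_def)
  have "AE t in M. (dt \<Omega> T v t - laplacian \<Omega> (v t)) \<in> L2 \<Omega> \<and>
      L2_norm \<Omega> ((dt \<Omega> T v t - laplacian \<Omega> (v t)) - parabolic_residual \<Omega> T f u t) = 0"
  proof -
    have "AE t in M. AE x in lebesgue_on \<Omega>. dt \<Omega> T uf t x - laplacian \<Omega> (uf t) x = f t x"
      using uf by (simp add: parabolic_solution_def)
    then show ?thesis
      using p_eq z_eq bmem[OF dtv(1)] bmem[OF zL] bmem[OF resL] bmem[OF dL] bmem[OF L2V_diff[OF lap]]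
        bmem[OF dtu(1)] bmem[OF dtuf(1)] bmem[OF lap(1)] bmem[OF lap(2)] bmem[OF f]
    proof eventually_elim
      case (elim t)
      \<comment> \<open>Three sources of discrepancy, each of norm 0: the choice of time
        derivatives, the choice of spatial derivatives, and the equation solved by
        \<open>uf\<close>.\<close>
      let ?a = "dt \<Omega> T v t - (dt \<Omega> T u t - dt \<Omega> T uf t)"
      let ?b = "laplacian \<Omega> (v t) - (laplacian \<Omega> (u t) - laplacian \<Omega> (uf t))"
      let ?c = "(dt \<Omega> T uf t - laplacian \<Omega> (uf t)) - f t"
      have c0: "L2_norm \<Omega> ?c = 0"
        using elim(1) by (intro L2_norm_diff_eq_0) simp
      have V: "?a \<in> L2 \<Omega>" "?b \<in> L2 \<Omega>" "?c \<in> L2 \<Omega>"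
        using elim by (auto intro!: V_closed(3))
      have eq: "(dt \<Omega> T v t - laplacian \<Omega> (v t)) - parabolic_residual \<Omega> T f u t = (?a - ?b) - ?c"
        by (simp add: parabolic_residual_def)
      have "L2_norm \<Omega> ((?a - ?b) - ?c) \<le> L2_norm \<Omega> ?a + L2_norm \<Omega> ?b + L2_norm \<Omega> ?c"
        using N_diff_le[OF V_closed(3)[OF V(1,2)] V(3)] N_diff_le[OF V(1,2)] by linarith
      also have "\<dots> = 0"
        using elim c0 by simp
      finally have "L2_norm \<Omega> ((?a - ?b) - ?c) = 0"
        using L2_norm_nonneg[of \<Omega> "(?a - ?b) - ?c"] by linarith
      then show ?case
        unfolding eq using elim by (auto intro: V_closed(3))
    qed
  qed
  note R_eq = L2V_cong[OF resL this]
  have R: "L2_time_norm {0..T} (L2_norm \<Omega>) (parabolic_residual \<Omega> T f u) = R"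
  proof -
    have "(\<integral>t. (L2_norm \<Omega> (dt \<Omega> T v t - laplacian \<Omega> (v t)))\<^sup>2 \<partial>M)
        = (\<integral>t. (L2_norm \<Omega> (parabolic_residual \<Omega> T f u t))\<^sup>2 \<partial>M)"
    proof (rule integral_cong_AE)
      show "AE t in M. (L2_norm \<Omega> (dt \<Omega> T v t - laplacian \<Omega> (v t)))\<^sup>2 = (L2_norm \<Omega> (parabolic_residual \<Omega> T f u t))\<^sup>2"
        using R_eq(2) by eventually_elim simp
    qed (use R_eq(1) resL in \<open>auto simp: L2_time_def\<close>)
    then show ?thesis
      by (simp add: R_def L2_time_norm_def)
  qed
  have "L2_time_norm {0..T} (H2_norm \<Omega>) v \<le> C * L2_time_norm {0..T} (L2_norm \<Omega>) (\<lambda>t. laplacian \<Omega> (v t))"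
  proof -
    have "(\<integral>t. (H2_norm \<Omega> (v t))\<^sup>2 \<partial>M) \<le> (\<integral>t. C\<^sup>2 * (L2_norm \<Omega> (laplacian \<Omega> (v t)))\<^sup>2 \<partial>M)"
    \<comment> \<open>Integrability is supplied for the nonnegative majorant; a left side that
      failed to be integrable would have integral 0 by convention.\<close>
    proof (rule integral_mono_AE')
      show "integrable M (\<lambda>t. C\<^sup>2 * (L2_norm \<Omega> (laplacian \<Omega> (v t)))\<^sup>2)"
        using zL by (simp add: L2_time_def)
      show "AE t in M. (H2_norm \<Omega> (v t))\<^sup>2 \<le> C\<^sup>2 * (L2_norm \<Omega> (laplacian \<Omega> (v t)))\<^sup>2"
        using vD
      proof eventually_elim
        case (elim t)
        have "0 \<le> H2_norm \<Omega> (v t)"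
          unfolding H2_norm_def by (intro real_sqrt_ge_zero add_nonneg_nonneg sum_nonneg) auto
        then have "(H2_norm \<Omega> (v t))\<^sup>2 \<le> (C * L2_norm \<Omega> (laplacian \<Omega> (v t)))\<^sup>2"
          using reg[OF elim] by (intro power_mono)
        then show ?case by (simp add: power_mult_distrib)
      qed
    qed simp
    then have "sqrt (\<integral>t. (H2_norm \<Omega> (v t))\<^sup>2 \<partial>M) \<le> sqrt (C\<^sup>2 * (\<integral>t. (L2_norm \<Omega> (laplacian \<Omega> (v t)))\<^sup>2 \<partial>M))"
      by simp
    then show ?thesis
      using C by (simp add: L2_time_norm_def real_sqrt_mult)
  qed
  also have "\<dots> \<le> C * R"
    using energy(2) C by (intro mult_left_mono) (auto simp: R_def)
  finally have "X_norm \<Omega> T v \<le> R + C * R"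
    unfolding X_norm_def using energy(1) by (simp add: R_def)
  then show ?thesis
    by (simp add: v_eq R algebra_simps)
qed

theorem theorem15:
  fixes \<Omega> :: "(real ^ 'd) set"
    and T :: real
    and f :: "real \<Rightarrow> real ^ 'd \<Rightarrow> real"
    and g :: "(real ^ 'd \<Rightarrow> real) set"
    and u0 :: "real ^ 'd \<Rightarrow> real"
    and uf :: "real \<Rightarrow> real ^ 'd \<Rightarrow> real"
    and \<Theta> :: "(real ^ 'N) set"
    and U :: "real ^ 'N \<Rightarrow> real \<Rightarrow> real ^ 'd \<Rightarrow> real"
  assumes "open \<Omega>" and "connected \<Omega>" and "\<Omega> \<noteq> {}"
    and "H2_regular \<Omega>"
    and "0 < T"
    and "f \<in> L2_time {0..T} (L2 \<Omega>) (L2_norm \<Omega>)"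
    and "g \<in> H32_boundary \<Omega>"
    and "u0 \<in> H1_0 \<Omega>"
    and "parabolic_solution \<Omega> T f g u0 uf"
    and "\<And>\<theta>. \<theta> \<in> \<Theta> \<Longrightarrow> U \<theta> \<in> X_space \<Omega> T g"
    and "\<And>\<theta>. \<theta> \<in> \<Theta> \<Longrightarrow> has_initial_value \<Omega> T (U \<theta>) u0"
  shows "\<exists>C. \<forall>\<theta>\<in>\<Theta>. X_norm \<Omega> T (U \<theta> - uf) \<le> C * sqrt (loss \<Omega> T f U \<theta>)"
proof -
  have "\<exists>C>0. \<forall>u \<in> H2 \<Omega> \<inter> H1_0 \<Omega>. H2_norm \<Omega> u \<le> C * L2_norm \<Omega> (laplacian \<Omega> u)"
    using assms(4) unfolding H2_regular_def by (rule conjunct1)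
  then obtain C where C: "0 < C" "\<And>v. v \<in> H2 \<Omega> \<inter> H1_0 \<Omega> \<Longrightarrow> H2_norm \<Omega> v \<le> C * L2_norm \<Omega> (laplacian \<Omega> v)"
    by blast
  \<comment> \<open>C comes from the regularity of \<Omega> and was fixed before \<theta>, so 1 + C
    serves the whole family.\<close>
  have "X_norm \<Omega> T (U \<theta> - uf) \<le> (1 + C) * sqrt (loss \<Omega> T f U \<theta>)" if "\<theta> \<in> \<Theta>" for \<theta>
  proof -
    have "sqrt (loss \<Omega> T f U \<theta>) = L2_time_norm {0..T} (L2_norm \<Omega>) (parabolic_residual \<Omega> T f (U \<theta>))"
      by (simp add: loss_def L2_time_norm_def)
    then show ?thesis
      using parabolic_error_estimate[OF assms(1,5,6) C(2,1) assms(9) assms(10)[OF that] assms(11)[OF that]] by simp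
  qed
  then show ?thesis by blast
qed

end
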